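(* Let $P$ and $Q$ be $c$-packed sequences of points in $\mathbb{R}^d$ with a total of $n$ vertices. For any $\varepsilon\in(0,1)$, there exists a $(1+\varepsilon)$-approximation algorithm for the strong discrete Fréchet distance of $P$ and $Q$ that runs in $O\!\left(\frac{cn}{\varepsilon}\right)$ time.
   Context: A sequence $P=(p_1,\dots,p_k)$ is a finite sequence of points (vertices) in $\mathbb{R}^d$ with no two consecutive points equal; its polygonal curve $\overline{P}$ is formed by connecting consecutive points by segments. For $c>0$, the curve $\overline P$ (and the sequence $P$) is $c$-packed if for all $p\in\mathbb{R}^d$ and $r>0$ the length of $\overline{P}$ inside the ball $B(p,r)$ of radius $r$ centered at $p$ is at most $cr$. For $P=(p_1,\dots,p_k)$ and $Q=(q_1,\dots,q_l)$, a discrete alignment is a sequence of index pairs $(i_1,j_1),\dots,(i_s,j_s)$ in $\{1,\dots,k\}\times\{1,\dots,l\}$ with $(i_1,j_1)=(1,1)$, $(i_s,j_s)=(k,l)$, and $\|(i_t,j_t)-(i_{t+1},j_{t+1})\|_\infty=1$ for all $t$. It is monotone if $i_t\le i_{t+1}$ and $j_t\le j_{t+1}$ for all $t$. Its pass is $\max_t\|p_{i_t}-q_{j_t}\|$ (Euclidean norm). The strong discrete Fréchet distance of $P$ and $Q$ is the minimum pass over all monotone discrete alignments. A $(1+\varepsilon)$-approximation algorithm computes this value up to a factor of $1+\varepsilon$. *)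

theory Defs
  imports "HOL-Analysis.Analysis"
begin

section \<open>Sequences of points and packedness\<close>

definition point_sequence :: "'a list \<Rightarrow> bool" where
  "point_sequence P \<longleftrightarrow> P \<noteq> [] \<and> (\<forall>i. Suc i < length P \<longrightarrow> P ! i \<noteq> P ! Suc i)"

text \<open>The length is that of the curve, so parts of space that the curve traverses several
  times are counted with multiplicity.  On each edge, parametrised over the unit interval with
  constant speed, the length inside the ball is the speed times the measure of the set of
  parameters that are mapped into the ball.\<close>

definition length_in_ball :: "'a::euclidean_space list \<Rightarrow> 'a \<Rightarrow> real \<Rightarrow> real" where
  "length_in_ball P p r =
     (\<Sum>i<length P - 1.
        measure lborel {t \<in> {0..1}. linepath (P ! i) (P ! Suc i) t \<in> cball p r}
          * dist (P ! i) (P ! Suc i))"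

definition packed :: "real \<Rightarrow> 'a::euclidean_space list \<Rightarrow> bool" where
  "packed c P \<longleftrightarrow> (\<forall>p. \<forall>r>0. length_in_ball P p r \<le> c * r)"

section \<open>The strong discrete Frechet distance\<close>

text \<open>Indices start at 0.\<close>

definition discrete_alignment :: "nat \<Rightarrow> nat \<Rightarrow> (nat \<times> nat) list \<Rightarrow> bool" where
  "discrete_alignment k l A \<longleftrightarrow>
     A \<noteq> [] \<and> set A \<subseteq> {..<k} \<times> {..<l} \<and> hd A = (0, 0) \<and> last A = (k - 1, l - 1) \<and>
     (\<forall>t. Suc t < length A \<longrightarrow>
        max \<bar>int (fst (A ! t)) - int (fst (A ! Suc t))\<bar>
            \<bar>int (snd (A ! t)) - int (snd (A ! Suc t))\<bar> = 1)"

definition monotone_alignment :: "(nat \<times> nat) list \<Rightarrow> bool" where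
  "monotone_alignment A \<longleftrightarrow>
     (\<forall>t. Suc t < length A \<longrightarrow>
        fst (A ! t) \<le> fst (A ! Suc t) \<and> snd (A ! t) \<le> snd (A ! Suc t))"

definition pass :: "'a::metric_space list \<Rightarrow> 'a list \<Rightarrow> (nat \<times> nat) list \<Rightarrow> real" where
  "pass P Q A = Max ((\<lambda>(i, j). dist (P ! i) (Q ! j)) ` set A)"

definition strong_frechet :: "'a::metric_space list \<Rightarrow> 'a list \<Rightarrow> real" where
  "strong_frechet P Q =
     Min {pass P Q A | A. discrete_alignment (length P) (length Q) A \<and> monotone_alignment A}"

section \<open>The real RAM\<close>

text \<open>A real RAM has two memories, one of natural numbers (counters, indices, pointers) and one
  of real numbers, both addressed by natural numbers with indirect addressing.  Natural numbers
  can be added, subtracted (truncated at 0) and compared; reals admit exact field operations,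
  square roots and comparisons.  There is no multiplication on natural numbers and no rounding or
  other conversion from reals to natural numbers; at unit cost these would be unrealistically
  powerful.  Real constants are integers.  Division by 0
  and roots of negative numbers have their HOL values; a program can test for these cases.\<close>

type_synonym ram_state = "(nat \<Rightarrow> nat) \<times> (nat \<Rightarrow> real)"

datatype nexp =
    NConst nat
  | NLoad nexp
  | NAdd nexp nexp
  | NSub nexp nexp

datatype rexp =
    RConst int
  | RLoad nexp
  | RAdd rexp rexp
  | RSub rexp rexp
  | RMul rexp rexp
  | RDiv rexp rexp
  | RSqrt rexp

datatype bexp =
    NLess nexp nexp
  | RLess rexp rexp
  | BNot bexp
  | BAnd bexp bexp

datatype com =
    Skip
  | NStore nexp nexp
  | RStore nexp rexp
  | Seq com com
  | Cond bexp com com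
  | While bexp com

fun nval :: "nexp \<Rightarrow> ram_state \<Rightarrow> nat" where
  "nval (NConst m) s = m"
| "nval (NLoad a) s = fst s (nval a s)"
| "nval (NAdd a b) s = nval a s + nval b s"
| "nval (NSub a b) s = nval a s - nval b s"

fun rval :: "rexp \<Rightarrow> ram_state \<Rightarrow> real" where
  "rval (RConst z) s = of_int z"
| "rval (RLoad a) s = snd s (nval a s)"
| "rval (RAdd a b) s = rval a s + rval b s"
| "rval (RSub a b) s = rval a s - rval b s"
| "rval (RMul a b) s = rval a s * rval b s"
| "rval (RDiv a b) s = rval a s / rval b s"
| "rval (RSqrt a) s = sqrt (rval a s)"

fun bval :: "bexp \<Rightarrow> ram_state \<Rightarrow> bool" where
  "bval (NLess a b) s \<longleftrightarrow> nval a s < nval b s"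
| "bval (RLess a b) s \<longleftrightarrow> rval a s < rval b s"
| "bval (BNot b) s \<longleftrightarrow> \<not> bval b s"
| "bval (BAnd b b') s \<longleftrightarrow> bval b s \<and> bval b' s"

text \<open>Unit costs: every constant, memory access, operation, comparison and connective takes one
  time step.\<close>

fun ncost :: "nexp \<Rightarrow> nat" where
  "ncost (NConst m) = 1"
| "ncost (NLoad a) = 1 + ncost a"
| "ncost (NAdd a b) = 1 + ncost a + ncost b"
| "ncost (NSub a b) = 1 + ncost a + ncost b"

fun rcost :: "rexp \<Rightarrow> nat" where
  "rcost (RConst z) = 1"
| "rcost (RLoad a) = 1 + ncost a"
| "rcost (RAdd a b) = 1 + rcost a + rcost b"
| "rcost (RSub a b) = 1 + rcost a + rcost b"
| "rcost (RMul a b) = 1 + rcost a + rcost b"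
| "rcost (RDiv a b) = 1 + rcost a + rcost b"
| "rcost (RSqrt a) = 1 + rcost a"

fun bcost :: "bexp \<Rightarrow> nat" where
  "bcost (NLess a b) = 1 + ncost a + ncost b"
| "bcost (RLess a b) = 1 + rcost a + rcost b"
| "bcost (BNot b) = 1 + bcost b"
| "bcost (BAnd b b') = 1 + bcost b + bcost b'"

text \<open>\<open>exec p s t s'\<close>: started in state \<open>s\<close>, the program \<open>p\<close> halts in state \<open>s'\<close> after exactly
  \<open>t\<close> time steps.\<close>

inductive exec :: "com \<Rightarrow> ram_state \<Rightarrow> nat \<Rightarrow> ram_state \<Rightarrow> bool" where
  Skip: "exec Skip s 1 s"
| NStore: "exec (NStore a e) s (1 + ncost a + ncost e) ((fst s)(nval a s := nval e s), snd s)"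
| RStore: "exec (RStore a e) s (1 + ncost a + rcost e) (fst s, (snd s)(nval a s := rval e s))"
| Seq: "exec p s t s' \<Longrightarrow> exec q s' t' s'' \<Longrightarrow> exec (Seq p q) s (t + t') s''"
| CondTrue: "bval b s \<Longrightarrow> exec p s t s' \<Longrightarrow> exec (Cond b p q) s (1 + bcost b + t) s'"
| CondFalse: "\<not> bval b s \<Longrightarrow> exec q s t s' \<Longrightarrow> exec (Cond b p q) s (1 + bcost b + t) s'"
| WhileFalse: "\<not> bval b s \<Longrightarrow> exec (While b p) s (1 + bcost b) s"
| WhileTrue: "bval b s \<Longrightarrow> exec p s t s' \<Longrightarrow> exec (While b p) s' t' s'' \<Longrightarrow>
    exec (While b p) s (1 + bcost b + t + t') s''"

section \<open>Input and output\<close>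

definition coords :: "real ^ 'n \<Rightarrow> real list" where
  "coords x = map (\<lambda>i. x $ i) (SOME js :: 'n list. distinct js \<and> set js = UNIV)"

text \<open>The natural-number memory holds the two lengths, the real memory holds the accuracy
  parameter followed by the coordinates of the points of the first and of the second sequence;
  all other cells are 0.  A packedness constant is not part of the input.\<close>

definition load_list :: "'a::zero list \<Rightarrow> nat \<Rightarrow> 'a" where
  "load_list xs i = (if i < length xs then xs ! i else 0)"

definition input_state :: "real \<Rightarrow> (real ^ 'n) list \<Rightarrow> (real ^ 'n) list \<Rightarrow> ram_state" where
  "input_state \<epsilon> P Q =
     (load_list [length P, length Q], load_list (\<epsilon> # concat (map coords (P @ Q))))"

definition ram_output :: "ram_state \<Rightarrow> real" where
  "ram_output s = snd s 0"

end

theory Submission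
  imports Defs
begin

text \<open>
  The index range of each curve is organised as a binary tree.  A pair of nodes of the two trees is
  separated if the lengths of the two subcurves are small (a factor \<open>\<epsilon> / 4\<close>) compared with their distance;
  otherwise the longer subcurve is split.  The separated pairs form a partition of the grid of
  all index pairs into rectangles on which the distance is almost constant.  Processing the
  rectangles in the order of the recursion, one computes for each of them the largest distance that has to
  be paid on a path from the start, allowing a path to move freely inside a rectangle, also backwards.
  Such a path moves backwards only inside subcurves that are short compared with its own cost, so this
  relaxation is harmless.

  Since a rectangle is a product of tree nodes, the values along the frontier of the
  processed rectangles can be kept in the trees like in a segment tree with lazy propagation, and each
  recursive call takes constant time.  The trees are built in linear time with a stack, in such a way that
  a node together with the edge that follows it has at least a third of the length of its parent.
  Packedness then bounds the number of pairs in which a given node \<open>X\<close> is split by \<open>O(c / \<epsilon>)\<close>: their partners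
  are disjoint, close to \<open>X\<close>, and own a piece of curve of length at least \<open>len X / 3\<close> each.
  No search over distances is needed, and hence there is no logarithmic factor.
\<close>

section \<open>Trees of index intervals\<close>

text \<open>Balance is a matter of lengths, not of vertex counts; the depth of a tree never enters.
  A node may be arbitrarily short (a leaf has length 0), so it is the edge behind it that lets it
  pay for a split of its partner. The last vertex of a curve has no such edge; this costs one extra
  charge per inner node, hence O(n) in all. The error budget is one-sided in each direction. With
  \<open>s\<close> the true distance and \<open>v\<close> the value of the recursion, separation by
  \<open>eps / 4\<close> gives \<open>(1 - eps / 4) * v \<le> s\<close> and
  \<open>s \<le> (1 + eps / 2) * v\<close>. So \<open>(1 + eps / 2) * v\<close> is output, and
  \<open>1 + eps / 2 \<le> (1 + eps) * (1 - eps / 4)\<close> for \<open>eps < 1\<close> closes the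
  estimate. The two curves share one index range, the first curve on \<open>0..<k\<close> and the
  second on \<open>k..<k + l\<close>. One frontier function, one numbering of nodes and one memory
  then serve both trees, and exchanging their roles is free.\<close>

datatype itree = Lf nat | Nd itree itree

fun lo :: "itree \<Rightarrow> nat" where
  "lo (Lf i) = i"
| "lo (Nd a b) = lo a"

fun hi :: "itree \<Rightarrow> nat" where
  "hi (Lf i) = i"
| "hi (Nd a b) = hi b"

fun wf_tree :: "itree \<Rightarrow> bool" where
  "wf_tree (Lf i) \<longleftrightarrow> True"
| "wf_tree (Nd a b) \<longleftrightarrow> wf_tree a \<and> wf_tree b \<and> lo b = Suc (hi a)"

fun subs :: "itree \<Rightarrow> itree set" where
  "subs (Lf i) = {Lf i}"
| "subs (Nd a b) = insert (Nd a b) (subs a \<union> subs b)"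

definition rng :: "itree \<Rightarrow> nat set" where
  "rng T = {lo T..hi T}"

fun isum :: "(itree \<Rightarrow> real) \<Rightarrow> itree \<Rightarrow> real" where
  "isum g (Lf i) = 0"
| "isum g (Nd a b) = g (Nd a b) + isum g a + isum g b"

lemma lo_le_hi: "wf_tree T \<Longrightarrow> lo T \<le> hi T"
  by (induction T) auto

lemma rng_ne [simp]: "wf_tree T \<Longrightarrow> rng T \<noteq> {}"
  using lo_le_hi by (auto simp: rng_def)

lemma finite_rng [simp]: "finite (rng T)"
  by (simp add: rng_def)

lemma rng_Lf [simp]: "rng (Lf i) = {i}"
  by (simp add: rng_def)

lemma rng_Nd: "wf_tree (Nd a b) \<Longrightarrow> rng (Nd a b) = rng a \<union> rng b"
  using lo_le_hi[of a] lo_le_hi[of b] by (auto simp: rng_def)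

lemma rng_Nd_disj: "wf_tree (Nd a b) \<Longrightarrow> rng a \<inter> rng b = {}"
  by (auto simp: rng_def)

lemma lo_hi_rng [simp]: "wf_tree T \<Longrightarrow> lo T \<in> rng T" "wf_tree T \<Longrightarrow> hi T \<in> rng T"
  using lo_le_hi by (auto simp: rng_def)

lemma self_subs [simp]: "T \<in> subs T"
  by (cases T) auto

lemma wf_subs: "wf_tree T \<Longrightarrow> X \<in> subs T \<Longrightarrow> wf_tree X"
  by (induction T) auto

lemma rng_subs: "wf_tree T \<Longrightarrow> X \<in> subs T \<Longrightarrow> rng X \<subseteq> rng T"
proof (induction T)
  case (Nd a b)
  then show ?case using rng_Nd[OF Nd.prems(1)] by auto
qed auto

lemma isum_add: "isum (\<lambda>I. g I + h I) T = isum g T + isum h T"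
  by (induction T) auto

lemma isum_nonneg: "(\<And>I. I \<in> subs T \<Longrightarrow> 0 \<le> g I) \<Longrightarrow> 0 \<le> isum g T"
  by (induction T) auto

lemma isum_le:
  "wf_tree T \<Longrightarrow> (\<And>a b. Nd a b \<in> subs T \<Longrightarrow> g (Nd a b) \<le> B) \<Longrightarrow> isum g T \<le> real (hi T - lo T) * B"
proof (induction T)
  case (Nd a b)
  have "isum g a \<le> real (hi a - lo a) * B" "isum g b \<le> real (hi b - lo b) * B"
    using Nd by auto
  moreover have "g (Nd a b) \<le> B" using Nd.prems by auto
  moreover have "real (hi (Nd a b) - lo (Nd a b)) = 1 + real (hi a - lo a) + real (hi b - lo b)"
    using Nd.prems(1) lo_le_hi[of a] lo_le_hi[of b] by auto
  ultimately show ?case by (simp add: algebra_simps)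
qed auto

section \<open>The recursion over pairs of subcurves\<close>

text \<open>The initial piece of the edge of length \<open>min s (dist u v)\<close> stays within
  \<open>s\<close> of \<open>u\<close>, hence in the ball. This converts a nearby vertex into curve
  length that packedness can count.\<close>

lemma length_in_cball_ge:
  fixes u v z :: "'a::euclidean_space"
  assumes "dist z u + s \<le> r" "0 \<le> s"
  shows "min s (dist u v) \<le> measure lborel {t \<in> {0..1}. linepath u v t \<in> cball z r} * dist u v"
proof (cases "u = v")
  case False
  then have d: "0 < dist u v" by simp
  let ?S = "{t \<in> {0..1}. linepath u v t \<in> cball z r}"
  define q where "q = min s (dist u v) / dist u v"
  have q: "0 \<le> q" "q \<le> 1" "q * dist u v = min s (dist u v)"
    using d assms by (auto simp: q_def divide_simps)
  have eq: "?S = {0..1} \<inter> linepath u v -` cball z r" by auto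
  have cl: "closed ?S"
    unfolding eq by (intro continuous_closed_preimage) auto
  have sub: "{0..q} \<subseteq> ?S"
  proof
    fix t assume t: "t \<in> {0..q}"
    have "dist u (linepath u v t) = t * dist u v"
      using t by (simp add: linepath_def dist_norm algebra_simps flip: scaleR_diff_right)
    also have "\<dots> \<le> q * dist u v" using t by (intro mult_right_mono) auto
    also have "\<dots> \<le> s" using q by simp
    finally have "dist z (linepath u v t) \<le> r"
      using assms(1) dist_triangle[of z "linepath u v t" u] by linarith
    then show "t \<in> ?S" using t q by auto
  qed
  have "emeasure lborel ?S \<le> emeasure lborel {0..1::real}"
    by (intro emeasure_mono) auto
  then have "emeasure lborel ?S < \<infinity>" by (rule le_less_trans) simp
  then have fm: "?S \<in> fmeasurable lborel" using cl by (intro fmeasurableI) (simp_all add: borel_closed)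
  have "q = measure lborel {0..q}" using q by simp
  also have "\<dots> \<le> measure lborel ?S"
    by (rule measure_mono_fmeasurable[OF sub _ fm]) simp
  finally have "q * dist u v \<le> measure lborel ?S * dist u v"
    using d by (intro mult_right_mono) auto
  then show ?thesis using q by simp
qed simp

section \<open>Two curves on one index range: lengths and separation\<close>

locale two_curves =
  fixes k l :: nat and eps :: real and pt :: "nat \<Rightarrow> 'a::euclidean_space"
  assumes k_pos: "0 < k" and l_pos: "0 < l" and eps_pos: "0 < eps" and eps_less: "eps < 1"
    and pt_neq: "\<And>m. Suc m < k + l \<Longrightarrow> Suc m \<noteq> k \<Longrightarrow> pt m \<noteq> pt (Suc m)"
begin

definition lst :: "nat \<Rightarrow> bool" where
  "lst m \<longleftrightarrow> Suc m = k \<or> Suc m = k + l"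

definition el :: "nat \<Rightarrow> real" where
  "el m = (if lst m then 0 else dist (pt m) (pt (Suc m)))"

fun len :: "itree \<Rightarrow> real" where
  "len (Lf i) = 0"
| "len (Nd a b) = len a + el (hi a) + len b"

definition wt :: "itree \<Rightarrow> real" where
  "wt T = len T + el (hi T)"

definition inseq :: "itree \<Rightarrow> bool" where
  "inseq T \<longleftrightarrow> wf_tree T \<and> (hi T < k \<or> (k \<le> lo T \<and> hi T < k + l))"

lemma el_nonneg: "0 \<le> el m"
  by (simp add: el_def)

lemma len_nonneg: "0 \<le> len T"
  by (induction T) (auto simp: el_nonneg)

lemma inseq_Nd:
  assumes "inseq (Nd a b)"
  shows "inseq a" "inseq b" "\<not> lst (hi a)"
  using assms lo_le_hi[of a] lo_le_hi[of b] unfolding inseq_def lst_def by auto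

lemma inseq_subs: "inseq T \<Longrightarrow> X \<in> subs T \<Longrightarrow> inseq X"
  by (induction T) (auto dest: inseq_Nd)

lemma el_pos: "inseq (Nd a b) \<Longrightarrow> 0 < el (hi a)"
proof -
  assume *: "inseq (Nd a b)"
  have "\<not> lst (hi a)" using inseq_Nd[OF *] by simp
  moreover have "Suc (hi a) < k + l" using * lo_le_hi[of b] \<open>\<not> lst (hi a)\<close> unfolding inseq_def lst_def by auto
  ultimately show ?thesis using pt_neq[of "hi a"] by (auto simp: el_def lst_def)
qed

lemma len_pos: "inseq (Nd a b) \<Longrightarrow> 0 < len (Nd a b)"
  using el_pos[of a b] len_nonneg[of a] len_nonneg[of b] by simp

lemma dist_le_len:
  "inseq T \<Longrightarrow> x \<in> rng T \<Longrightarrow> y \<in> rng T \<Longrightarrow> dist (pt x) (pt y) \<le> len T"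
proof (induction T arbitrary: x y)
  case (Nd a b)
  note ab = inseq_Nd[OF Nd.prems(1)]
  have wf: "wf_tree (Nd a b)" using Nd.prems(1) by (simp add: inseq_def)
  have nn: "0 \<le> len a" "0 \<le> len b" "0 \<le> el (hi a)" by (simp_all add: len_nonneg el_nonneg)
  have cross: "dist (pt x) (pt y) \<le> len (Nd a b)" if "x \<in> rng a" "y \<in> rng b" for x y
  proof -
    have "dist (pt x) (pt (hi a)) \<le> len a" using Nd.IH(1) ab that wf by simp
    moreover have "dist (pt (lo b)) (pt y) \<le> len b" using wf that by (intro Nd.IH(2) ab lo_hi_rng) simp_all
    moreover have "dist (pt (hi a)) (pt (lo b)) = el (hi a)" using ab wf by (simp add: el_def)
    moreover have "dist (pt x) (pt y) \<le> dist (pt x) (pt (hi a)) + dist (pt (hi a)) (pt (lo b)) + dist (pt (lo b)) (pt y)"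
      using dist_triangle[of "pt x" "pt y" "pt (hi a)"] dist_triangle[of "pt (hi a)" "pt y" "pt (lo b)"]
      by linarith
    ultimately show ?thesis by simp
  qed
  show ?case
    using Nd.prems(2,3) rng_Nd[OF wf] cross[of x y] cross[of y x] Nd.IH(1)[OF ab(1), of x y]
      Nd.IH(2)[OF ab(2), of x y] nn by (auto simp: dist_commute)
qed auto

text \<open>Only first vertices are compared, so that the test takes constant time. Two leaves have
  length 0 and are always separated, which ends the recursion.\<close>

definition sep :: "itree \<Rightarrow> itree \<Rightarrow> bool" where
  "sep X Y \<longleftrightarrow> 4 * (len X + len Y) \<le> eps * dist (pt (lo X)) (pt (lo Y))"

lemma sep_commute: "sep X Y \<longleftrightarrow> sep Y X"
  by (simp add: sep_def dist_commute add.commute)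

lemma not_sep_Lf: "\<not> sep (Lf i) Y \<Longrightarrow> \<not> len (Lf i) < len Y \<Longrightarrow> False"
  using len_nonneg[of Y] eps_pos by (simp add: sep_def)

text \<open>The recursion scheme shared by \<open>dp\<close>, \<open>cnt\<close> and their proofs. A
  swap is a step of its own so that the tree to be split always comes first; since lengths are
  compared strictly, no swap follows a swap.\<close>

lemma pair_induct [case_names sep swap split]:
  assumes "\<And>X Y. sep X Y \<Longrightarrow> R X Y"
    and "\<And>X Y. \<not> sep X Y \<Longrightarrow> len X < len Y \<Longrightarrow> R Y X \<Longrightarrow> R X Y"
    and "\<And>a b Y. \<not> sep (Nd a b) Y \<Longrightarrow> len Y \<le> len (Nd a b) \<Longrightarrow> R a Y \<Longrightarrow> R b Y \<Longrightarrow> R (Nd a b) Y"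
  shows "R X Y"
proof (induction "size X + size Y" arbitrary: X Y rule: less_induct)
  case less
  have main: "R X Y" if IH: "\<And>X' Y'. size X' + size Y' < size X + size Y \<Longrightarrow> R X' Y'"
    and ns: "\<not> sep X Y" and le: "len Y \<le> len X" for X Y
  proof (cases X)
    case (Lf i)
    then show ?thesis using not_sep_Lf[of i Y] ns le by simp
  next
    case (Nd a b)
    have "R a Y" "R b Y" by (rule IH, simp add: Nd)+
    then show ?thesis using assms(3)[of a b Y] ns le unfolding Nd by blast
  qed
  show ?case
  proof (cases "sep X Y")
    case True
    then show ?thesis by (rule assms(1))
  next
    case ns: False
    show ?thesis
    proof (cases "len X < len Y")
      case True
      have "R Y X"
      proof (rule main)
        show "R X' Y'" if "size X' + size Y' < size Y + size X" for X' Y'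
          using that by (intro less) simp
      qed (use ns True sep_commute in auto)
      then show ?thesis using assms(2) ns True by blast
    next
      case False
      show ?thesis
        by (rule main) (use ns False less in auto)
    qed
  qed
qed

text \<open>\<open>dp\<close> transforms the frontier \<open>F\<close>.  When the rectangle \<open>X\<close>, \<open>Y\<close> is entered, \<open>F y\<close> is the value of the
  pair left of row \<open>y\<close> and \<open>F x\<close> the value of the pair below column \<open>x\<close>; afterwards \<open>F\<close> has the values in the
  last column and in the last row.  The value \<open>c\<close> belongs to the pair diagonally before the rectangle.\<close>

definition leafval :: "itree \<Rightarrow> itree \<Rightarrow> real \<Rightarrow> (nat \<Rightarrow> real) \<Rightarrow> real" where
  "leafval X Y c F = max (dist (pt (lo X)) (pt (lo Y))) (min c (min (Min (F ` rng X)) (Min (F ` rng Y))))"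

function dp :: "itree \<Rightarrow> itree \<Rightarrow> real \<Rightarrow> (nat \<Rightarrow> real) \<Rightarrow> nat \<Rightarrow> real" where
  "dp X Y c F =
     (if sep X Y then (\<lambda>m. if m \<in> rng X \<union> rng Y then leafval X Y c F else F m)
      else if len X < len Y then dp Y X c F
      else case X of Lf i \<Rightarrow> F | Nd a b \<Rightarrow> dp b Y (F (hi a)) (dp a Y c F))"
  by auto
termination
  by (relation "measures [\<lambda>(X, Y, c, F). size X + size Y, \<lambda>(X, Y, c, F). if len X < len Y then 1 else 0]")
    auto

declare dp.simps [simp del]

text \<open>Iterations of the loop with an explicit stack are counted, not calls: a split pair is
  met once to push its children and, after both of them, once more to combine their results. By
  \<open>not_sep_Lf\<close> the branch \<open>Lf\<close> cannot occur.\<close>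

function cnt :: "itree \<Rightarrow> itree \<Rightarrow> nat" where
  "cnt X Y =
     (if sep X Y then 1
      else if len X < len Y then Suc (cnt Y X)
      else case X of Lf i \<Rightarrow> 0 | Nd a b \<Rightarrow> Suc (cnt a Y + (cnt b Y + 1)))"
  by auto
termination
  by (relation "measures [\<lambda>(X, Y). size X + size Y, \<lambda>(X, Y). if len X < len Y then 1 else 0]")
    auto

declare cnt.simps [simp del]

text \<open>Positions are shifted by one, so \<open>(lo X, lo Y)\<close> is the corner diagonally
  before the rectangle and no predecessor of 0 is needed. \<open>Rl\<close> relates a stored value
  to its position; lower and upper bounds, nonnegativity and mere locality of \<open>dp\<close> are
  instances.\<close>

definition pre :: "(real \<Rightarrow> nat \<Rightarrow> nat \<Rightarrow> bool) \<Rightarrow> itree \<Rightarrow> itree \<Rightarrow> real \<Rightarrow> (nat \<Rightarrow> real) \<Rightarrow> bool" where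
  "pre Rl X Y c F \<longleftrightarrow> Rl c (lo X) (lo Y) \<and> (\<forall>y\<in>rng Y. Rl (F y) (lo X) (Suc y)) \<and>
     (\<forall>x\<in>rng X. Rl (F x) (Suc x) (lo Y))"

definition post :: "(real \<Rightarrow> nat \<Rightarrow> nat \<Rightarrow> bool) \<Rightarrow> itree \<Rightarrow> itree \<Rightarrow> (nat \<Rightarrow> real) \<Rightarrow> bool" where
  "post Rl X Y F \<longleftrightarrow> (\<forall>y\<in>rng Y. Rl (F y) (Suc (hi X)) (Suc y)) \<and>
     (\<forall>x\<in>rng X. Rl (F x) (Suc x) (Suc (hi Y)))"

definition leaf_ok :: "(real \<Rightarrow> nat \<Rightarrow> nat \<Rightarrow> bool) \<Rightarrow> itree \<Rightarrow> itree \<Rightarrow> bool" where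
  "leaf_ok Rl X Y \<longleftrightarrow> (\<forall>X'\<in>subs X. \<forall>Y'\<in>subs Y. \<forall>c F. sep X' Y' \<longrightarrow> pre Rl X' Y' c F \<longrightarrow>
     (\<forall>x\<in>rng X'. \<forall>y\<in>rng Y'. Rl (leafval X' Y' c F) (Suc x) (Suc y)))"

lemma leafval_commute: "leafval X Y c F = leafval Y X c F"
  by (simp add: leafval_def dist_commute min.commute min.left_commute)

text \<open>Splitting passes frontier conditions from one part to the next whatever
  \<open>Rl\<close> says, so only separated rectangles need an argument of their own.
  \<open>Rl\<close> has to vary in the induction because a swap transposes its two
  positions.\<close>

lemma dp_invariant:
  assumes "wf_tree X" "wf_tree Y" "rng X \<inter> rng Y = {}" "pre Rl X Y c F" "leaf_ok Rl X Y"
  shows "post Rl X Y (dp X Y c F) \<and> (\<forall>m. m \<notin> rng X \<union> rng Y \<longrightarrow> dp X Y c F m = F m)"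
  using assms
proof (induction X Y arbitrary: Rl c F rule: pair_induct)
  case (sep X Y)
  have "Rl (leafval X Y c F) (Suc x) (Suc y)" if "x \<in> rng X" "y \<in> rng Y" for x y
    using sep.prems(5)[unfolded leaf_ok_def, rule_format, OF self_subs self_subs sep.hyps sep.prems(4)] that .
  then show ?case using sep by (auto simp: dp.simps[of X] post_def)
next
  case (swap X Y)
  let ?Rl = "\<lambda>x i j. Rl x j i"
  have "pre ?Rl Y X c F" using swap.prems by (auto simp: pre_def)
  moreover have "leaf_ok ?Rl Y X"
    unfolding leaf_ok_def
  proof (intro ballI allI impI)
    fix Y' X' c F y x
    assume *: "Y' \<in> subs Y" "X' \<in> subs X" "sep Y' X'" "pre ?Rl Y' X' c F" "y \<in> rng Y'" "x \<in> rng X'"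
    have "pre Rl X' Y' c F" using * by (auto simp: pre_def)
    then have "Rl (leafval X' Y' c F) (Suc x) (Suc y)"
      using swap.prems * sep_commute[of X' Y'] unfolding leaf_ok_def by blast
    then show "Rl (leafval Y' X' c F) (Suc x) (Suc y)" by (simp add: leafval_commute)
  qed
  ultimately have "post ?Rl Y X (dp Y X c F) \<and> (\<forall>m. m \<notin> rng Y \<union> rng X \<longrightarrow> dp Y X c F m = F m)"
    using swap.prems by (intro swap.IH) auto
  then show ?case using swap.hyps by (auto simp: dp.simps[of X] post_def)
next
  case (split a b Y)
  have wf: "wf_tree a" "wf_tree b" "lo b = Suc (hi a)" using split.prems by auto
  note R = rng_Nd[OF split.prems(1)] rng_Nd_disj[OF split.prems(1)]
  let ?F = "dp a Y c F"
  have ok: "leaf_ok Rl a Y" "leaf_ok Rl b Y" using split.prems(5) by (auto simp: leaf_ok_def)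
  have 1: "post Rl a Y ?F \<and> (\<forall>m. m \<notin> rng a \<union> rng Y \<longrightarrow> ?F m = F m)"
    by (rule split.IH(1)) (use split.prems R wf ok in \<open>auto simp: pre_def\<close>)
  have Fb: "?F x = F x" if "x \<in> rng b" for x using 1 that R split.prems by blast
  \<comment> \<open>The corner of \<open>b\<close> is the pair of \<open>hi a\<close> with the row
    below \<open>Y\<close>. Its value is the old \<open>F (hi a)\<close>; \<open>?F (hi a)\<close>
    already belongs to the last row of \<open>Y\<close>.\<close>
  have "pre Rl b Y (F (hi a)) ?F"
    using 1 wf split.prems(4) R Fb by (auto simp: pre_def post_def)
  then have 2: "post Rl b Y (dp b Y (F (hi a)) ?F) \<and>
      (\<forall>m. m \<notin> rng b \<union> rng Y \<longrightarrow> dp b Y (F (hi a)) ?F m = ?F m)"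
    by (intro split.IH(2)) (use split.prems R wf ok in auto)
  have eq: "dp (Nd a b) Y c F = dp b Y (F (hi a)) ?F" using split.hyps by (simp add: dp.simps[of "Nd a b"])
  have Fa: "dp b Y (F (hi a)) ?F x = ?F x" if "x \<in> rng a" for x using 2 that R split.prems by blast
  show ?case unfolding eq using 1 2 R Fa by (auto simp: post_def)
qed

section \<open>The number of recursive calls\<close>

text \<open>The calls that split \<open>I\<close> while the partner is a part of \<open>Y\<close> are charged to \<open>share I Y\<close>: each partner pays
  with its edges near \<open>I\<close>, including the edge behind its last vertex.  The partner with the last vertex of
  its curve has no such edge and is counted separately.\<close>

definition inball :: "'a \<Rightarrow> real \<Rightarrow> nat \<Rightarrow> real" where
  "inball z r m = (if lst m then 0 else
     measure lborel {t \<in> {0..1}. linepath (pt m) (pt (Suc m)) t \<in> cball z r} * dist (pt m) (pt (Suc m)))"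

definition share :: "itree \<Rightarrow> itree \<Rightarrow> real" where
  "share I Y = 3 / len I * (\<Sum>m\<in>rng Y. inball (pt (lo I)) (10 / eps * len I) m) + (if lst (hi Y) then 1 else 0)"

definition potential :: "itree \<Rightarrow> itree \<Rightarrow> real" where
  "potential X Y = isum (\<lambda>I. share I Y) X + isum (\<lambda>J. share J X) Y"

fun balanced :: "itree \<Rightarrow> bool" where
  "balanced (Lf i) \<longleftrightarrow> True"
| "balanced (Nd a b) \<longleftrightarrow> balanced a \<and> balanced b \<and> len (Nd a b) \<le> 3 * wt a \<and>
     (lst (hi b) \<or> len (Nd a b) \<le> 3 * wt b)"

lemma inball_nonneg: "0 \<le> inball z r m"
  by (simp add: inball_def)

lemma share_nonneg: "0 \<le> share I Y"
  unfolding share_def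
  by (intro add_nonneg_nonneg mult_nonneg_nonneg divide_nonneg_nonneg sum_nonneg len_nonneg inball_nonneg) auto

lemma potential_nonneg: "0 \<le> potential X Y"
  unfolding potential_def by (intro add_nonneg_nonneg isum_nonneg share_nonneg)

lemma potential_commute: "potential X Y = potential Y X"
  by (simp add: potential_def)

text \<open>Since \<open>b\<close> continues the curve of \<open>a\<close>, the last vertex of
  \<open>a\<close> does have an edge behind it, and the extra 1 goes to \<open>b\<close> alone. This
  additivity lets the potential split along with the partner.\<close>

lemma share_Nd:
  assumes "inseq (Nd a b)"
  shows "share J (Nd a b) = share J a + share J b"
proof -
  have wf: "wf_tree (Nd a b)" using assms by (simp add: inseq_def)
  show ?thesis
    using inseq_Nd[OF assms] rng_Nd_disj[OF wf]
    by (simp add: share_def rng_Nd[OF wf] sum.union_disjoint algebra_simps)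
qed

lemma potential_Nd:
  assumes "inseq (Nd a b)"
  shows "potential (Nd a b) Y = share (Nd a b) Y + potential a Y + potential b Y"
  by (simp add: potential_def share_Nd[OF assms] isum_add)

lemma len_eq_sum: "wf_tree T \<Longrightarrow> len T = (\<Sum>m = lo T..<hi T. el m)"
proof (induction T)
  case (Nd a b)
  have "lo a \<le> hi a" "Suc (hi a) \<le> hi b" using Nd.prems lo_le_hi[of a] lo_le_hi[of b] by auto
  then have "{lo a..<hi b} = insert (hi a) ({lo a..<hi a} \<union> {Suc (hi a)..<hi b})" by auto
  then show ?case using Nd by (simp add: sum.union_disjoint)
qed auto

text \<open>All edges inside \<open>Y\<close> lie in the ball, being no longer than
  \<open>len X\<close>, and so does a piece of length \<open>min (len X) (el (hi Y))\<close> of the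
  edge behind \<open>Y\<close>.\<close>

lemma share_ge_1:
  assumes X: "inseq X" "0 < len X" and Y: "inseq Y" and le: "len Y \<le> len X" and ns: "\<not> sep X Y"
    and bal: "lst (hi Y) \<or> len X \<le> 3 * wt Y"
  shows "1 \<le> share X Y"
proof (cases "lst (hi Y)")
  case True
  have "0 \<le> 3 / len X * (\<Sum>m\<in>rng Y. inball (pt (lo X)) (10 / eps * len X) m)"
    using X(2) by (intro mult_nonneg_nonneg sum_nonneg inball_nonneg) auto
  then show ?thesis using True by (simp add: share_def)
next
  case False
  have wf: "wf_tree Y" using Y by (simp add: inseq_def)
  let ?z = "pt (lo X)" and ?r = "10 / eps * len X"
  have "eps * dist ?z (pt (lo Y)) < 8 * len X"
  proof -
    have "eps * dist ?z (pt (lo Y)) < 4 * (len X + len Y)" using ns by (simp add: sep_def not_le)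
    then show ?thesis using le by simp
  qed
  then have d0: "dist ?z (pt (lo Y)) \<le> 8 / eps * len X"
    using eps_pos by (simp add: field_simps)
  \<comment> \<open>Origin of the 10: failing separation puts \<open>lo Y\<close> within
    \<open>8 / eps * len X\<close> of the centre, any vertex of \<open>Y\<close> is at most
    \<open>len X\<close> further away, and another \<open>len X\<close> is left for the edge that
    starts there.\<close>
  have r: "8 / eps * len X + 2 * len X \<le> ?r"
  proof -
    have "2 * len X \<le> 2 * (len X / eps)" using X(2) eps_pos eps_less by (simp add: field_simps)
    then show ?thesis by (simp add: field_simps)
  qed
  have each: "min (len X) (el m) \<le> inball ?z ?r m" if "m \<in> rng Y" "\<not> lst m" for m
  proof -
    have "dist (pt (lo Y)) (pt m) \<le> len Y" using dist_le_len[OF Y] that wf by simp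
    then have "dist ?z (pt m) \<le> 8 / eps * len X + len X"
      using d0 le dist_triangle[of ?z "pt m" "pt (lo Y)"] by linarith
    then show ?thesis
      using length_in_cball_ge[of ?z "pt m" "len X" ?r "pt (Suc m)"] r that X(2) by (simp add: inball_def el_def)
  qed
  have inner: "\<not> lst m \<and> el m \<le> len X" if m: "m \<in> {lo Y..<hi Y}" for m
  proof -
    have "el m \<le> (\<Sum>m = lo Y..<hi Y. el m)" using m by (intro member_le_sum) (auto simp: el_nonneg)
    then show ?thesis using len_eq_sum[OF wf] le m Y unfolding inseq_def lst_def by auto
  qed
  have "rng Y = insert (hi Y) {lo Y..<hi Y}" using lo_le_hi[OF wf] by (auto simp: rng_def)
  then have "(\<Sum>m\<in>rng Y. inball ?z ?r m) = inball ?z ?r (hi Y) + (\<Sum>m = lo Y..<hi Y. inball ?z ?r m)"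
    by simp
  also have "\<dots> \<ge> min (len X) (el (hi Y)) + (\<Sum>m = lo Y..<hi Y. el m)"
  proof (rule add_mono)
    show "min (len X) (el (hi Y)) \<le> inball ?z ?r (hi Y)" using each False wf by simp
    show "(\<Sum>m = lo Y..<hi Y. el m) \<le> (\<Sum>m = lo Y..<hi Y. inball ?z ?r m)"
    proof (rule sum_mono)
      fix m assume m: "m \<in> {lo Y..<hi Y}"
      then have "m \<in> rng Y" by (auto simp: rng_def)
      with each[of m] inner[OF m] show "el m \<le> inball ?z ?r m" by simp
    qed
  qed
  also have "(\<Sum>m = lo Y..<hi Y. el m) = len Y" using len_eq_sum[OF wf] by simp
  finally have S: "min (len X) (el (hi Y)) + len Y \<le> (\<Sum>m\<in>rng Y. inball ?z ?r m)" .
  have "len X \<le> 3 * (len Y + el (hi Y))" using bal False by (simp add: wt_def)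
  \<comment> \<open>Either the edge behind \<open>Y\<close> is cut off at \<open>len X\<close>,
    which is plenty, or it counts in full and the sum is \<open>wt Y\<close>.\<close>
  then have "len X / 3 \<le> min (len X) (el (hi Y)) + len Y"
    using len_nonneg[of Y] X(2) by (cases "len X \<le> el (hi Y)") (simp_all add: min_def)
  with S have "len X / 3 \<le> (\<Sum>m\<in>rng Y. inball ?z ?r m)" by (rule order_trans[rotated])
  moreover have "1 \<le> 3 / x * S" if "x / 3 \<le> S" "0 < x" for x S :: real
    using that by (simp add: field_simps)
  ultimately have "1 \<le> 3 / len X * (\<Sum>m\<in>rng Y. inball ?z ?r m)" using X(2) by (iprover)
  then show ?thesis unfolding share_def by (simp only: False if_False add_0_right)
qed

text \<open>The last two hypotheses survive a split because the longer tree is split: its children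
  weigh a third of it, hence a third of the partner, unless they end a curve. A split costs 2
  iterations, and its two subcalls have additive terms of at most 2 each; of these 6, the share of
  at least 1 pays 5 and one remains. The indicator pays for a swap.\<close>

lemma cnt_le_potential:
  assumes "inseq X" "inseq Y" "balanced X" "balanced Y"
    and "lst (hi X) \<or> len Y \<le> 3 * wt X" and "lst (hi Y) \<or> len X \<le> 3 * wt Y"
  shows "real (cnt X Y) \<le> 5 * potential X Y + 1 + (if len X < len Y then 1 else 0)"
  using assms
proof (induction X Y rule: pair_induct)
  case (sep X Y)
  then have "cnt X Y = 1" by (simp add: cnt.simps[of X Y])
  then show ?case using potential_nonneg[of X Y] by simp
next
  case (swap X Y)
  have "real (cnt Y X) \<le> 5 * potential Y X + 1 + (if len Y < len X then 1 else 0)"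
    by (rule swap.IH) (fact swap.prems)+
  moreover have "cnt X Y = Suc (cnt Y X)" using swap.hyps by (simp add: cnt.simps[of X Y])
  ultimately show ?case
    unfolding potential_commute[of X Y] using swap.hyps(2) by simp
next
  case (split a b Y)
  note ab = inseq_Nd[OF split.prems(1)]
  have le: "len a \<le> len (Nd a b)" "len b \<le> len (Nd a b)"
    using len_nonneg[of a] len_nonneg[of b] el_nonneg[of "hi a"] by simp_all
  have Y: "lst (hi Y) \<or> len a \<le> 3 * wt Y" "lst (hi Y) \<or> len b \<le> 3 * wt Y"
    using split.prems(6) le order_trans by blast+
  have bal: "balanced a" "balanced b" "len (Nd a b) \<le> 3 * wt a" "lst (hi b) \<or> len (Nd a b) \<le> 3 * wt b"
    using split.prems(3) by simp_all
  have X: "lst (hi a) \<or> len Y \<le> 3 * wt a" "lst (hi b) \<or> len Y \<le> 3 * wt b"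
    using bal split.hyps(2) order_trans by blast+
  have "1 \<le> share (Nd a b) Y"
    using split.prems(1,2,6) split.hyps len_pos[OF split.prems(1)] by (intro share_ge_1) simp_all
  moreover have "real (cnt a Y) \<le> 5 * potential a Y + 1 + (if len a < len Y then 1 else 0)"
    by (rule split.IH(1)[OF ab(1) split.prems(2) bal(1) split.prems(4) X(1) Y(1)])
  moreover have "real (cnt b Y) \<le> 5 * potential b Y + 1 + (if len b < len Y then 1 else 0)"
    by (rule split.IH(2)[OF ab(2) split.prems(2) bal(2) split.prems(4) X(2) Y(2)])
  moreover have "cnt (Nd a b) Y = Suc (cnt a Y + (cnt b Y + 1))"
    using split.hyps by (simp add: cnt.simps[of "Nd a b"])
  moreover have "(if len a < len Y then 1 else (0::real)) \<le> 1" "(if len b < len Y then 1 else (0::real)) \<le> 1"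
    "(if len (Nd a b) < len Y then 1 else (0::real)) = 0"
    using split.hyps(2) by simp_all
  moreover have "real n \<le> 5 * (s + p + q) + 1 + z"
    if "1 \<le> s" "real na \<le> 5 * p + 1 + x" "real nb \<le> 5 * q + 1 + y" "n = Suc (na + (nb + 1))"
      "x \<le> 1" "y \<le> 1" "z = 0" for n na nb :: nat and s p q x y z :: real
    using that by simp
  ultimately show ?case
    unfolding potential_Nd[OF split.prems(1)] by blast
qed

section \<open>Approximation guarantee\<close>

text \<open>Index pairs are shifted by one: \<open>(Suc x, Suc y)\<close> stands for the pair \<open>(x, y)\<close> of vertices, so that
  the start of an alignment is the fictitious pair \<open>(0, k)\<close>.\<close>

inductive reach :: "real \<Rightarrow> nat \<Rightarrow> nat \<Rightarrow> bool" for \<delta> where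
  start: "reach \<delta> 0 k"
| step: "x < k \<Longrightarrow> k \<le> y \<Longrightarrow> y < k + l \<Longrightarrow> dist (pt x) (pt y) \<le> \<delta> \<Longrightarrow>
    reach \<delta> x y \<or> reach \<delta> (Suc x) y \<or> reach \<delta> x (Suc y) \<Longrightarrow> reach \<delta> (Suc x) (Suc y)"

inductive_cases reach_SucE: "reach \<delta> (Suc x) (Suc y)"

lemma reach_0: "reach \<delta> 0 y \<Longrightarrow> y = k"
  by (auto elim: reach.cases)

lemma reach_k: "reach \<delta> x k \<Longrightarrow> x = 0"
  by (auto elim: reach.cases)

definition full :: "itree \<Rightarrow> itree \<Rightarrow> bool" where
  "full S T \<longleftrightarrow> wf_tree S \<and> wf_tree T \<and> lo S = 0 \<and> Suc (hi S) = k \<and> lo T = k \<and> Suc (hi T) = k + l"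

lemma full_inseq: "full S T \<Longrightarrow> inseq S \<and> inseq T"
  by (auto simp: full_def inseq_def)

lemma rng_full: "full S T \<Longrightarrow> rng S = {..<k}" "full S T \<Longrightarrow> rng T = {k..<k + l}"
  by (auto simp: full_def rng_def)

text \<open>Follow the derivation of \<open>reach\<close> backwards until it leaves the rectangle.
  It does so at the corner, in the row below or in the column to the left, where \<open>pre\<close>
  bounds a value that takes part in the minimum.\<close>

lemma leaf_complete:
  assumes "reach \<delta> (Suc x) (Suc y)" "x \<in> rng X" "y \<in> rng Y" "pre (\<lambda>c i j. reach \<delta> i j \<longrightarrow> c \<le> u) X Y c F"
  shows "min c (min (Min (F ` rng X)) (Min (F ` rng Y))) \<le> u"
  using assms(1-3)
proof (induction "x + y" arbitrary: x y rule: less_induct)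
  case less
  have X: "Min (F ` rng X) \<le> F x" "Min (F ` rng Y) \<le> F y" using less.prems by auto
  have sources: "lo X \<le> x" "lo Y \<le> y" using less.prems by (auto simp: rng_def)
  consider "reach \<delta> x y" | "reach \<delta> (Suc x) y" | "reach \<delta> x (Suc y)"
    using less.prems(1) by (auto elim: reach_SucE)
  then show ?case
  proof cases
    case 1
    consider "x = lo X" "y = lo Y" | "x = lo X" "y \<noteq> lo Y" | "x \<noteq> lo X" "y = lo Y" | "x \<noteq> lo X" "y \<noteq> lo Y" by blast
    then show ?thesis
    proof cases
      case 1
      then show ?thesis using \<open>reach \<delta> x y\<close> assms(4) by (auto simp: pre_def min_le_iff_disj)
    next
      case 2
      then obtain y' where y': "y = Suc y'" "y' \<in> rng Y" using sources less.prems(3) by (cases y) (auto simp: rng_def)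
      then have "F y' \<le> u" using \<open>reach \<delta> x y\<close> assms(4) 2 by (auto simp: pre_def)
      moreover have "Min (F ` rng Y) \<le> F y'" using y' by auto
      ultimately show ?thesis by (auto simp: min_le_iff_disj)
    next
      case 3
      then obtain x' where x': "x = Suc x'" "x' \<in> rng X" using sources less.prems(2) by (cases x) (auto simp: rng_def)
      then have "F x' \<le> u" using \<open>reach \<delta> x y\<close> assms(4) 3 by (auto simp: pre_def)
      moreover have "Min (F ` rng X) \<le> F x'" using x' by auto
      ultimately show ?thesis by (auto simp: min_le_iff_disj)
    next
      case 4
      then obtain x' where x': "x = Suc x'" "x' \<in> rng X" using sources less.prems(2) by (cases x) (auto simp: rng_def)
      moreover obtain y' where y': "y = Suc y'" "y' \<in> rng Y" using 4 sources less.prems(3) by (cases y) (auto simp: rng_def)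
      ultimately show ?thesis using \<open>reach \<delta> x y\<close> less.hyps[of x' y'] by simp
    qed
  next
    case 2
    show ?thesis
    proof (cases "y = lo Y")
      case True
      then have "F x \<le> u" using 2 assms(4) less.prems(2) by (auto simp: pre_def)
      then show ?thesis using X by (auto simp: min_le_iff_disj)
    next
      case False
      then obtain y' where "y = Suc y'" "y' \<in> rng Y" using sources less.prems(3) by (cases y) (auto simp: rng_def)
      then show ?thesis using 2 less.hyps[of x y'] less.prems(2) by simp
    qed
  next
    case 3
    show ?thesis
    proof (cases "x = lo X")
      case True
      then have "F y \<le> u" using 3 assms(4) less.prems(3) by (auto simp: pre_def)
      then show ?thesis using X by (auto simp: min_le_iff_disj)
    next
      case False
      then obtain x' where "x = Suc x'" "x' \<in> rng X" using sources less.prems(2) by (cases x) (auto simp: rng_def)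
      then show ?thesis using 3 less.hyps[of x' y] less.prems(3) by simp
    qed
  qed
qed

text \<open>If a separated rectangle contains a pair at distance at most \<open>\<delta>\<close>,
  its own distance \<open>?w\<close> exceeds \<open>\<delta>\<close> by at most
  \<open>len X + len Y \<le> eps / 4 * ?w\<close>. Hence \<open>?w \<le> u\<close>, and no rectangle
  on an optimal path costs more than \<open>u\<close>.\<close>

lemma dp_complete:
  assumes ST: "full S T" and r: "reach \<delta> k (k + l)" and u: "0 \<le> u" "\<delta> \<le> (1 - eps / 4) * u"
  shows "dp S T 0 F (hi T) \<le> u"
proof -
  let ?Rl = "\<lambda>c i j. reach \<delta> i j \<longrightarrow> c \<le> u"
  have wf: "wf_tree S" "wf_tree T" and eqs: "lo S = 0" "Suc (hi S) = k" "lo T = k" "Suc (hi T) = k + l"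
    using ST by (auto simp: full_def)
  have in_seq: "inseq S" "inseq T" using full_inseq[OF ST] by auto
  have "leaf_ok ?Rl S T"
    unfolding leaf_ok_def
  proof (intro ballI allI impI)
    fix X Y c F x y
    assume *: "X \<in> subs S" "Y \<in> subs T" "sep X Y" "pre ?Rl X Y c F" "x \<in> rng X" "y \<in> rng Y"
      and r: "reach \<delta> (Suc x) (Suc y)"
    have sub: "inseq X" "inseq Y" using in_seq * by (auto intro: inseq_subs)
    let ?w = "dist (pt (lo X)) (pt (lo Y))"
    have "dist (pt (lo X)) (pt x) \<le> len X" "dist (pt y) (pt (lo Y)) \<le> len Y"
      using sub * by (auto intro!: dist_le_len simp: inseq_def)
    moreover have "dist (pt x) (pt y) \<le> \<delta>" using r by (auto elim: reach_SucE)
    ultimately have "?w \<le> \<delta> + (len X + len Y)"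
      using dist_triangle[of "pt (lo X)" "pt (lo Y)" "pt x"] dist_triangle[of "pt x" "pt (lo Y)" "pt y"] by linarith
    then have "?w \<le> \<delta> + eps / 4 * ?w" using *(3) by (simp add: sep_def)
    then have "(1 - eps / 4) * ?w \<le> (1 - eps / 4) * u" using u by (simp add: algebra_simps)
    then have "?w \<le> u" using eps_less by simp
    then show "leafval X Y c F \<le> u"
      using leaf_complete[OF r *(5,6,4)] by (simp add: leafval_def)
  qed
  \<comment> \<open>Apart from the corner no boundary position is reachable, so the initial frontier
    may be anything.\<close>
  moreover have "pre ?Rl S T 0 F"
    using u by (auto simp: pre_def eqs rng_def dest!: reach_0 reach_k)
  moreover have "rng S \<inter> rng T = {}" using rng_full[OF ST] by auto
  ultimately have "post ?Rl S T (dp S T 0 F)" using dp_invariant[OF wf] by blast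
  then show ?thesis using r wf eqs by (auto simp: post_def)
qed

section \<open>Clusters\<close>

text \<open>For \<open>\<theta> \<ge> 0\<close> the maximal nodes of length at most
  \<open>\<theta>\<close> partition the vertices, and each is represented by its first vertex.
  Taking the blocks from the tree itself ensures that every short node lies inside one
  block.\<close>

fun cluster :: "real \<Rightarrow> itree \<Rightarrow> nat \<Rightarrow> nat" where
  "cluster \<theta> (Lf i) m = i"
| "cluster \<theta> (Nd a b) m =
     (if len (Nd a b) \<le> \<theta> then lo a else if m \<le> hi a then cluster \<theta> a m else cluster \<theta> b m)"

declare len.simps [simp del]

lemma cluster_bounds: "wf_tree T \<Longrightarrow> m \<in> rng T \<Longrightarrow> lo T \<le> cluster \<theta> T m \<and> cluster \<theta> T m \<le> m"
proof (induction T)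
  case (Nd a b)
  then show ?case using lo_le_hi[of a] lo_le_hi[of b] by (auto simp: rng_def not_le Suc_le_eq)
qed simp

lemma cluster_const:
  assumes "wf_tree T" "X \<in> subs T" "len X \<le> \<theta>" "x \<in> rng X" "y \<in> rng X"
  shows "cluster \<theta> T x = cluster \<theta> T y"
  using assms
proof (induction T)
  case (Nd a b)
  have wf: "wf_tree a" "wf_tree b" "lo b = Suc (hi a)" using Nd.prems(1) by auto
  consider "X = Nd a b" | "X \<in> subs a" | "X \<in> subs b" using Nd.prems(2) by auto
  then show ?case
  proof cases
    case 1
    then show ?thesis using Nd.prems(3) by simp
  next
    case 2
    then have "x \<le> hi a" "y \<le> hi a" using rng_subs[of a X] Nd.prems wf by (auto simp: rng_def)
    then show ?thesis using Nd.IH(1) 2 wf Nd.prems by simp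
  next
    case 3
    then have "\<not> x \<le> hi a" "\<not> y \<le> hi a" using rng_subs[of b X] Nd.prems wf by (auto simp: rng_def)
    then show ?thesis using Nd.IH(2) 3 wf Nd.prems by simp
  qed
qed auto

lemma cluster_dist:
  assumes "inseq T" "0 \<le> \<theta>" "x \<in> rng T" "y \<in> rng T" "cluster \<theta> T x = cluster \<theta> T y"
  shows "dist (pt x) (pt y) \<le> \<theta>"
  using assms
proof (induction T)
  case (Nd a b)
  note ab = inseq_Nd[OF Nd.prems(1)]
  have wf: "wf_tree a" "wf_tree b" "lo b = Suc (hi a)" using Nd.prems(1) by (auto simp: inseq_def)
  show ?case
  proof (cases "len (Nd a b) \<le> \<theta>")
    case True
    then show ?thesis using dist_le_len[OF Nd.prems(1,3,4)] by linarith
  next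
    case False
    have R: "z \<in> rng (Nd a b) \<Longrightarrow> if z \<le> hi a then z \<in> rng a else z \<in> rng b" for z
      using wf by (auto simp: rng_def)
    have cross: False if "z \<in> rng a" "z' \<in> rng b" "cluster \<theta> a z = cluster \<theta> b z'" for z z'
      using cluster_bounds[OF wf(1) that(1), of \<theta>] cluster_bounds[OF wf(2) that(2), of \<theta>] that wf
      by (auto simp: rng_def)
    show ?thesis
      using R[OF Nd.prems(3)] R[OF Nd.prems(4)] Nd.prems(5) False Nd.IH(1)[OF ab(1) Nd.prems(2)]
        Nd.IH(2)[OF ab(2) Nd.prems(2)] cross[of x y] cross[of y x]
      by (auto split: if_splits)
  qed
qed simp

lemma cluster_Suc:
  assumes "wf_tree T" "m \<in> rng T" "Suc m \<in> rng T"
  shows "cluster \<theta> T (Suc m) = cluster \<theta> T m \<or> cluster \<theta> T (Suc m) = Suc m"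
  using assms
proof (induction T)
  case (Nd a b)
  have wf: "wf_tree a" "wf_tree b" "lo b = Suc (hi a)" using Nd.prems(1) by auto
  consider "Suc m \<le> hi a" | "m = hi a" | "hi a < m" by linarith
  then show ?case
  proof cases
    case 1
    then show ?thesis using Nd.IH(1) wf Nd.prems by (auto simp: rng_def)
  next
    case 2
    moreover have "cluster \<theta> b (lo b) = lo b"
      using cluster_bounds[OF wf(2) lo_hi_rng(1)[OF wf(2)]] by (simp add: le_antisym)
    ultimately show ?thesis using wf by auto
  next
    case 3
    then show ?thesis using Nd.IH(2) wf Nd.prems by (auto simp: rng_def)
  qed
qed simp

lemma cluster_interval:
  assumes "wf_tree T" "m \<in> rng T" "cluster \<theta> T m \<le> x" "x \<le> m"
  shows "cluster \<theta> T x = cluster \<theta> T m"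
  using assms
proof (induction T)
  case (Nd a b)
  have wf: "wf_tree a" "wf_tree b" "lo b = Suc (hi a)" using Nd.prems(1) by auto
  have "hi a < x" if "\<not> m \<le> hi a" "\<not> len (Nd a b) \<le> \<theta>"
    using Nd.prems cluster_bounds[of b m \<theta>] wf that by (auto simp: rng_def)
  then show ?case using Nd wf by (auto simp: rng_def)
qed (auto)

text \<open>Clusters in the shifted indices of \<open>reach\<close>. The index \<open>lo T\<close>
  stands before the first vertex and forms a class of its own, so the start is not mixed up with
  real vertices.\<close>

definition shifted :: "real \<Rightarrow> itree \<Rightarrow> nat \<Rightarrow> nat" where
  "shifted \<theta> T x = (if x \<le> lo T then lo T else Suc (cluster \<theta> T (x - 1)))"

lemma shifted_Suc:
  "lo T \<le> x \<Longrightarrow> shifted \<theta> T (Suc x) = Suc (cluster \<theta> T x)"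
  by (simp add: shifted_def)

lemma shifted_le:
  assumes "wf_tree T" "lo T \<le> x" "x \<le> Suc (hi T)"
  shows "shifted \<theta> T x \<le> x" "lo T \<le> shifted \<theta> T x"
proof -
  have "shifted \<theta> T x \<le> x \<and> lo T \<le> shifted \<theta> T x"
  proof (cases "x = lo T")
    case False
    then obtain x' where "x = Suc x'" "x' \<in> rng T" using assms by (cases x) (auto simp: rng_def)
    then show ?thesis using cluster_bounds[OF assms(1), of x' \<theta>] assms by (auto simp: shifted_def)
  qed (simp add: shifted_def)
  then show "shifted \<theta> T x \<le> x" "lo T \<le> shifted \<theta> T x" by auto
qed

lemma shifted_step:
  assumes "wf_tree T" "x \<in> rng T"
  shows "shifted \<theta> T (Suc x) = shifted \<theta> T x \<or> shifted \<theta> T (Suc x) = Suc x"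
proof (cases "x = lo T")
  case True
  then show ?thesis using cluster_bounds[OF assms, of \<theta>] by (auto simp: shifted_def)
next
  case False
  then obtain x' where "x = Suc x'" "x' \<in> rng T" using assms by (cases x) (auto simp: rng_def)
  then show ?thesis using cluster_Suc[OF assms(1), of x' \<theta>] assms False by (auto simp: shifted_def rng_def)
qed

lemma shifted_interval:
  assumes "wf_tree T" "lo T \<le> m" "m \<le> Suc (hi T)" "shifted \<theta> T m \<le> x" "x \<le> m"
  shows "shifted \<theta> T x = shifted \<theta> T m"
proof (cases "m = lo T")
  case True
  then show ?thesis using assms by (auto simp: shifted_def)
next
  case False
  then obtain m' where m: "m = Suc m'" "m' \<in> rng T" using assms by (cases m) (auto simp: rng_def)
  then have "Suc (cluster \<theta> T m') \<le> x" using assms by (auto simp: shifted_def rng_def)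
  moreover from this obtain x' where "x = Suc x'" by (cases x) auto
  ultimately show ?thesis
    using m assms cluster_interval[OF assms(1) m(2), of \<theta> x'] cluster_bounds[OF assms(1) m(2), of \<theta>]
    by (auto simp: shifted_def rng_def)
qed

lemma shifted_idem:
  assumes "wf_tree T" "lo T \<le> m" "m \<le> Suc (hi T)"
  shows "shifted \<theta> T (shifted \<theta> T m) = shifted \<theta> T m"
  using shifted_interval[OF assms order_refl] shifted_le[OF assms] by simp

lemma shifted_eq_lo:
  assumes "wf_tree T" "lo T \<le> x" "x \<le> Suc (hi T)" "shifted \<theta> T x = shifted \<theta> T (lo T)"
  shows "x = lo T"
proof (rule ccontr)
  assume "x \<noteq> lo T"
  then obtain x' where "x = Suc x'" "x' \<in> rng T" using assms by (cases x) (auto simp: rng_def)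
  then show False using cluster_bounds[OF assms(1), of x' \<theta>] assms by (auto simp: shifted_def rng_def)
qed

text \<open>The path through the leaves that \<open>dp\<close> finds may move backwards inside a leaf.  Every leaf
  of value at most \<open>v\<close> lies in a product of two clusters of length at most \<open>eps / 4 * v\<close>, and all
  pairs in this product are close; since leaves are left in forward direction only, the path
  visits the clusters in monotone order.\<close>

lemma dp_sound:
  assumes ST: "full S T" and v: "v = dp S T 0 (\<lambda>_. M) (hi T)" and vM: "v < M" and v0: "0 \<le> v"
  shows "reach ((1 + eps / 2) * v) k (k + l)"
proof -
  have wf: "wf_tree S" "wf_tree T" and eqs: "lo S = 0" "Suc (hi S) = k" "lo T = k" "Suc (hi T) = k + l"
    using ST by (auto simp: full_def)
  have in_seq: "inseq S" "inseq T" using full_inseq[OF ST] by auto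
  define \<theta> where "\<theta> = eps / 4 * v"
  have \<theta>: "0 \<le> \<theta>" using v0 eps_pos by (simp add: \<theta>_def)
  define \<delta> where "\<delta> = (1 + eps / 2) * v"
  define sS where "sS = shifted \<theta> S"
  define sT where "sT = shifted \<theta> T"
  \<comment> \<open>Quantifying over the whole product of two classes makes \<open>Z\<close> blind
    to the position inside the classes; this absorbs backward moves.\<close>
  define Z where "Z i j \<longleftrightarrow> (\<forall>x y. x \<le> k \<longrightarrow> sS x = sS i \<longrightarrow> k \<le> y \<longrightarrow> y \<le> k + l \<longrightarrow> sT y = sT j \<longrightarrow> reach \<delta> x y)"
    for i j
  let ?Rl = "\<lambda>c i j. c \<le> v \<longrightarrow> Z i j"
  note S_le = shifted_le[OF wf(1), of _ \<theta>, folded sS_def, unfolded eqs]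
  note T_le = shifted_le[OF wf(2), of _ \<theta>, folded sT_def, unfolded eqs]
  note S_int = shifted_interval[OF wf(1), of _ \<theta>, folded sS_def, unfolded eqs]
  note T_int = shifted_interval[OF wf(2), of _ \<theta>, folded sT_def, unfolded eqs]
  have "leaf_ok ?Rl S T"
    unfolding leaf_ok_def
  proof (intro ballI allI impI)
    fix X Y c F x1 y1
    assume *: "X \<in> subs S" "Y \<in> subs T" "sep X Y" "pre ?Rl X Y c F" "x1 \<in> rng X" "y1 \<in> rng Y"
      and f: "leafval X Y c F \<le> v"
    have wfXY: "wf_tree X" "wf_tree Y" using wf_subs wf * by auto
    have sub: "rng X \<subseteq> rng S" "rng Y \<subseteq> rng T" using rng_subs wf * by auto
    have sub': "rng X \<subseteq> {..<k}" "rng Y \<subseteq> {k..<k+l}" using sub rng_full[OF ST] by auto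
    let ?w = "dist (pt (lo X)) (pt (lo Y))"
    have w: "?w \<le> v" using f by (simp add: leafval_def)
    have "eps * ?w \<le> eps * v" using w eps_pos by simp
    then have "len X + len Y \<le> \<theta>" using *(3) by (simp add: sep_def \<theta>_def)
    then have small: "len X \<le> \<theta>" "len Y \<le> \<theta>"
      using len_nonneg[of X] len_nonneg[of Y] by simp_all
    define a where "a = sS (Suc (lo X))"
    define b where "b = sT (Suc (lo Y))"
    have a: "sS (Suc x) = a" if "x \<in> rng X" for x
      using cluster_const[OF wf(1) *(1) small(1) that lo_hi_rng(1)[OF wfXY(1)]] eqs
      by (simp add: a_def sS_def shifted_Suc)
    have b: "sT (Suc y) = b" if "y \<in> rng Y" for y
    proof -
      have "lo T \<le> y" "lo T \<le> lo Y" using sub' that lo_hi_rng(1)[OF wfXY(2)] eqs(3) by auto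
      then show ?thesis
        using cluster_const[OF wf(2) *(2) small(2) that lo_hi_rng(1)[OF wfXY(2)]]
        by (simp add: b_def sT_def shifted_Suc)
    qed
    have close: "dist (pt x) (pt y) \<le> \<delta>"
      if "x < k" "k \<le> y" "y < k + l" "sS (Suc x) = a" "sT (Suc y) = b" for x y
    proof -
      have 1: "lo X < k" "k \<le> lo Y" "lo Y < k + l" using sub' lo_hi_rng(1)[OF wfXY(1)] lo_hi_rng(1)[OF wfXY(2)] by auto
      have "dist (pt x) (pt (lo X)) \<le> \<theta>"
        by (rule cluster_dist[OF in_seq(1) \<theta>])
          (use that 1 a_def eqs in \<open>auto simp: rng_full[OF ST] sS_def shifted_Suc\<close>)
      moreover have "dist (pt (lo Y)) (pt y) \<le> \<theta>"
        by (rule cluster_dist[OF in_seq(2) \<theta>])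
          (use that 1 b_def eqs in \<open>auto simp: rng_full[OF ST] sT_def shifted_Suc\<close>)
      ultimately have "dist (pt x) (pt y) \<le> v + 2 * \<theta>"
        using w dist_triangle[of "pt x" "pt y" "pt (lo X)"] dist_triangle[of "pt (lo X)" "pt y" "pt (lo Y)"]
        by linarith
      then show ?thesis by (simp add: \<delta>_def \<theta>_def algebra_simps)
    qed
    have a1: "1 \<le> a" "a \<le> k" "sS a = a"
      using S_le[of "Suc (lo X)"] lo_hi_rng(1)[OF wfXY(1)] sub' shifted_idem[OF wf(1), of "Suc (lo X)" \<theta>] eqs
      by (auto simp: a_def sS_def shifted_Suc)
    have b1: "Suc k \<le> b" "b \<le> k + l" "sT b = b"
    proof -
      have "lo Y \<in> rng T" using lo_hi_rng(1)[OF wfXY(2)] sub by auto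
      then show "Suc k \<le> b" "b \<le> k + l"
        using cluster_bounds[OF wf(2), of "lo Y" \<theta>] sub' eqs rng_full[OF ST] by (auto simp: b_def sT_def shifted_Suc)
      show "sT b = b"
        using shifted_idem[OF wf(2), of "Suc (lo Y)" \<theta>] \<open>lo Y \<in> rng T\<close> eqs
        by (auto simp: b_def sT_def rng_def)
    qed
    \<comment> \<open>\<open>(a, b)\<close> is the smallest position of the class product. From
      there a monotone path first increases the first index at \<open>b\<close>, then the second
      one, and meets only close pairs of the same product.\<close>
    have fill: "Z (Suc x) (Suc y)" if r: "reach \<delta> a b" and xy: "x \<in> rng X" "y \<in> rng Y" for x y
      unfolding Z_def a[OF xy(1)] b[OF xy(2)]
    proof (intro allI impI)
      fix x y assume x: "x \<le> k" "sS x = a" and y: "k \<le> y" "y \<le> k + l" "sT y = b"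
      have "a \<le> x" "b \<le> y" using S_le[of x] T_le[of y] x y by auto
      have row: "reach \<delta> x' b" if "a \<le> x'" "x' \<le> x" for x'
        using that
      proof (induction x' rule: dec_induct)
        case base
        show ?case by (rule r)
      next
        case (step n)
        obtain b' where b': "b = Suc b'" "k \<le> b'" using b1 by (cases b) auto
        have "sS (Suc n) = a" using S_int[of x "Suc n"] x step by auto
        then have "dist (pt n) (pt b') \<le> \<delta>" using close[of n b'] b1 b' x step by auto
        then show ?case using reach.step[of n b' \<delta>] step b' b1 x by auto
      qed
      show "reach \<delta> x y"
        using \<open>b \<le> y\<close> order_refl[of y]
      proof (induction y rule: dec_induct)
        case base
        show ?case using row \<open>a \<le> x\<close> by simp
      next
        case (step n)
        obtain x' where x': "x = Suc x'" using \<open>a \<le> x\<close> a1 by (cases x) auto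
        have "sT (Suc n) = b" using T_int[of y "Suc n"] y step b1 by auto
        then have "dist (pt x') (pt n) \<le> \<delta>" using close[of x' n] b1 x' x y step by auto
        then show ?case using reach.step[of x' n \<delta>] step x' x y b1 by auto
      qed
    qed
    \<comment> \<open>If the predecessor differs in the class of a coordinate, that coordinate has
      just begun a new class. If the other coordinate stays in its class, \<open>Z\<close> allows it
      to be reset to the first index. Thus \<open>(a, b)\<close> itself gets a reachable
      predecessor.\<close>
    have enter: "Z (Suc x) (Suc y)"
      if xy: "x \<in> rng X" "y \<in> rng Y" and i: "i = x \<or> i = Suc x" and j: "j = y \<or> j = Suc y" and Z: "Z i j" for x y i j
    proof -
      have bd: "x < k" "k \<le> y" "y < k + l" using xy sub' by auto
      have ij: "i \<le> k" "k \<le> j" "j \<le> k + l" using i j bd by auto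
      have ca: "sS i = a \<or> i = x \<and> Suc x = a"
        using shifted_step[OF wf(1), of x \<theta>] xy sub i a[OF xy(1)] by (auto simp: sS_def)
      have cb: "sT j = b \<or> j = y \<and> Suc y = b"
        using shifted_step[OF wf(2), of y \<theta>] xy sub j b[OF xy(2)] by (auto simp: sT_def)
      obtain b' where b': "b = Suc b'" "k \<le> b'" using b1 by (cases b) auto
      obtain a' where a': "a = Suc a'" using a1 by (cases a) auto
      show ?thesis
      proof (cases "sS i = a \<and> sT j = b")
        case True
        then show ?thesis using Z a[OF xy(1)] b[OF xy(2)] by (simp add: Z_def)
      next
        case False
        have "reach \<delta> a' b' \<or> reach \<delta> (Suc a') b' \<or> reach \<delta> a' (Suc b')"
        proof (cases "sT j = b")
          case True
          then have "i = a'" using False ca a' by auto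
          moreover have "reach \<delta> i b" using Z ij b1 True by (simp add: Z_def)
          ultimately show ?thesis using b' by simp
        next
          case jn: False
          then have "j = b'" using cb b' by auto
          show ?thesis
          proof (cases "sS i = a")
            case True
            then have "reach \<delta> a j" using Z ij a1 by (simp add: Z_def)
            then show ?thesis using \<open>j = b'\<close> a' by simp
          next
            case False
            then have "i = a'" using ca a' by auto
            moreover have "reach \<delta> i j" using Z ij by (simp add: Z_def)
            ultimately show ?thesis using \<open>j = b'\<close> by simp
          qed
        qed
        then have "reach \<delta> a b"
          using reach.step[of a' b' \<delta>] close[of a' b'] a1 b1 a' b' by simp
        then show ?thesis using fill xy by blast
      qed
    qed
    have all: "Z (Suc x1) (Suc y1)" if "Z (Suc x) (Suc y)" "x \<in> rng X" "y \<in> rng Y" for x y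
      using that a b *(5,6) by (simp add: Z_def)
    have "min c (min (Min (F ` rng X)) (Min (F ` rng Y))) \<le> v" using f by (simp add: leafval_def)
    then consider "c \<le> v" | "Min (F ` rng X) \<le> v" | "Min (F ` rng Y) \<le> v" by (auto simp: min_le_iff_disj)
    then show "Z (Suc x1) (Suc y1)"
    proof cases
      case 1
      then have "Z (lo X) (lo Y)" using *(4) by (simp add: pre_def)
      then show ?thesis using enter[of "lo X" "lo Y"] all wfXY lo_hi_rng(1) by blast
    next
      case 2
      have "Min (F ` rng X) \<in> F ` rng X" using wfXY by (intro Min_in) auto
      then obtain x where "x \<in> rng X" "F x \<le> v" using 2 by auto
      then have "Z (Suc x) (lo Y)" using *(4) by (simp add: pre_def)
      then show ?thesis using enter[of x "lo Y"] all \<open>x \<in> rng X\<close> wfXY lo_hi_rng(1) by blast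
    next
      case 3
      have "Min (F ` rng Y) \<in> F ` rng Y" using wfXY by (intro Min_in) auto
      then obtain y where "y \<in> rng Y" "F y \<le> v" using 3 by auto
      then have "Z (lo X) (Suc y)" using *(4) by (simp add: pre_def)
      then show ?thesis using enter[of "lo X" y] all \<open>y \<in> rng Y\<close> wfXY lo_hi_rng(1) by blast
    qed
  qed
  moreover have "pre ?Rl S T 0 (\<lambda>_. M)"
  proof -
    \<comment> \<open>The classes of \<open>0\<close> and \<open>k\<close> are singletons, so only
      the start is claimed; all other initial values are \<open>M\<close>, which exceeds
      \<open>v\<close> and imposes nothing.\<close>
    have "Z 0 k"
      unfolding Z_def
    proof (intro allI impI)
      fix x y assume "x \<le> k" "sS x = sS 0" "k \<le> y" "y \<le> k + l" "sT y = sT k"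
      then have "x = lo S" "y = lo T"
        using shifted_eq_lo[OF wf(1), of x \<theta>] shifted_eq_lo[OF wf(2), of y \<theta>] unfolding sS_def sT_def eqs by simp_all
      then have "x = 0" "y = k" using eqs by simp_all
      then show "reach \<delta> x y" by (simp add: reach.start)
    qed
    then show ?thesis using vM by (auto simp: pre_def eqs)
  qed
  moreover have "rng S \<inter> rng T = {}" using rng_full[OF ST] by auto
  ultimately have "post ?Rl S T (dp S T 0 (\<lambda>_. M))" using dp_invariant[OF wf] by blast
  moreover have "dp S T 0 (\<lambda>_. M) (hi T) \<le> v" using v by simp
  ultimately have "Z (Suc (hi S)) (Suc (hi T))" using lo_hi_rng(2)[OF wf(2)] unfolding post_def by blast
  then have "Z k (k + l)" unfolding eqs .
  then show ?thesis by (simp add: Z_def \<delta>_def)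
qed

section \<open>Building the trees\<close>

text \<open>The top element of the stack comes first.  Below the top, weights decrease geometrically; this is
  what bounds the length of a tree by the weight of its left neighbour.\<close>

fun strict_stack :: "itree list \<Rightarrow> bool" where
  "strict_stack (x # y # ts) \<longleftrightarrow> lo x = Suc (hi y) \<and> len x \<le> wt y \<and> 2 * wt x < wt y \<and> strict_stack (y # ts)"
| "strict_stack ts \<longleftrightarrow> True"

fun weak_stack :: "itree list \<Rightarrow> bool" where
  "weak_stack (x # y # ts) \<longleftrightarrow> lo x = Suc (hi y) \<and> len x \<le> wt y \<and> strict_stack (y # ts)"
| "weak_stack ts \<longleftrightarrow> True"

definition good_trees :: "nat \<Rightarrow> nat \<Rightarrow> itree list \<Rightarrow> bool" where
  "good_trees b m ts \<longleftrightarrow> weak_stack ts \<and> (\<forall>T\<in>set ts. wf_tree T \<and> balanced T) \<and>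
     (if ts = [] then m = b else m = Suc (hi (hd ts)) \<and> lo (last ts) = b)"

lemma strict_imp_weak: "strict_stack ts \<Longrightarrow> weak_stack ts"
  by (cases ts rule: strict_stack.cases) auto

lemma strict_stack_Cons: "strict_stack (x # ts) \<Longrightarrow> strict_stack ts"
  by (cases ts) auto

lemma good_push:
  assumes "good_trees b m ts" "\<And>x y r. ts = x # y # r \<Longrightarrow> 2 * wt x < wt y"
  shows "good_trees b (Suc m) (Lf m # ts)"
proof -
  have "strict_stack ts" using assms by (cases ts rule: strict_stack.cases) (auto simp: good_trees_def)
  then have "weak_stack (Lf m # ts)"
    using assms(1) len_nonneg el_nonneg
    by (cases ts) (auto simp: good_trees_def wt_def len.simps)
  then show ?thesis using assms(1) by (auto simp: good_trees_def)
qed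

text \<open>From \<open>len x \<le> wt y\<close> the new length is at most \<open>2 * wt y\<close>,
  which lies below the weight of the next tree by strictness: this is what the factor 2 in
  \<open>strict_stack\<close> is for. If \<open>wt y \<le> 2 * wt x\<close>, the length is also at
  most \<open>3 * wt x\<close>, the origin of the third in \<open>balanced\<close>.\<close>

lemma good_merge:
  assumes "good_trees b m (x # y # ts)" "lst (hi x) \<or> wt y \<le> 2 * wt x"
  shows "good_trees b m (Nd y x # ts)"
proof -
  have *: "lo x = Suc (hi y)" "len x \<le> wt y" "strict_stack (y # ts)" using assms(1) by (auto simp: good_trees_def)
  have len: "len (Nd y x) = wt y + len x" by (simp add: len.simps wt_def)
  have wt: "wt x = len x + el (hi x)" by (simp add: wt_def)
  have "weak_stack (Nd y x # ts)"
    using * by (cases ts) (auto simp: len strict_stack_Cons)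
  moreover have "balanced (Nd y x)"
    using assms * len_nonneg[of x] len_nonneg[of y] el_nonneg[of "hi x"] el_nonneg[of "hi y"]
    by (auto simp: len good_trees_def wt)
  ultimately show ?thesis using assms(1) * by (auto simp: good_trees_def)
qed

end

section \<open>Alignments\<close>

text \<open>Covers the three predecessors of a pair in the shifted indices: an alignment of the
  first \<open>i\<close> and \<open>j\<close> vertices ends at
  \<open>(i - 1, j - 1)\<close>.\<close>

lemma alignment_snoc:
  assumes A: "discrete_alignment i j A" "monotone_alignment A"
    and ij: "i = x \<or> i = Suc x" "j = y \<or> j = Suc y" "\<not> (i = Suc x \<and> j = Suc y)"
  shows "discrete_alignment (Suc x) (Suc y) (A @ [(x, y)])" "monotone_alignment (A @ [(x, y)])"
proof -
  have ne: "A \<noteq> []" and sub: "set A \<subseteq> {..<i} \<times> {..<j}" and hd: "hd A = (0, 0)" and last: "last A = (i - 1, j - 1)"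
    using A by (auto simp: discrete_alignment_def)
  have pos: "0 < i" "0 < j" using sub last_in_set[OF ne] by auto
  have sub': "set A \<subseteq> {..<Suc x} \<times> {..<Suc y}" using sub ij by fastforce
  have nth: "(A @ [(x, y)]) ! t = (if t < length A then A ! t else (x, y))" if "t < Suc (length A)" for t
    using that by (auto simp: nth_append)
  have lst: "A ! t = (i - 1, j - 1)" if "\<not> Suc t < length A" "Suc t < Suc (length A)" for t
  proof -
    have "t = length A - 1" using that by linarith
    then show ?thesis using last ne by (simp add: last_conv_nth)
  qed
  have K: "max \<bar>int (fst ((A @ [(x, y)]) ! t)) - int (fst ((A @ [(x, y)]) ! Suc t))\<bar>
            \<bar>int (snd ((A @ [(x, y)]) ! t)) - int (snd ((A @ [(x, y)]) ! Suc t))\<bar> = 1 \<and>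
     fst ((A @ [(x, y)]) ! t) \<le> fst ((A @ [(x, y)]) ! Suc t) \<and> snd ((A @ [(x, y)]) ! t) \<le> snd ((A @ [(x, y)]) ! Suc t)"
    if t: "Suc t < Suc (length A)" for t
  proof (cases "Suc t < length A")
    case True
    then show ?thesis using A by (simp add: nth discrete_alignment_def monotone_alignment_def)
  next
    case False
    then show ?thesis using lst[OF False t] t ij pos by (auto simp: nth)
  qed
  have len: "length (A @ [(x, y)]) = Suc (length A)" by simp
  show "discrete_alignment (Suc x) (Suc y) (A @ [(x, y)])"
    unfolding discrete_alignment_def len
  proof (intro conjI allI impI)
    show "set (A @ [(x, y)]) \<subseteq> {..<Suc x} \<times> {..<Suc y}" "hd (A @ [(x, y)]) = (0, 0)"
      using sub' hd ne by auto
    fix t assume "Suc t < Suc (length A)"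
    then show "max \<bar>int (fst ((A @ [(x, y)]) ! t)) - int (fst ((A @ [(x, y)]) ! Suc t))\<bar>
            \<bar>int (snd ((A @ [(x, y)]) ! t)) - int (snd ((A @ [(x, y)]) ! Suc t))\<bar> = 1"
      by (rule K[THEN conjunct1])
  qed simp_all
  show "monotone_alignment (A @ [(x, y)])"
    unfolding monotone_alignment_def len by (intro allI impI K[THEN conjunct2])
qed

section \<open>Reachability and the strong discrete Frechet distance\<close>

locale two_sequences =
  fixes P Q :: "'a::euclidean_space list" and eps :: real
  assumes P: "point_sequence P" and Q: "point_sequence Q" and eps: "0 < eps" "eps < 1"
begin

sublocale two_curves "length P" "length Q" eps "\<lambda>m. (P @ Q) ! m"
proof
  show "(P @ Q) ! m \<noteq> (P @ Q) ! Suc m" if "Suc m < length P + length Q" "Suc m \<noteq> length P" for m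
  proof (cases "Suc m < length P")
    case True
    then show ?thesis using P by (simp add: nth_append point_sequence_def)
  next
    case False
    then have "length P \<le> m" using that by simp
    then show ?thesis using Q that by (simp add: nth_append point_sequence_def Suc_diff_le)
  qed
qed (use P Q eps in \<open>auto simp: point_sequence_def\<close>)

lemma reach_imp_alignment:
  assumes "reach \<delta> i j" "(i, j) \<noteq> (0, length P)"
  shows "\<exists>A. discrete_alignment i (j - length P) A \<and> monotone_alignment A \<and>
    (\<forall>(x, y)\<in>set A. dist (P ! x) (Q ! y) \<le> \<delta>)"
  using assms
proof (induction rule: reach.induct)
  case (step x y)
  let ?y = "y - length P"
  have d: "dist (P ! x) (Q ! ?y) \<le> \<delta>" using step.hyps by (simp add: nth_append)
  show ?case
  proof (cases "(x, y) = (0, length P)")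
    case True
    then have "discrete_alignment (Suc x) (Suc y - length P) [(0, 0)]" by (simp add: discrete_alignment_def)
    then show ?thesis using d True by (auto simp: monotone_alignment_def intro!: exI[of _ "[(0, 0)]"])
  next
    case False
    let ?ex = "\<lambda>i j. \<exists>A. discrete_alignment i (j - length P) A \<and> monotone_alignment A \<and>
      (\<forall>(x, y)\<in>set A. dist (P ! x) (Q ! y) \<le> \<delta>)"
    let ?adj = "\<lambda>i j. (i = x \<or> i = Suc x) \<and> (j = y \<or> j = Suc y) \<and> \<not> (i = Suc x \<and> j = Suc y)"
    have ex: "?ex x y \<or> ?ex (Suc x) y \<or> ?ex x (Suc y)"
      using step.IH False step.hyps by (elim disjE conjE) simp_all
    have adj: "\<exists>i j. ?adj i j \<and> E i j" if E: "E x y \<or> E (Suc x) y \<or> E x (Suc y)" for E :: "nat \<Rightarrow> nat \<Rightarrow> bool"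
    proof -
      consider "E x y" | "E (Suc x) y" | "E x (Suc y)" using E by blast
      then show ?thesis
      proof cases
        case 1
        then show ?thesis by (intro exI[of _ x] exI[of _ y]) simp
      next
        case 2
        then show ?thesis by (intro exI[of _ "Suc x"] exI[of _ y]) simp
      next
        case 3
        then show ?thesis by (intro exI[of _ x] exI[of _ "Suc y"]) simp
      qed
    qed
    from adj[of ?ex, OF ex] obtain i j A where ij: "i = x \<or> i = Suc x" "j = y \<or> j = Suc y" "\<not> (i = Suc x \<and> j = Suc y)"
      and A: "discrete_alignment i (j - length P) A" "monotone_alignment A"
      "\<forall>(x, y)\<in>set A. dist (P ! x) (Q ! y) \<le> \<delta>"
      by (elim exE conjE) (rule that; assumption)
    have Suc_y: "Suc y - length P = Suc ?y" using step.hyps(2) by (simp add: Suc_diff_le)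
    have j: "j - length P = ?y \<or> j - length P = Suc ?y" using ij(2) Suc_y by metis
    have "\<not> (i = Suc x \<and> j - length P = Suc ?y)"
      using ij(2,3) Suc_y by (metis n_not_Suc_n)
    note snoc = alignment_snoc[OF A(1,2) ij(1) j this]
    have "\<forall>(x, y)\<in>set (A @ [(x, ?y)]). dist (P ! x) (Q ! y) \<le> \<delta>" using A(3) d by simp
    then show ?thesis using snoc unfolding Suc_y by blast
  qed
qed simp

lemma alignment_imp_reach:
  assumes A: "discrete_alignment (length P) (length Q) A" "monotone_alignment A"
    and d: "\<forall>(x, y)\<in>set A. dist (P ! x) (Q ! y) \<le> \<delta>" and t: "t < length A"
  shows "reach \<delta> (Suc (fst (A ! t))) (Suc (length P + snd (A ! t)))"
  using t
proof (induction t)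
  have mem: "fst (A ! t) < length P \<and> snd (A ! t) < length Q \<and> dist (P ! fst (A ! t)) (Q ! snd (A ! t)) \<le> \<delta>"
    if "t < length A" for t
    using nth_mem[OF that] A(1) d by (auto simp: discrete_alignment_def)
  {
    case 0
    then have "A ! 0 = (0, 0)" using A by (simp add: discrete_alignment_def hd_conv_nth)
    then show ?case using mem[OF 0] reach.start[of \<delta>] reach.step[of 0 "length P" \<delta>] by (simp add: nth_append)
  next
    case (Suc t)
    obtain x y where xy: "A ! t = (x, y)" by fastforce
    obtain x' y' where xy': "A ! Suc t = (x', y')" by fastforce
    have "max \<bar>int (fst (A ! t)) - int (fst (A ! Suc t))\<bar> \<bar>int (snd (A ! t)) - int (snd (A ! Suc t))\<bar> = 1"
      using A(1) Suc.prems unfolding discrete_alignment_def by blast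
    moreover have "fst (A ! t) \<le> fst (A ! Suc t) \<and> snd (A ! t) \<le> snd (A ! Suc t)"
      using A(2) Suc.prems unfolding monotone_alignment_def by blast
    ultimately have "x' = Suc x \<and> y' = Suc y \<or> x' = Suc x \<and> y' = y \<or> x' = x \<and> y' = Suc y"
      unfolding xy xy' fst_conv snd_conv by linarith
    moreover have "reach \<delta> (Suc x) (Suc (length P + y))" using Suc xy by simp
    ultimately show ?case using mem[OF Suc.prems] xy' reach.step[of x' "length P + y'" \<delta>] by (auto simp: nth_append)
  }
qed

lemma finite_passes: "finite {pass P Q A | A. discrete_alignment (length P) (length Q) A \<and> monotone_alignment A}"
proof (rule finite_subset)
  show "{pass P Q A | A. discrete_alignment (length P) (length Q) A \<and> monotone_alignment A}
    \<subseteq> (\<lambda>(i, j). dist (P ! i) (Q ! j)) ` ({..<length P} \<times> {..<length Q})"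
  proof safe
    fix A assume A: "discrete_alignment (length P) (length Q) A"
    then have "pass P Q A \<in> (\<lambda>(i, j). dist (P ! i) (Q ! j)) ` set A"
      unfolding pass_def by (intro Max_in) (auto simp: discrete_alignment_def)
    moreover have "set A \<subseteq> {..<length P} \<times> {..<length Q}" using A by (simp add: discrete_alignment_def)
    ultimately show "pass P Q A \<in> (\<lambda>(i, j). dist (P ! i) (Q ! j)) ` ({..<length P} \<times> {..<length Q})"
      by (rule subsetD[OF image_mono, rotated])
  qed
qed simp

lemma strong_frechet_le:
  assumes "reach \<delta> (length P) (length P + length Q)"
  shows "strong_frechet P Q \<le> \<delta>"
proof -
  obtain A where A: "discrete_alignment (length P) (length Q) A" "monotone_alignment A"
    "\<forall>(x, y)\<in>set A. dist (P ! x) (Q ! y) \<le> \<delta>"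
    using reach_imp_alignment[OF assms] k_pos unfolding diff_add_inverse by blast
  have "strong_frechet P Q \<le> pass P Q A"
    unfolding strong_frechet_def using A by (intro Min_le finite_passes CollectI exI[of _ A] conjI) simp_all
  also have "\<dots> \<le> \<delta>"
    unfolding pass_def using A by (subst Max_le_iff) (auto simp: discrete_alignment_def)
  finally show ?thesis .
qed

text \<open>Run through the first sequence, then through the second. With the largest distance as
  \<open>\<delta>\<close> this yields an alignment, so the minimum in \<open>strong_frechet\<close>
  is not over the empty set.\<close>

lemma reach_all:
  assumes d: "\<And>x y. x < length P \<Longrightarrow> y < length Q \<Longrightarrow> dist (P ! x) (Q ! y) \<le> \<delta>"
  shows "reach \<delta> (length P) (length P + length Q)"
proof -
  have 1: "reach \<delta> (Suc x) (Suc (length P))" if "x < length P" for x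
    using that
  proof (induction x)
    case 0
    then show ?case using d[of 0 0] l_pos reach.step[of 0 "length P" \<delta>] reach.start[of \<delta>] by (simp add: nth_append)
  next
    case (Suc x)
    then show ?case using d[of "Suc x" 0] l_pos k_pos reach.step[of "Suc x" "length P" \<delta>] by (simp add: nth_append)
  qed
  have 2: "reach \<delta> (length P) (Suc (length P + y))" if "y < length Q" for y
    using that
  proof (induction y)
    case 0
    then show ?case using 1[of "length P - 1"] k_pos by simp
  next
    case (Suc y)
    obtain x where x: "length P = Suc x" using k_pos by (cases "length P") auto
    have "reach \<delta> (Suc x) (Suc (length P + Suc y))"
      using d[of x "Suc y"] Suc x reach.step[of x "Suc (length P + y)" \<delta>] by (simp add: nth_append)
    then show ?case using x by simp
  qed
  show ?thesis using 2[of "length Q - 1"] l_pos by simp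
qed

lemma strong_frechet_reach: "reach (strong_frechet P Q) (length P) (length P + length Q)"
  and strong_frechet_in: "\<exists>x y. x < length P \<and> y < length Q \<and> strong_frechet P Q = dist (P ! x) (Q ! y)"
proof -
  let ?\<delta> = "Max ((\<lambda>(i, j). dist (P ! i) (Q ! j)) ` ({..<length P} \<times> {..<length Q}))"
  have "dist (P ! x) (Q ! y) \<le> ?\<delta>" if "x < length P" "y < length Q" for x y
    using that by (intro Max_ge) auto
  then have "reach ?\<delta> (length P) (length P + length Q)" by (rule reach_all)
  then obtain A0 where "discrete_alignment (length P) (length Q) A0" "monotone_alignment A0"
    using reach_imp_alignment[of ?\<delta> "length P" "length P + length Q"] k_pos unfolding diff_add_inverse by blast
  then have "{pass P Q A | A. discrete_alignment (length P) (length Q) A \<and> monotone_alignment A} \<noteq> {}" by blast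
  from Min_in[OF finite_passes this] obtain A where A: "discrete_alignment (length P) (length Q) A" "monotone_alignment A"
    and eq: "strong_frechet P Q = pass P Q A"
    by (auto simp: strong_frechet_def)
  have ne: "A \<noteq> []" and last: "last A = (length P - 1, length Q - 1)" using A by (auto simp: discrete_alignment_def)
  have "\<forall>(x, y)\<in>set A. dist (P ! x) (Q ! y) \<le> pass P Q A"
    unfolding pass_def by (auto intro!: Max_ge)
  then have "reach (pass P Q A) (Suc (fst (A ! (length A - 1)))) (Suc (length P + snd (A ! (length A - 1))))"
    using ne by (intro alignment_imp_reach[OF A]) simp_all
  moreover have "A ! (length A - 1) = (length P - 1, length Q - 1)" using last ne by (simp add: last_conv_nth)
  moreover have "Suc (length P - 1) = length P" "Suc (length P + (length Q - 1)) = length P + length Q"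
    using k_pos l_pos by linarith+
  ultimately show "reach (strong_frechet P Q) (length P) (length P + length Q)"
    by (simp only: eq fst_conv snd_conv)
  have "pass P Q A \<in> (\<lambda>(i, j). dist (P ! i) (Q ! j)) ` set A"
    unfolding pass_def using ne by (intro Max_in) auto
  then show "\<exists>x y. x < length P \<and> y < length Q \<and> strong_frechet P Q = dist (P ! x) (Q ! y)"
    using A eq by (auto simp: discrete_alignment_def)
qed

text \<open>\<open>M\<close> plays the role of infinity: the triangle inequality through the first
  vertices gives \<open>2 * strong_frechet P Q + 1 \<le> M\<close>, while
  \<open>v \<le> u \<le> 4 / 3 * strong_frechet P Q\<close>, so \<open>v < M\<close> as
  \<open>dp_sound\<close> requires.\<close>

theorem dp_approx:
  assumes ST: "full S T" and M: "2 * (len S + len T + dist (P ! 0) (Q ! 0)) + 1 \<le> M"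
    and v: "v = dp S T 0 (\<lambda>_. M) (hi T)" and v0: "0 \<le> v"
  shows "strong_frechet P Q \<le> (1 + eps / 2) * v" "(1 + eps / 2) * v \<le> (1 + eps) * strong_frechet P Q"
proof -
  let ?s = "strong_frechet P Q"
  have in_seq: "inseq S" "inseq T" using full_inseq[OF ST] by auto
  obtain x y where xy: "x < length P" "y < length Q" "?s = dist (P ! x) (Q ! y)" using strong_frechet_in by blast
  have s0: "0 \<le> ?s" using xy by simp
  have "dist (P ! 0) (P ! x) \<le> len S"
    using dist_le_len[OF in_seq(1), of 0 x] xy rng_full[OF ST] k_pos by (simp add: nth_append)
  moreover have "dist (Q ! 0) (Q ! y) \<le> len T"
    using dist_le_len[OF in_seq(2), of "length P" "length P + y"] xy rng_full[OF ST] l_pos by (simp add: nth_append)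
  ultimately have sM: "?s \<le> len S + len T + dist (P ! 0) (Q ! 0)"
    using xy dist_triangle[of "P ! x" "Q ! y" "P ! 0"] dist_triangle[of "P ! 0" "Q ! y" "Q ! 0"]
    by (simp add: dist_commute)
  define u where "u = ?s / (1 - eps / 4)"
  have u: "(1 - eps / 4) * u = ?s" "0 \<le> u" using eps s0 by (auto simp: u_def)
  have vu: "v \<le> u"
    unfolding v by (rule dp_complete[OF ST strong_frechet_reach u(2)]) (simp only: u(1))
  have "eps * u \<le> u" using u(2) eps by (simp add: mult_left_le_one_le)
  moreover have "u - eps * u / 4 = ?s" using u(1) by (simp add: left_diff_distrib)
  moreover have "v < M" if "e \<le> u" "u - e / 4 = s" "v \<le> u" "s \<le> a" "2 * a + 1 \<le> M" "0 \<le> s"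
    for e u s v a M :: real
    using that by linarith
  ultimately have "v < M" using vu sM M s0 by blast
  from strong_frechet_le[OF dp_sound[OF ST v this v0]] show "?s \<le> (1 + eps / 2) * v" .
  have "eps * eps \<le> eps" using eps by (simp add: mult_left_le_one_le)
  moreover have "(1 + eps) * (1 - eps / 4) = 1 + 3 / 4 * eps - eps * eps / 4" by (simp add: field_simps)
  moreover have "1 + e / 2 \<le> z" if "q \<le> e" "z = 1 + 3 / 4 * e - q / 4" for e q z :: real
    using that by simp
  ultimately have "1 + eps / 2 \<le> (1 + eps) * (1 - eps / 4)" by blast
  then have "(1 + eps / 2) * u \<le> (1 + eps) * (1 - eps / 4) * u" using u(2) by (rule mult_right_mono)
  also have "\<dots> = (1 + eps) * ((1 - eps / 4) * u)" by (rule mult.assoc)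
  finally have "(1 + eps / 2) * u \<le> (1 + eps) * ?s" by (simp only: u)
  moreover have "(1 + eps / 2) * v \<le> (1 + eps / 2) * u"
    using eps by (intro mult_left_mono[OF vu]) simp
  ultimately show "(1 + eps / 2) * v \<le> (1 + eps) * ?s" by (rule order_trans[rotated])
qed

end

section \<open>Programs over arrays\<close>

text \<open>Per node: children \<open>Lc\<close>, \<open>Rc\<close>, first vertex \<open>Fs\<close>,
  lazy flag \<open>Lz\<close>, length \<open>Len\<close>, weight \<open>Wt\<close>, minimum
  \<open>Mn\<close> and last value \<open>Ls\<close> of the frontier. \<open>Stk\<close> is the
  stack of roots during construction. \<open>FX\<close>, \<open>FY\<close>, \<open>FC\<close> and
  \<open>FK\<close> form the recursion stack, where \<open>FK\<close> is 1 for a split pair that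
  waits to be combined. Scalars sit in entry 0: next vertex \<open>Mv\<close>, end
  \<open>Ev\<close>, height \<open>Sp\<close> of the current stack, saved root \<open>RtP\<close>,
  distance \<open>Dw\<close>.\<close>

datatype nf = Lc | Rc | Fs | Lz | Stk | FX | FY | FK | Mv | Ev | Sp | RtP | Tmp
datatype rf = Len | Wt | Mn | Ls | FC | Dw

datatype nx = NC nat | NV nf nx | NP nx nx | NM nx nx | NK | NQ
datatype rx = RC int | RV rf nx | RP rx rx | RT rx rx | RE
datatype bx = NL nx nx | RL rx rx | BN bx | BA bx bx
datatype cx = SK | SN nf nx nx | SR rf nx rx | SD rf nx nx nx | SQ cx cx | IF bx cx cx

type_synonym arrays = "(nf \<Rightarrow> nat \<Rightarrow> nat) \<times> (rf \<Rightarrow> nat \<Rightarrow> real)"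

context two_curves
begin

fun neval :: "nx \<Rightarrow> arrays \<Rightarrow> nat" where
  "neval (NC m) s = m"
| "neval (NV f a) s = fst s f (neval a s)"
| "neval (NP a b) s = neval a s + neval b s"
| "neval (NM a b) s = neval a s - neval b s"
| "neval NK s = k"
| "neval NQ s = l"

fun reval :: "rx \<Rightarrow> arrays \<Rightarrow> real" where
  "reval (RC z) s = of_int z"
| "reval (RV f a) s = snd s f (neval a s)"
| "reval (RP a b) s = reval a s + reval b s"
| "reval (RT a b) s = reval a s * reval b s"
| "reval RE s = eps"

fun beval :: "bx \<Rightarrow> arrays \<Rightarrow> bool" where
  "beval (NL a b) s \<longleftrightarrow> neval a s < neval b s"
| "beval (RL a b) s \<longleftrightarrow> reval a s < reval b s"
| "beval (BN b) s \<longleftrightarrow> \<not> beval b s"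
| "beval (BA b b') s \<longleftrightarrow> beval b s \<and> beval b' s"

text \<open>Loop-free programs have a total semantics that simplification evaluates; loops appear
  only through \<open>iter\<close>. The guard of \<open>SD\<close> confines vertex numbers to the
  input, outside of which the RAM would read scratch cells as coordinates.\<close>

fun ceval :: "cx \<Rightarrow> arrays \<Rightarrow> arrays" where
  "ceval SK s = s"
| "ceval (SN f a e) s = ((fst s)(f := (fst s f)(neval a s := neval e s)), snd s)"
| "ceval (SR f a e) s = (fst s, (snd s)(f := (snd s f)(neval a s := reval e s)))"
| "ceval (SD f a x y) s =
     (if neval x s < k + l \<and> neval y s < k + l
      then (fst s, (snd s)(f := (snd s f)(neval a s := dist (pt (neval x s)) (pt (neval y s))))) else s)"
| "ceval (SQ p q) s = ceval q (ceval p s)"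
| "ceval (IF b p q) s = (if beval b s then ceval p s else ceval q s)"

fun iter :: "bx \<Rightarrow> cx \<Rightarrow> nat \<Rightarrow> arrays \<Rightarrow> arrays \<Rightarrow> bool" where
  "iter b p 0 s s' \<longleftrightarrow> s = s'"
| "iter b p (Suc n) s s' \<longleftrightarrow> beval b s \<and> iter b p n (ceval p s) s'"

lemma iter_add: "iter b p m s s' \<Longrightarrow> iter b p n s' s'' \<Longrightarrow> iter b p (m + n) s s''"
  by (induction m arbitrary: s) auto

end

section \<open>Compilation to the real RAM\<close>

text \<open>Entry \<open>i\<close> of the array with number \<open>f < 16\<close> is cell \<open>f + 16 * i\<close> behind a fixed offset.  The offset
  into the real memory depends on the size of the input; it is kept in cell 2 of the other memory.\<close>

fun nidx :: "nf \<Rightarrow> nat" where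
  "nidx Lc = 0" | "nidx Rc = 1" | "nidx Fs = 2" | "nidx Lz = 3" | "nidx Stk = 4" | "nidx FX = 5"
| "nidx FY = 6" | "nidx FK = 7" | "nidx Mv = 8" | "nidx Ev = 9" | "nidx Sp = 10" | "nidx RtP = 11"
| "nidx Tmp = 12"

fun ridx :: "rf \<Rightarrow> nat" where
  "ridx Len = 0" | "ridx Wt = 1" | "ridx Mn = 2" | "ridx Ls = 3" | "ridx FC = 4" | "ridx Dw = 5"

text \<open>Replaces the missing product of natural numbers. The factors are 16 and the dimension,
  both fixed, so the cost stays constant.\<close>

fun ntimes :: "nat \<Rightarrow> nexp \<Rightarrow> nexp" where
  "ntimes 0 e = NConst 0"
| "ntimes (Suc m) e = NAdd e (ntimes m e)"

definition naddr :: "nf \<Rightarrow> nexp \<Rightarrow> nexp" where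
  "naddr f e = NAdd (NConst (3 + nidx f)) (ntimes 16 e)"

definition raddr :: "rf \<Rightarrow> nexp \<Rightarrow> nexp" where
  "raddr f e = NAdd (NAdd (NLoad (NConst 2)) (NConst (ridx f))) (ntimes 16 e)"

definition coord :: "nat \<Rightarrow> nat \<Rightarrow> nexp \<Rightarrow> rexp" where
  "coord d t e = RLoad (NAdd (NConst (Suc t)) (ntimes d e))"

fun sqdist :: "nat \<Rightarrow> nat \<Rightarrow> nexp \<Rightarrow> nexp \<Rightarrow> rexp" where
  "sqdist d 0 a b = RConst 0"
| "sqdist d (Suc t) a b =
     RAdd (sqdist d t a b) (RMul (RSub (coord d t a) (coord d t b)) (RSub (coord d t a) (coord d t b)))"

fun ncomp :: "nx \<Rightarrow> nexp" where
  "ncomp (NC m) = NConst m"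
| "ncomp (NV f a) = NLoad (naddr f (ncomp a))"
| "ncomp (NP a b) = NAdd (ncomp a) (ncomp b)"
| "ncomp (NM a b) = NSub (ncomp a) (ncomp b)"
| "ncomp NK = NLoad (NConst 0)"
| "ncomp NQ = NLoad (NConst 1)"

fun rcomp :: "rx \<Rightarrow> rexp" where
  "rcomp (RC z) = RConst z"
| "rcomp (RV f a) = RLoad (raddr f (ncomp a))"
| "rcomp (RP a b) = RAdd (rcomp a) (rcomp b)"
| "rcomp (RT a b) = RMul (rcomp a) (rcomp b)"
| "rcomp RE = RLoad (NConst 0)"

fun bcomp :: "bx \<Rightarrow> bexp" where
  "bcomp (NL a b) = NLess (ncomp a) (ncomp b)"
| "bcomp (RL a b) = RLess (rcomp a) (rcomp b)"
| "bcomp (BN b) = BNot (bcomp b)"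
| "bcomp (BA b b') = BAnd (bcomp b) (bcomp b')"

fun ccomp :: "nat \<Rightarrow> cx \<Rightarrow> com" where
  "ccomp d SK = Skip"
| "ccomp d (SN f a e) = NStore (naddr f (ncomp a)) (ncomp e)"
| "ccomp d (SR f a e) = RStore (raddr f (ncomp a)) (rcomp e)"
| "ccomp d (SD f a x y) =
     (let n = NAdd (NLoad (NConst 0)) (NLoad (NConst 1)) in
      Cond (BAnd (NLess (ncomp x) n) (NLess (ncomp y) n))
        (RStore (raddr f (ncomp a)) (RSqrt (sqdist d d (ncomp x) (ncomp y)))) Skip)"
| "ccomp d (SQ p q) = Seq (ccomp d p) (ccomp d q)"
| "ccomp d (IF b p q) = Cond (bcomp b) (ccomp d p) (ccomp d q)"

text \<open>Only meaningful for programs without loops.\<close>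

fun maxcost :: "com \<Rightarrow> nat" where
  "maxcost Skip = 1"
| "maxcost (NStore a e) = 1 + ncost a + ncost e"
| "maxcost (RStore a e) = 1 + ncost a + rcost e"
| "maxcost (Seq p q) = maxcost p + maxcost q"
| "maxcost (Cond b p q) = 1 + bcost b + max (maxcost p) (maxcost q)"
| "maxcost (While b p) = 0"

definition loopcost :: "nat \<Rightarrow> bx \<Rightarrow> cx \<Rightarrow> nat" where
  "loopcost d b p = 1 + bcost (bcomp b) + maxcost (ccomp d p)"

lemma nval_ntimes [simp]: "nval (ntimes m e) s = m * nval e s"
  by (induction m) auto

lemma nidx_less: "nidx f < 16"
  by (cases f) auto

lemma ridx_less: "ridx f < 16"
  by (cases f) auto

lemma nidx_eq [simp]: "nidx f = nidx g \<longleftrightarrow> f = g"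
  by (cases f; cases g; simp)

lemma ridx_eq [simp]: "ridx f = ridx g \<longleftrightarrow> f = g"
  by (cases f; cases g; simp)

lemma cell_eq: "m < 16 \<Longrightarrow> m' < 16 \<Longrightarrow> m + 16 * i = m' + 16 * i' \<longleftrightarrow> m = m' \<and> i = (i'::nat)"
proof
  assume a: "m < 16" "m' < 16" and e: "m + 16 * i = m' + 16 * i'"
  have "(m + 16 * i) mod 16 = m" "(m' + 16 * i') mod 16 = m'" using a by simp_all
  with e show "m = m' \<and> i = i'" by simp
qed simp

lemma ncell_eq: "nidx f + 16 * i = nidx g + 16 * j \<longleftrightarrow> f = g \<and> i = j"
  using cell_eq[OF nidx_less nidx_less] by simp

lemma rcell_eq: "ridx f + 16 * i = ridx g + 16 * j \<longleftrightarrow> f = g \<and> i = j"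
  using cell_eq[OF ridx_less ridx_less] by simp

section \<open>Simulation of array programs on the real RAM\<close>

locale ram_input = two_curves +
  fixes d :: nat and co :: "nat \<Rightarrow> nat \<Rightarrow> real"
  assumes dist_co: "\<And>m m'. m < k + l \<Longrightarrow> m' < k + l \<Longrightarrow>
    dist (pt m) (pt m') = sqrt (\<Sum>t<d. (co m t - co m' t)\<^sup>2)"
begin

text \<open>The first cell of the real memory behind the input.\<close>

definition base :: nat where
  "base = 1 + d * (k + l)"

definition ok :: "ram_state \<Rightarrow> bool" where
  "ok s \<longleftrightarrow> fst s 0 = k \<and> fst s 1 = l \<and> fst s 2 = base \<and> snd s 0 = eps \<and>
     (\<forall>m<k + l. \<forall>t<d. snd s (Suc t + d * m) = co m t)"

definition view :: "ram_state \<Rightarrow> arrays" where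
  "view s = ((\<lambda>f i. fst s (3 + nidx f + 16 * i)), (\<lambda>f i. snd s (base + ridx f + 16 * i)))"

lemma input_cell: "m < k + l \<Longrightarrow> t < d \<Longrightarrow> Suc t + d * m < base"
proof -
  assume "m < k + l" "t < d"
  then have "d * Suc m \<le> d * (k + l)" by (intro mult_le_mono2) simp
  then show ?thesis using \<open>t < d\<close> by (simp add: base_def)
qed

lemma nval_ncomp: "ok s \<Longrightarrow> nval (ncomp e) s = neval e (view s)"
  by (induction e) (auto simp: ok_def view_def naddr_def)

lemma rval_rcomp: "ok s \<Longrightarrow> rval (rcomp e) s = reval e (view s)"
  by (induction e) (auto simp: nval_ncomp raddr_def, auto simp: ok_def view_def)

lemma bval_bcomp: "ok s \<Longrightarrow> bval (bcomp b) s = beval b (view s)"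
  by (induction b) (auto simp: nval_ncomp rval_rcomp)

lemma rval_sqdist:
  assumes "ok s" "nval a s < k + l" "nval b s < k + l" "t \<le> d"
  shows "rval (sqdist d t a b) s = (\<Sum>t<t. (co (nval a s) t - co (nval b s) t)\<^sup>2)"
  using assms(4)
proof (induction t)
  case (Suc t)
  then show ?case using assms by (simp add: coord_def ok_def power2_eq_square)
qed simp

lemma store_nat:
  assumes "ok s"
  shows "ok ((fst s)(3 + nidx f + 16 * i := x), snd s)"
    and "view ((fst s)(3 + nidx f + 16 * i := x), snd s) =
      ((fst (view s))(f := (fst (view s) f)(i := x)), snd (view s))"
proof -
  show "ok ((fst s)(3 + nidx f + 16 * i := x), snd s)" using assms by (auto simp: ok_def)
  have "3 + nidx g + 16 * j = 3 + nidx f + 16 * i \<longleftrightarrow> g = f \<and> j = i" for g j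
    using ncell_eq[of g j f i] by simp
  then show "view ((fst s)(3 + nidx f + 16 * i := x), snd s) =
      ((fst (view s))(f := (fst (view s) f)(i := x)), snd (view s))"
    by (auto simp: view_def fun_eq_iff)
qed

lemma store_real:
  assumes "ok s"
  shows "ok (fst s, (snd s)(base + ridx f + 16 * i := x))"
    and "view (fst s, (snd s)(base + ridx f + 16 * i := x)) =
      (fst (view s), (snd (view s))(f := (snd (view s) f)(i := x)))"
proof -
  let ?a = "base + ridx f + 16 * i"
  have "((snd s)(?a := x)) (Suc t + d * m) = snd s (Suc t + d * m)" if "m < k + l" "t < d" for m t
    using input_cell[OF that] by simp
  moreover have "((snd s)(?a := x)) 0 = snd s 0" by (simp add: base_def)
  ultimately show "ok (fst s, (snd s)(?a := x))"
    using assms unfolding ok_def fst_conv snd_conv by metis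
  have "base + ridx g + 16 * j = base + ridx f + 16 * i \<longleftrightarrow> g = f \<and> j = i" for g j
    using rcell_eq[of g j f i] by simp
  then show "view (fst s, (snd s)(base + ridx f + 16 * i := x)) =
      (fst (view s), (snd (view s))(f := (snd (view s) f)(i := x)))"
    by (auto simp: view_def fun_eq_iff)
qed

lemma nval_naddr: "ok s \<Longrightarrow> nval (naddr f (ncomp a)) s = 3 + nidx f + 16 * neval a (view s)"
  by (simp add: naddr_def nval_ncomp)

lemma nval_raddr: "ok s \<Longrightarrow> nval (raddr f (ncomp a)) s = base + ridx f + 16 * neval a (view s)"
  by (simp add: raddr_def nval_ncomp, simp add: ok_def)

lemma exec_ccomp:
  assumes "ok s"
  shows "\<exists>t s'. exec (ccomp d p) s t s' \<and> t \<le> maxcost (ccomp d p) \<and> ok s' \<and> view s' = ceval p (view s)"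
  using assms
proof (induction p arbitrary: s)
  case SK
  then show ?case using exec.Skip[of s] by (intro exI[of _ 1] exI[of _ s]) simp
next
  case (SN f a e)
  have "exec (ccomp d (SN f a e)) s (maxcost (ccomp d (SN f a e)))
      ((fst s)(3 + nidx f + 16 * neval a (view s) := neval e (view s)), snd s)"
    using exec.NStore[of "naddr f (ncomp a)" "ncomp e" s] SN by (simp only: nval_naddr nval_ncomp ccomp.simps maxcost.simps)
  then show ?case using store_nat[OF SN] by (metis ceval.simps(2) order_refl)
next
  case (SR f a e)
  have "exec (ccomp d (SR f a e)) s (maxcost (ccomp d (SR f a e)))
      (fst s, (snd s)(base + ridx f + 16 * neval a (view s) := reval e (view s)))"
    using exec.RStore[of "raddr f (ncomp a)" "rcomp e" s] SR by (simp only: nval_raddr rval_rcomp ccomp.simps maxcost.simps)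
  then show ?case using store_real[OF SR] by (metis ceval.simps(3) order_refl)
next
  case (SD f a x y)
  let ?b = "BAnd (NLess (ncomp x) (NAdd (NLoad (NConst 0)) (NLoad (NConst 1))))
    (NLess (ncomp y) (NAdd (NLoad (NConst 0)) (NLoad (NConst 1))))"
  let ?p = "RStore (raddr f (ncomp a)) (RSqrt (sqdist d d (ncomp x) (ncomp y)))"
  have b: "bval ?b s \<longleftrightarrow> neval x (view s) < k + l \<and> neval y (view s) < k + l"
    using SD by (simp add: nval_ncomp, simp add: ok_def)
  show ?case
  proof (cases "bval ?b s")
    case True
    then have lt: "neval x (view s) < k + l" "neval y (view s) < k + l" using b by auto
    have val: "rval (RSqrt (sqdist d d (ncomp x) (ncomp y))) s = dist (pt (neval x (view s))) (pt (neval y (view s)))"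
      using lt SD by (simp add: rval_sqdist nval_ncomp dist_co)
    have "exec ?p s (1 + ncost (raddr f (ncomp a)) + rcost (RSqrt (sqdist d d (ncomp x) (ncomp y))))
      (fst s, (snd s)(base + ridx f + 16 * neval a (view s) := dist (pt (neval x (view s))) (pt (neval y (view s)))))"
      using exec.RStore[of "raddr f (ncomp a)" "RSqrt (sqdist d d (ncomp x) (ncomp y))" s] SD
      by (simp only: nval_raddr val)
    from exec.CondTrue[OF True this, of Skip] show ?thesis
      using store_real[OF SD] lt by (intro exI conjI) (assumption | simp add: Let_def)+
  next
    case False
    have "ceval (SD f a x y) (view s) = view s" using b False by (auto simp del: bval.simps)
    with exec.CondFalse[OF False exec.Skip, of ?p] show ?thesis
      using SD by (intro exI conjI) (assumption | simp add: Let_def del: ceval.simps)+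
  qed
next
  case (SQ p q)
  obtain t s' where 1: "exec (ccomp d p) s t s'" "t \<le> maxcost (ccomp d p)" "ok s'" "view s' = ceval p (view s)"
    using SQ by blast
  obtain t' s'' where 2: "exec (ccomp d q) s' t' s''" "t' \<le> maxcost (ccomp d q)" "ok s''" "view s'' = ceval q (view s')"
    using SQ 1 by blast
  show ?case using exec.Seq[OF 1(1) 2(1)] 1 2 by (intro exI[of _ "t + t'"] exI[of _ s'']) simp
next
  case (IF b p q)
  show ?case
  proof (cases "bval (bcomp b) s")
    case True
    obtain t s' where "exec (ccomp d p) s t s'" "t \<le> maxcost (ccomp d p)" "ok s'" "view s' = ceval p (view s)"
      using IF by blast
    then show ?thesis using exec.CondTrue[OF True] True bval_bcomp[OF IF.prems]
      by (intro exI[of _ "1 + bcost (bcomp b) + t"] exI[of _ s']) simp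
  next
    case False
    obtain t s' where "exec (ccomp d q) s t s'" "t \<le> maxcost (ccomp d q)" "ok s'" "view s' = ceval q (view s)"
      using IF by blast
    then show ?thesis using exec.CondFalse[OF False] False bval_bcomp[OF IF.prems]
      by (intro exI[of _ "1 + bcost (bcomp b) + t"] exI[of _ s']) simp
  qed
qed

lemma exec_while:
  assumes "ok s" "iter b p n (view s) \<sigma>" "\<not> beval b \<sigma>"
  shows "\<exists>t s'. exec (While (bcomp b) (ccomp d p)) s t s' \<and> t \<le> Suc n * loopcost d b p \<and> ok s' \<and> view s' = \<sigma>"
  using assms
proof (induction n arbitrary: s)
  case 0
  then have "exec (While (bcomp b) (ccomp d p)) s (1 + bcost (bcomp b)) s"
    by (intro exec.WhileFalse) (simp add: bval_bcomp)
  then show ?case using 0 by (intro exI conjI) (assumption | simp add: loopcost_def)+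
next
  case (Suc n)
  obtain t s' where 1: "exec (ccomp d p) s t s'" "t \<le> maxcost (ccomp d p)" "ok s'" "view s' = ceval p (view s)"
    using exec_ccomp[OF Suc.prems(1)] by blast
  obtain t' s'' where 2: "exec (While (bcomp b) (ccomp d p)) s' t' s''" "t' \<le> Suc n * loopcost d b p" "ok s''" "view s'' = \<sigma>"
    using Suc.IH[of s'] Suc.prems 1 by auto
  have "bval (bcomp b) s" using Suc.prems by (simp add: bval_bcomp)
  from exec.WhileTrue[OF this 1(1) 2(1)] show ?case
    using 1 2 by (intro exI[of _ "1 + bcost (bcomp b) + t + t'"] exI[of _ s'']) (simp add: loopcost_def)
qed

end

section \<open>The programs\<close>

abbreviation var :: "nf \<Rightarrow> nx" where
  "var f \<equiv> NV f (NC 0)"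

abbreviation top1 :: nx where
  "top1 \<equiv> NV Stk (NM (var Sp) (NC 1))"

abbreviation top2 :: nx where
  "top2 \<equiv> NV Stk (NM (var Sp) (NC 2))"

definition build_cond :: bx where
  "build_cond = BN (BA (BN (NL (var Mv) (var Ev))) (BN (NL (NC 1) (var Sp))))"

text \<open>Once all vertices are pushed, merging is unconditional: the top tree then ends its
  curve, and \<open>balanced\<close> asks nothing of the weight of such a right child.\<close>

definition merge_cond :: bx where
  "merge_cond = BA (NL (NC 1) (var Sp))
     (BN (BA (NL (var Mv) (var Ev)) (RL (RP (RV Wt top1) (RV Wt top1)) (RV Wt top2))))"

definition merge_prog :: cx where
  "merge_prog =
     SQ (SN Tmp (NC 0) (NM (NP (NV Fs top1) (NV Fs top1)) (NC 1)))
    (SQ (SN Lc (var Tmp) top2)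
    (SQ (SN Rc (var Tmp) top1)
    (SQ (SN Fs (var Tmp) (NV Fs top2))
    (SQ (SR Len (var Tmp) (RP (RV Wt top2) (RV Len top1)))
    (SQ (SR Wt (var Tmp) (RP (RV Wt top2) (RV Wt top1)))
    (SQ (SN Stk (NM (var Sp) (NC 2)) (var Tmp))
        (SN Sp (NC 0) (NM (var Sp) (NC 1)))))))))"

definition push_prog :: cx where
  "push_prog =
     SQ (SN Tmp (NC 0) (NP (var Mv) (var Mv)))
    (SQ (SN Fs (var Tmp) (var Mv))
    (SQ (SR Len (var Tmp) (RC 0))
    (SQ (IF (NL (NP (var Mv) (NC 1)) (var Ev)) (SD Wt (var Tmp) (var Mv) (NP (var Mv) (NC 1))) (SR Wt (var Tmp) (RC 0)))
    (SQ (SN Stk (var Sp) (var Tmp))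
    (SQ (SN Sp (NC 0) (NP (var Sp) (NC 1)))
        (SN Mv (NC 0) (NP (var Mv) (NC 1))))))))"

definition build_body :: cx where
  "build_body = IF merge_cond merge_prog push_prog"

abbreviation ftop :: nx where
  "ftop \<equiv> NM (var Sp) (NC 1)"

abbreviation fX :: nx where
  "fX \<equiv> NV FX ftop"

abbreviation fY :: nx where
  "fY \<equiv> NV FY ftop"

definition pull_prog :: cx where
  "pull_prog =
     SQ (SR Mn fX (RV Mn (NV Lc fX)))
    (SQ (IF (RL (RV Mn (NV Rc fX)) (RV Mn fX)) (SR Mn fX (RV Mn (NV Rc fX))) SK)
    (SQ (SR Ls fX (RV Ls (NV Rc fX)))
    (SQ (SN Lz fX (NC 0))
        (SN Sp (NC 0) ftop))))"

definition leaf_prog :: cx where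
  "leaf_prog =
     SQ (IF (RL (RV Mn fY) (RV Mn fX)) (SR Mn fX (RV Mn fY)) SK)
    (SQ (IF (RL (RV FC ftop) (RV Mn fX)) (SR Mn fX (RV FC ftop)) SK)
    (SQ (IF (RL (RV Mn fX) (RV Dw (NC 0))) (SR Mn fX (RV Dw (NC 0))) SK)
    (SQ (SR Ls fX (RV Mn fX))
    (SQ (SR Mn fY (RV Mn fX))
    (SQ (SR Ls fY (RV Mn fX))
    (SQ (SN Lz fX (NC 1))
    (SQ (SN Lz fY (NC 1))
        (SN Sp (NC 0) ftop))))))))"

definition swap_prog :: cx where
  "swap_prog = SQ (SN Tmp (NC 0) fX) (SQ (SN FX ftop fY) (SN FY ftop (var Tmp)))"

abbreviation fA :: nx where
  "fA \<equiv> NV Lc fX"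

abbreviation fB :: nx where
  "fB \<equiv> NV Rc fX"

text \<open>The flag of the node itself stays set; the pull that concludes the split clears it, and
  the node is not consulted in between.\<close>

definition push_down :: cx where
  "push_down = IF (NL (NC 0) (NV Lz fX))
     (SQ (SR Mn fA (RV Mn fX)) (SQ (SR Ls fA (RV Mn fX)) (SQ (SN Lz fA (NC 1))
     (SQ (SR Mn fB (RV Mn fX)) (SQ (SR Ls fB (RV Mn fX)) (SN Lz fB (NC 1))))))) SK"

text \<open>The frame of the right child is placed below that of the left one, which therefore runs
  first. The corner value of the right child is saved before the left child overwrites it, and after
  \<open>push_down\<close>, without which it might be stale.\<close>

definition split_prog :: cx where
  "split_prog =
     SQ push_down
    (SQ (SN FX (var Sp) fB)
    (SQ (SN FY (var Sp) fY)
    (SQ (SR FC (var Sp) (RV Ls fA))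
    (SQ (SN FK (var Sp) (NC 0))
    (SQ (SN FX (NP (var Sp) (NC 1)) fA)
    (SQ (SN FY (NP (var Sp) (NC 1)) fY)
    (SQ (SR FC (NP (var Sp) (NC 1)) (RV FC ftop))
    (SQ (SN FK (NP (var Sp) (NC 1)) (NC 0))
    (SQ (SN FK ftop (NC 1))
        (SN Sp (NC 0) (NP (var Sp) (NC 2))))))))))))"

definition dp_cond :: bx where
  "dp_cond = NL (NC 0) (var Sp)"

definition dp_body :: cx where
  "dp_body = IF (NL (NC 0) (NV FK ftop)) pull_prog
     (SQ (SD Dw (NC 0) (NV Fs fX) (NV Fs fY))
       (IF (BN (RL (RT RE (RV Dw (NC 0))) (RT (RC 4) (RP (RV Len fX) (RV Len fY))))) leaf_prog
         (IF (RL (RV Len fX) (RV Len fY)) swap_prog split_prog)))"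

section \<open>Trees in memory\<close>

text \<open>The leaf of vertex \<open>i\<close> has number \<open>2 * i\<close>, the node that joins \<open>i - 1\<close> to \<open>i\<close> has number \<open>2 * i - 1\<close>.\<close>

fun idn :: "itree \<Rightarrow> nat" where
  "idn (Lf i) = 2 * i"
| "idn (Nd a b) = 2 * lo b - 1"

text \<open>Numbers depend on vertex indices only, so nothing has to be allocated and trees over
  disjoint ranges never share a cell.\<close>

definition ids :: "itree \<Rightarrow> nat set" where
  "ids T = {2 * lo T..2 * hi T}"

lemma idn_ids [simp]: "wf_tree T \<Longrightarrow> idn T \<in> ids T"
  using lo_le_hi[of T] by (cases T) (auto simp: ids_def dest: lo_le_hi)

lemma ids_Nd:
  assumes "wf_tree (Nd a b)"
  shows "ids a \<subseteq> ids (Nd a b)" "ids b \<subseteq> ids (Nd a b)" "idn (Nd a b) \<notin> ids a" "idn (Nd a b) \<notin> ids b"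
    "ids a \<inter> ids b = {}"
  using assms lo_le_hi[of a] lo_le_hi[of b] by (auto simp: ids_def)

lemma ids_disjoint:
  assumes "wf_tree X" "wf_tree Y" "rng X \<inter> rng Y = {}"
  shows "ids X \<inter> ids Y = {}"
proof -
  have "lo X \<le> hi X" "lo Y \<le> hi Y" using assms lo_le_hi by auto
  then have "hi X < lo Y \<or> hi Y < lo X" using assms(3) by (auto simp: rng_def)
  then show ?thesis by (auto simp: ids_def)
qed

fun stk :: "(nat \<Rightarrow> nat) \<Rightarrow> itree list \<Rightarrow> bool" where
  "stk S [] \<longleftrightarrow> True"
| "stk S (x # ts) \<longleftrightarrow> S (length ts) = idn x \<and> stk S ts"

lemma stk_cong: "stk S ts \<Longrightarrow> (\<And>j. j < length ts \<Longrightarrow> S' j = S j) \<Longrightarrow> stk S' ts"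
  by (induction ts) auto

section \<open>Trees in arrays and the effect of the program pieces\<close>

context two_curves
begin

fun tr :: "arrays \<Rightarrow> itree \<Rightarrow> bool" where
  "tr s (Lf i) \<longleftrightarrow> fst s Fs (2 * i) = i \<and> snd s Len (2 * i) = 0"
| "tr s (Nd a b) \<longleftrightarrow> fst s Fs (idn (Nd a b)) = lo a \<and> snd s Len (idn (Nd a b)) = len (Nd a b) \<and>
     fst s Lc (idn (Nd a b)) = idn a \<and> fst s Rc (idn (Nd a b)) = idn b \<and> tr s a \<and> tr s b"

lemma tr_root: "tr s T \<Longrightarrow> fst s Fs (idn T) = lo T \<and> snd s Len (idn T) = len T"
  by (cases T) (auto simp: len.simps)

lemma tr_cong:
  assumes "wf_tree T" "tr s T"
    and "\<And>i. i \<in> ids T \<Longrightarrow> fst s' Fs i = fst s Fs i \<and> fst s' Lc i = fst s Lc i \<and> fst s' Rc i = fst s Rc i \<and>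
      snd s' Len i = snd s Len i"
  shows "tr s' T"
  using assms
proof (induction T)
  case (Nd a b)
  have "idn (Nd a b) \<in> ids (Nd a b)" using Nd.prems(1) by (rule idn_ids)
  moreover have "tr s' a"
    by (rule Nd.IH(1)) (use Nd.prems ids_Nd(1)[OF Nd.prems(1)] in auto)
  moreover have "tr s' b"
    by (rule Nd.IH(2)) (use Nd.prems ids_Nd(2)[OF Nd.prems(1)] in auto)
  ultimately show ?case using Nd.prems(2,3) by (simp del: idn.simps)
qed (simp add: ids_def)

lemma weak_chain:
  assumes "weak_stack ts" "\<forall>T\<in>set ts. wf_tree T"
  shows "(\<forall>T\<in>set ts. lo (last ts) \<le> lo T) \<and> (\<forall>T\<in>set (tl ts). hi T < lo (hd ts))"
  using assms
proof (induction ts)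
  case (Cons x r)
  show ?case
  proof (cases r)
    case Nil
    then show ?thesis by simp
  next
    case r: (Cons y r')
    have weak: "weak_stack r" and x: "lo x = Suc (hi y)" using Cons.prems(1) r by (auto simp: strict_imp_weak)
    have IH: "(\<forall>T\<in>set r. lo (last r) \<le> lo T) \<and> (\<forall>T\<in>set r'. hi T < lo y)"
      using Cons.IH[OF weak] Cons.prems(2) r by simp
    have "lo y \<le> hi y" using Cons.prems(2) r lo_le_hi by simp
    then show ?thesis using IH r x by fastforce
  qed
qed simp

lemma ceval_merge:
  assumes "N Sp 0 = Suc (Suc n)" "N Stk (Suc n) = ix" "N Stk n = iy" "z = 2 * N Fs ix - 1"
  shows "ceval merge_prog (N, R) =
    (N(Tmp := (N Tmp)(0 := z), Lc := (N Lc)(z := iy), Rc := (N Rc)(z := ix), Fs := (N Fs)(z := N Fs iy),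
       Stk := (N Stk)(n := z), Sp := (N Sp)(0 := Suc n)),
     R(Len := (R Len)(z := R Wt iy + R Len ix), Wt := (R Wt)(z := R Wt iy + R Wt ix)))"
  using assms by (auto simp: merge_prog_def fun_eq_iff mult_2)

lemma ceval_push:
  assumes "N Sp 0 = n" "N Mv 0 = m" "N Ev 0 = e" "e \<le> k + l"
  shows "ceval push_prog (N, R) =
    (N(Tmp := (N Tmp)(0 := 2 * m), Fs := (N Fs)(2 * m := m), Stk := (N Stk)(n := 2 * m), Sp := (N Sp)(0 := Suc n),
       Mv := (N Mv)(0 := Suc m)),
     R(Len := (R Len)(2 * m := 0), Wt := (R Wt)(2 * m := if Suc m < e then dist (pt m) (pt (Suc m)) else 0)))"
  using assms by (auto simp: push_prog_def fun_eq_iff mult_2)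

lemma ceval_pull:
  assumes "N Sp 0 = Suc t" "N FK t = 1" "N FX t = ix" "N Lc ix = a" "N Rc ix = b" "ix \<noteq> a" "ix \<noteq> b"
  shows "ceval dp_body (N, R) =
    (N(Lz := (N Lz)(ix := 0), Sp := (N Sp)(0 := t)),
     R(Mn := (R Mn)(ix := min (R Mn a) (R Mn b)), Ls := (R Ls)(ix := R Ls b)))"
  using assms by (auto simp: dp_body_def pull_prog_def fun_eq_iff min_def)

lemma ceval_min:
  "ceval (IF (RL u (RV Mn e)) (SR Mn e u) SK) s =
    (fst s, (snd s)(Mn := (snd s Mn)(neval e s := min (snd s Mn (neval e s)) (reval u s))))"
  by (cases s) (auto simp: min_def)

lemma ceval_max:
  "ceval (IF (RL (RV Mn e) u) (SR Mn e u) SK) s =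
    (fst s, (snd s)(Mn := (snd s Mn)(neval e s := max (snd s Mn (neval e s)) (reval u s))))"
  by (cases s) (auto simp: max_def)

lemma ceval_leaf:
  assumes "N Sp 0 = Suc t" "N FK t = 0" "N FX t = ix" "N FY t = iy" "ix \<noteq> iy"
    and "N Fs ix < k + l" "N Fs iy < k + l" "w = dist (pt (N Fs ix)) (pt (N Fs iy))"
    and "4 * (R Len ix + R Len iy) \<le> eps * w"
    and f: "f = max (min (min (R Mn ix) (R Mn iy)) (R FC t)) w"
  shows "ceval dp_body (N, R) =
    (N(Lz := (N Lz)(ix := 1, iy := 1), Sp := (N Sp)(0 := t)),
     R(Dw := (R Dw)(0 := w), Mn := (R Mn)(ix := f, iy := f), Ls := (R Ls)(ix := f, iy := f)))"
proof -
  have "ceval dp_body (N, R) = ceval leaf_prog (N, R(Dw := (R Dw)(0 := w)))"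
    using assms(1-9) by (simp add: dp_body_def)
  also have "\<dots> = (N(Lz := (N Lz)(ix := 1, iy := 1), Sp := (N Sp)(0 := t)),
     R(Dw := (R Dw)(0 := w), Mn := (R Mn)(ix := f, iy := f), Ls := (R Ls)(ix := f, iy := f)))"
    unfolding leaf_prog_def ceval.simps(5) ceval_min ceval_max
    using assms(1-5) by (simp add: f[symmetric] fun_eq_iff)
  finally show ?thesis .
qed

lemma ceval_swap:
  assumes "N Sp 0 = Suc t" "N FK t = 0" "N FX t = ix" "N FY t = iy"
    and "N Fs ix < k + l" "N Fs iy < k + l" "w = dist (pt (N Fs ix)) (pt (N Fs iy))"
    and "\<not> 4 * (R Len ix + R Len iy) \<le> eps * w" "R Len ix < R Len iy"
  shows "ceval dp_body (N, R) =
    (N(Tmp := (N Tmp)(0 := ix), FX := (N FX)(t := iy), FY := (N FY)(t := ix)), R(Dw := (R Dw)(0 := w)))"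
  using assms by (auto simp: dp_body_def swap_prog_def fun_eq_iff)

lemma ceval_push_down:
  assumes "N Sp 0 = Suc t" "N FX t = ix" "N Lc ix = a" "N Rc ix = b" "ix \<noteq> a" "ix \<noteq> b" "a \<noteq> b"
  shows "ceval push_down (N, R) = (if N Lz ix \<noteq> 0
    then (N(Lz := (N Lz)(a := 1, b := 1)),
      R(Mn := (R Mn)(a := R Mn ix, b := R Mn ix), Ls := (R Ls)(a := R Mn ix, b := R Mn ix)))
    else (N, R))"
  using assms by (auto simp: push_down_def fun_eq_iff)

lemma ceval_split:
  assumes "N Sp 0 = Suc t" "N FK t = 0" "N FX t = ix" "N FY t = iy"
    and "N Fs ix < k + l" "N Fs iy < k + l" "w = dist (pt (N Fs ix)) (pt (N Fs iy))"
    and "\<not> 4 * (R Len ix + R Len iy) \<le> eps * w" "\<not> R Len ix < R Len iy"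
    and pd: "ceval push_down (N, R(Dw := (R Dw)(0 := w))) = (N', R')"
    and same: "N' Sp = N Sp" "N' FX = N FX" "N' FY = N FY" "N' FK = N FK" "N' Lc = N Lc" "N' Rc = N Rc"
      "R' FC = R FC"
    and ab: "N Lc ix = a" "N Rc ix = b"
  shows "ceval dp_body (N, R) =
    (N'(FX := (N FX)(Suc t := b, Suc (Suc t) := a), FY := (N FY)(Suc t := iy, Suc (Suc t) := iy),
        FK := (N FK)(Suc t := 0, Suc (Suc t) := 0, t := 1), Sp := (N Sp)(0 := Suc (Suc (Suc t)))),
     R'(FC := (R FC)(Suc t := R' Ls a, Suc (Suc t) := R FC t)))"
proof -
  have "ceval dp_body (N, R) = ceval split_prog (N, R(Dw := (R Dw)(0 := w)))"
    using assms(1-9) by (simp add: dp_body_def)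
  also have "\<dots> = (N'(FX := (N FX)(Suc t := b, Suc (Suc t) := a), FY := (N FY)(Suc t := iy, Suc (Suc t) := iy),
        FK := (N FK)(Suc t := 0, Suc (Suc t) := 0, t := 1), Sp := (N Sp)(0 := Suc (Suc (Suc t)))),
     R'(FC := (R FC)(Suc t := R' Ls a, Suc (Suc t) := R FC t)))"
    unfolding split_prog_def ceval.simps(5)[of push_down] pd
    using assms(1-4) same ab by (simp add: fun_eq_iff)
  finally show ?thesis .
qed

section \<open>Correctness of the tree construction\<close>

definition segment :: "nat \<Rightarrow> nat \<Rightarrow> bool" where
  "segment b e \<longleftrightarrow> b < e \<and> e \<le> k + l \<and> (\<forall>m. b \<le> m \<longrightarrow> m < e \<longrightarrow> (lst m \<longleftrightarrow> Suc m = e))"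

text \<open>\<open>Old\<close> collects trees built earlier over smaller indices, so that the second
  construction is known to spare the first tree.\<close>

definition build_inv :: "itree set \<Rightarrow> nat \<Rightarrow> nat \<Rightarrow> nat \<Rightarrow> itree list \<Rightarrow> arrays \<Rightarrow> bool" where
  "build_inv Old b e m ts s \<longleftrightarrow> fst s Mv 0 = m \<and> fst s Ev 0 = e \<and> fst s Sp 0 = length ts \<and> stk (fst s Stk) ts \<and>
     (\<forall>T\<in>set ts. tr s T \<and> snd s Wt (idn T) = wt T) \<and> good_trees b m ts \<and> b \<le> m \<and> m \<le> e \<and>
     (\<forall>T\<in>Old. wf_tree T \<and> hi T < b \<and> tr s T)"

lemma good_trees_wf: "good_trees b m ts \<Longrightarrow> T \<in> set ts \<Longrightarrow> wf_tree T"
  by (simp add: good_trees_def)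

lemma good_trees_lo:
  assumes "good_trees b m ts" "T \<in> set ts"
  shows "b \<le> lo T"
  using assms weak_chain[of ts] by (auto simp: good_trees_def split: if_splits)

lemma good_trees_tl:
  assumes "good_trees b m (x # ts)" "T \<in> set ts"
  shows "hi T < lo x"
  using assms weak_chain[of "x # ts"] by (auto simp: good_trees_def)

lemma good_trees_hi:
  assumes "good_trees b m ts" "T \<in> set ts"
  shows "hi T < m"
proof (cases ts)
  case (Cons x r)
  then have "m = Suc (hi x)" "lo x \<le> hi x" using assms(1) lo_le_hi by (auto simp: good_trees_def)
  then show ?thesis using assms good_trees_tl[of b m x r T] Cons by auto
qed (use assms in simp)

lemma build_merge:
  assumes inv: "build_inv Old b e m (x # y # ts) s" and seg: "segment b e" and cond: "beval merge_cond s"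
  shows "build_inv Old b e m (Nd y x # ts) (ceval merge_prog s)"
proof -
  define N R where "N = fst s" and "R = snd s"
  have s: "s = (N, R)" by (simp add: N_def R_def)
  define s' where "s' = ceval merge_prog s"
  have good: "good_trees b m (x # y # ts)" and bm: "b \<le> m" "m \<le> e"
    and sp: "N Sp 0 = Suc (Suc (length ts))" "N Mv 0 = m" "N Ev 0 = e"
    and st: "N Stk (Suc (length ts)) = idn x" "N Stk (length ts) = idn y" "stk (N Stk) ts"
    and T: "\<And>T. T \<in> set (x # y # ts) \<Longrightarrow> tr s T \<and> R Wt (idn T) = wt T"
    and Old: "\<And>T. T \<in> Old \<Longrightarrow> wf_tree T \<and> hi T < b \<and> tr s T"
    using inv by (auto simp: build_inv_def N_def R_def)
  have lo_x: "lo x = Suc (hi y)" using good by (simp add: good_trees_def)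
  have wf: "wf_tree x" "wf_tree y" using good by (auto simp: good_trees_def)
  have tx: "tr s x" "R Wt (idn x) = wt x" and ty: "tr s y" "R Wt (idn y) = wt y" using T by auto
  have m: "m = Suc (hi x)" using good by (simp add: good_trees_def)
  have "lst (hi x) \<or> wt y \<le> 2 * wt x"
  proof (cases "m = e")
    case True
    have "b \<le> hi x" using good_trees_lo[OF good, of x] lo_le_hi[OF wf(1)] by simp
    then show ?thesis using seg m True by (simp add: segment_def)
  next
    case False
    then show ?thesis using cond bm sp st tx ty by (simp add: merge_cond_def s)
  qed
  then have good': "good_trees b m (Nd y x # ts)" by (rule good_merge[OF good])
  define z where "z = idn (Nd y x)"
  \<comment> \<open>This number falls into the gap between the numbers of \<open>y\<close> and those
    of \<open>x\<close>, so the new node overwrites nothing.\<close>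
  have z: "z = 2 * N Fs (idn x) - 1" "z = Suc (2 * hi y)"
    using tr_root[OF tx(1)] lo_x by (auto simp: z_def N_def)
  have eq: "s' = (N(Tmp := (N Tmp)(0 := z), Lc := (N Lc)(z := idn y), Rc := (N Rc)(z := idn x),
       Fs := (N Fs)(z := N Fs (idn y)), Stk := (N Stk)(length ts := z), Sp := (N Sp)(0 := Suc (length ts))),
     R(Len := (R Len)(z := R Wt (idn y) + R Len (idn x)), Wt := (R Wt)(z := R Wt (idn y) + R Wt (idn x))))"
    unfolding s'_def s by (rule ceval_merge[OF sp(1) st(1,2) z(1)])
  have keep: "tr s' T'" "idn T' \<noteq> z" if "wf_tree T'" "z \<notin> ids T'" "tr s T'" for T'
  proof -
    show "tr s' T'" by (rule tr_cong[OF that(1,3)]) (use that(2) in \<open>auto simp: eq N_def R_def\<close>)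
    show "idn T' \<noteq> z" using idn_ids[OF that(1)] that(2) by auto
  qed
  have zx: "z \<notin> ids x" "z \<notin> ids y" using z lo_x by (auto simp: ids_def)
  have y_hi: "lo y \<le> hi y" using lo_le_hi[OF wf(2)] .
  have zt: "z \<notin> ids T'" "wf_tree T'" if "T' \<in> set ts" for T'
  proof -
    have "good_trees b (Suc (hi y)) (y # ts)"
      using good by (auto simp: good_trees_def strict_imp_weak)
    then show "z \<notin> ids T'" using good_trees_tl[of b _ y ts T'] that z y_hi by (auto simp: ids_def)
    show "wf_tree T'" using good_trees_wf[OF good] that by simp
  qed
  have zo: "z \<notin> ids T'" if "T' \<in> Old" for T'
    using Old[OF that] good_trees_lo[OF good, of y] y_hi z by (auto simp: ids_def)
  have "tr s' (Nd y x)"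
    using keep[OF wf(1) zx(1) tx(1)] keep[OF wf(2) zx(2) ty(1)] tr_root[OF ty(1)] tr_root[OF tx(1)] ty(2)
    by (auto simp: eq z_def[symmetric] N_def R_def len.simps wt_def simp del: idn.simps)
  moreover have "snd s' Wt z = wt (Nd y x)"
    using tx(2) ty(2) by (simp add: eq wt_def len.simps)
  moreover have "tr s' T' \<and> snd s' Wt (idn T') = wt T'" if "T' \<in> set ts" for T'
    using keep[OF zt(2,1)[OF that]] T[of T'] that by (simp add: eq)
  moreover have "wf_tree T' \<and> hi T' < b \<and> tr s' T'" if "T' \<in> Old" for T'
    using keep[OF _ zo[OF that]] Old[OF that] by simp
  moreover have "fst s' Stk (length ts) = z" by (simp add: eq)
  moreover have "stk (fst s' Stk) ts" by (rule stk_cong[OF st(3)]) (simp add: eq)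
  moreover have "fst s' Mv 0 = m" "fst s' Ev 0 = e" "fst s' Sp 0 = Suc (length ts)" using sp by (simp_all add: eq)
  ultimately show ?thesis
    unfolding build_inv_def s'_def[symmetric] using good' bm
    by (simp add: z_def[symmetric] del: idn.simps)
qed

lemma build_push:
  assumes inv: "build_inv Old b e m ts s" and seg: "segment b e" and cond: "\<not> beval merge_cond s" "m < e"
  shows "build_inv Old b e (Suc m) (Lf m # ts) (ceval push_prog s)"
proof -
  define N R where "N = fst s" and "R = snd s"
  have s: "s = (N, R)" by (simp add: N_def R_def)
  define s' where "s' = ceval push_prog s"
  have good: "good_trees b m ts" and bm: "b \<le> m" "m \<le> e"
    and sp: "N Sp 0 = length ts" "N Mv 0 = m" "N Ev 0 = e"
    and st: "stk (N Stk) ts"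
    and T: "\<And>T. T \<in> set ts \<Longrightarrow> tr s T \<and> R Wt (idn T) = wt T"
    and Old: "\<And>T. T \<in> Old \<Longrightarrow> wf_tree T \<and> hi T < b \<and> tr s T"
    using inv by (auto simp: build_inv_def N_def R_def)
  have "2 * wt x < wt y" if "ts = x # y # r" for x y r
    using cond sp st T that by (auto simp: merge_cond_def s)
  then have good': "good_trees b (Suc m) (Lf m # ts)" by (rule good_push[OF good])
  have "e \<le> k + l" using seg by (simp add: segment_def)
  note eq = ceval_push[of N "length ts" m e R, OF sp this, folded s, folded s'_def]
  have keep: "tr s' T'" "idn T' \<noteq> 2 * m" if "wf_tree T'" "hi T' < m" "tr s T'" for T'
  proof -
    have "2 * m \<notin> ids T'" using that(2) by (auto simp: ids_def)
    then show "tr s' T'" "idn T' \<noteq> 2 * m"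
      using idn_ids[OF that(1)] by (auto intro!: tr_cong[OF that(1,3)] simp: eq N_def R_def)
  qed
  have "Suc m < e \<longleftrightarrow> \<not> lst m" using seg bm cond(2) by (auto simp: segment_def)
  then have "snd s' Wt (2 * m) = wt (Lf m)" by (simp add: eq wt_def len.simps el_def)
  moreover have "tr s' (Lf m)" by (simp add: eq)
  moreover have "tr s' T' \<and> snd s' Wt (idn T') = wt T'" if "T' \<in> set ts" for T'
    using keep[OF good_trees_wf[OF good that] good_trees_hi[OF good that]] T[OF that] by (simp add: eq)
  moreover have "wf_tree T' \<and> hi T' < b \<and> tr s' T'" if "T' \<in> Old" for T'
    using keep[of T'] Old[OF that] bm by simp
  moreover have "stk (fst s' Stk) ts" by (rule stk_cong[OF st]) (simp add: eq)
  moreover have "fst s' Stk (length ts) = 2 * m" "fst s' Mv 0 = Suc m" "fst s' Ev 0 = e" "fst s' Sp 0 = Suc (length ts)"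
    using sp by (simp_all add: eq)
  ultimately show ?thesis
    unfolding build_inv_def s'_def[symmetric] using good' bm cond(2) by simp
qed

text \<open>A push trades two units of \<open>2 * (e - m)\<close> for one stack entry and a merge
  removes an entry, so the sum drops in every iteration.\<close>

lemma iter_build:
  assumes "build_inv Old b e m ts s" "segment b e"
  shows "\<exists>n s' ts'. n \<le> 2 * (e - m) + length ts \<and> iter build_cond build_body n s s' \<and>
    \<not> beval build_cond s' \<and> (\<exists>m'. build_inv Old b e m' ts' s')"
  using assms(1)
proof (induction "2 * (e - m) + length ts" arbitrary: m ts s rule: less_induct)
  case less
  show ?case
  proof (cases "beval build_cond s")
    case False
    then show ?thesis using less.prems by (intro exI[of _ 0] exI[of _ s] exI[of _ ts] conjI exI[of _ m]) auto
  next
    case True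
    have sp: "fst s Mv 0 = m" "fst s Ev 0 = e" "fst s Sp 0 = length ts" "m \<le> e"
      using less.prems by (auto simp: build_inv_def)
    have "\<exists>m' ts'. build_inv Old b e m' ts' (ceval build_body s) \<and>
        2 * (e - m') + length ts' < 2 * (e - m) + length ts"
    proof (cases "beval merge_cond s")
      case m: True
      then have "1 < length ts" using sp by (simp add: merge_cond_def)
      then obtain x y r where ts: "ts = x # y # r" by (cases ts rule: strict_stack.cases) auto
      have "build_inv Old b e m (Nd y x # r) (ceval build_body s)"
        using build_merge[OF less.prems[unfolded ts] assms(2) m] m by (simp add: build_body_def)
      then show ?thesis using ts by (intro exI[of _ m] exI[of _ "Nd y x # r"]) simp
    next
      case m: False
      then have me: "m < e" using True sp by (auto simp: merge_cond_def build_cond_def)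
      have "build_inv Old b e (Suc m) (Lf m # ts) (ceval build_body s)"
        using build_push[OF less.prems assms(2) m me] m by (simp add: build_body_def)
      then show ?thesis using me by (intro exI[of _ "Suc m"] exI[of _ "Lf m # ts"]) simp
    qed
    then obtain m' ts' where 1: "build_inv Old b e m' ts' (ceval build_body s)"
      and lt: "2 * (e - m') + length ts' < 2 * (e - m) + length ts" by blast
    from less.hyps[OF lt 1] obtain n s' ts'' m'' where "n \<le> 2 * (e - m') + length ts'"
      "iter build_cond build_body n (ceval build_body s) s'" "\<not> beval build_cond s'" "build_inv Old b e m'' ts'' s'"
      by blast
    then show ?thesis using True lt by (intro exI[of _ "Suc n"] exI[of _ s'] exI[of _ ts''] conjI exI[of _ m'']) auto
  qed
qed

lemma build_done:
  assumes inv: "build_inv Old b e m ts s" and seg: "segment b e" and fin: "\<not> beval build_cond s"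
  shows "\<exists>T. wf_tree T \<and> balanced T \<and> lo T = b \<and> Suc (hi T) = e \<and> tr s T \<and> fst s Stk 0 = idn T \<and>
    fst s Mv 0 = e \<and> (\<forall>T\<in>Old. tr s T)"
proof -
  have m: "m = e" "length ts \<le> 1" "fst s Mv 0 = m" using inv fin by (auto simp: build_inv_def build_cond_def)
  have good: "good_trees b m ts" using inv by (simp add: build_inv_def)
  have "ts \<noteq> []" using good m(1) seg by (auto simp: good_trees_def segment_def)
  then obtain T where T: "ts = [T]" using m(2) by (cases ts) auto
  have "lo T = b" "Suc (hi T) = e" "wf_tree T" "balanced T" using good T m(1) by (auto simp: good_trees_def)
  moreover have "tr s T" "fst s Stk 0 = idn T" "\<forall>T\<in>Old. tr s T" using inv T by (auto simp: build_inv_def)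
  ultimately show ?thesis using m by blast
qed

lemma build_correct:
  assumes seg: "segment b e" and init: "fst s Mv 0 = b" "fst s Ev 0 = e" "fst s Sp 0 = 0"
    and Old: "\<forall>T\<in>Old. wf_tree T \<and> hi T < b \<and> tr s T"
  shows "\<exists>n s' T. n \<le> 2 * (e - b) \<and> iter build_cond build_body n s s' \<and> \<not> beval build_cond s' \<and>
    wf_tree T \<and> balanced T \<and> lo T = b \<and> Suc (hi T) = e \<and> tr s' T \<and> fst s' Stk 0 = idn T \<and>
    fst s' Mv 0 = e \<and> (\<forall>T\<in>Old. tr s' T)"
proof -
  have "build_inv Old b e b [] s"
    using assms by (auto simp: build_inv_def good_trees_def segment_def)
  from iter_build[OF this seg] obtain n s' ts' m' where n: "n \<le> 2 * (e - b)" "iter build_cond build_body n s s'"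
    "\<not> beval build_cond s'" "build_inv Old b e m' ts' s'"
    by auto
  from build_done[OF n(4) seg n(3)] show ?thesis using n(1-3) by blast
qed

section \<open>Correctness of the dynamic program\<close>

text \<open>The frontier \<open>F\<close> is stored in the trees: a node has the minimum and the last value of \<open>F\<close> on its
  range.  If the flag of a node is set then \<open>F\<close> is constant on its range and the entries of its
  descendants are meaningless.\<close>

fun repr :: "arrays \<Rightarrow> (nat \<Rightarrow> real) \<Rightarrow> itree \<Rightarrow> bool" where
  "repr s F (Lf i) \<longleftrightarrow> fst s Lz (2 * i) \<noteq> 0 \<and> snd s Mn (2 * i) = F i \<and> snd s Ls (2 * i) = F i"
| "repr s F (Nd a b) \<longleftrightarrow>
     (if fst s Lz (idn (Nd a b)) \<noteq> 0
      then (\<forall>m\<in>rng (Nd a b). F m = snd s Mn (idn (Nd a b))) \<and> snd s Ls (idn (Nd a b)) = snd s Mn (idn (Nd a b))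
      else repr s F a \<and> repr s F b \<and> snd s Mn (idn (Nd a b)) = min (snd s Mn (idn a)) (snd s Mn (idn b)) \<and>
        snd s Ls (idn (Nd a b)) = snd s Ls (idn b))"

lemma repr_const:
  "wf_tree T \<Longrightarrow> fst s Lz (idn T) \<noteq> 0 \<Longrightarrow> snd s Mn (idn T) = v \<Longrightarrow> snd s Ls (idn T) = v \<Longrightarrow>
    (\<And>m. m \<in> rng T \<Longrightarrow> F m = v) \<Longrightarrow> repr s F T"
  by (cases T) auto

lemma repr_root:
  assumes "wf_tree T" "repr s F T"
  shows "snd s Mn (idn T) = Min (F ` rng T) \<and> snd s Ls (idn T) = F (hi T)"
  using assms
proof (induction T)
  case (Nd a b)
  have hi: "hi (Nd a b) \<in> rng (Nd a b)" by (rule lo_hi_rng(2)[OF Nd.prems(1)])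
  show ?case
  proof (cases "fst s Lz (idn (Nd a b)) = 0")
    case False
    then have *: "\<forall>m\<in>rng (Nd a b). F m = snd s Mn (idn (Nd a b))" "snd s Ls (idn (Nd a b)) = snd s Mn (idn (Nd a b))"
      using Nd.prems(2) by (simp_all del: idn.simps)
    have "F ` rng (Nd a b) = {snd s Mn (idn (Nd a b))}" using *(1) hi by (auto simp del: idn.simps)
    then show ?thesis using * hi by (simp del: idn.simps hi.simps)
  next
    case True
    then have *: "repr s F a" "repr s F b" "snd s Mn (idn (Nd a b)) = min (snd s Mn (idn a)) (snd s Mn (idn b))"
        "snd s Ls (idn (Nd a b)) = snd s Ls (idn b)"
      using Nd.prems(2) by (simp_all del: idn.simps)
    have wf: "wf_tree a" "wf_tree b" using Nd.prems(1) by auto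
    have "Min (F ` rng (Nd a b)) = min (Min (F ` rng a)) (Min (F ` rng b))"
      unfolding rng_Nd[OF Nd.prems(1)] image_Un using wf by (intro Min_Un) auto
    then show ?thesis using * Nd.IH(1)[OF wf(1)] Nd.IH(2)[OF wf(2)] by (simp del: idn.simps)
  qed
qed simp

lemma repr_cong:
  assumes "wf_tree T" "repr s F T" "\<And>m. m \<in> rng T \<Longrightarrow> F' m = F m"
    and "\<And>i. i \<in> ids T \<Longrightarrow> fst s' Lz i = fst s Lz i \<and> snd s' Mn i = snd s Mn i \<and> snd s' Ls i = snd s Ls i"
  shows "repr s' F' T"
  using assms
proof (induction T)
  case (Nd a b)
  have wf: "wf_tree a" "wf_tree b" using Nd.prems(1) by auto
  have id: "idn (Nd a b) \<in> ids (Nd a b)" "idn a \<in> ids (Nd a b)" "idn b \<in> ids (Nd a b)"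
    using idn_ids[OF Nd.prems(1)] ids_Nd[OF Nd.prems(1)] idn_ids[OF wf(1)] idn_ids[OF wf(2)] by auto
  show ?case
  proof (cases "fst s Lz (idn (Nd a b)) = 0")
    case False
    then show ?thesis using Nd.prems(2,3) Nd.prems(4)[OF id(1)] by (simp del: idn.simps)
  next
    case True
    then have *: "repr s F a" "repr s F b" using Nd.prems(2) by (simp_all del: idn.simps)
    have "repr s' F' a"
      by (rule Nd.IH(1)[OF wf(1) *(1)]) (use Nd.prems ids_Nd[OF Nd.prems(1)] rng_Nd[OF Nd.prems(1)] in auto)
    moreover have "repr s' F' b"
      by (rule Nd.IH(2)[OF wf(2) *(2)]) (use Nd.prems ids_Nd[OF Nd.prems(1)] rng_Nd[OF Nd.prems(1)] in auto)
    ultimately show ?thesis using True Nd.prems(2) Nd.prems(4)[OF id(1)] Nd.prems(4)[OF id(2)] Nd.prems(4)[OF id(3)]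
      by (simp del: idn.simps)
  qed
qed (simp add: ids_def)

text \<open>Frame condition of a call: the shape of the trees is fixed, frontier entries change only
  inside \<open>I\<close>, and recursion frames only from \<open>t\<close> upwards.\<close>

definition keeps :: "nat set \<Rightarrow> nat \<Rightarrow> arrays \<Rightarrow> arrays \<Rightarrow> bool" where
  "keeps I t s s' \<longleftrightarrow> (\<forall>f\<in>{Lc, Rc, Fs, Stk}. fst s' f = fst s f) \<and> snd s' Len = snd s Len \<and>
     (\<forall>i. i \<notin> I \<longrightarrow> fst s' Lz i = fst s Lz i \<and> snd s' Mn i = snd s Mn i \<and> snd s' Ls i = snd s Ls i) \<and>
     (\<forall>j<t. fst s' FX j = fst s FX j \<and> fst s' FY j = fst s FY j \<and> fst s' FK j = fst s FK j \<and> snd s' FC j = snd s FC j)"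

lemma keeps_trans:
  assumes "keeps I t s s'" "keeps I' t' s' s''" "I \<subseteq> J" "I' \<subseteq> J" "u \<le> t" "u \<le> t'"
  shows "keeps J u s s''"
proof -
  have "i \<notin> I \<and> i \<notin> I'" if "i \<notin> J" for i using that assms(3,4) by blast
  moreover have "j < t \<and> j < t'" if "j < u" for j using that assms(5,6) by simp
  ultimately show ?thesis using assms(1,2) unfolding keeps_def by simp
qed

lemma keeps_tr: "keeps I t s s' \<Longrightarrow> wf_tree T \<Longrightarrow> tr s T \<Longrightarrow> tr s' T"
  by (erule tr_cong) (auto simp: keeps_def)

lemma keeps_repr:
  assumes "keeps I t s s'" "wf_tree T" "repr s F T" "ids T \<inter> I = {}" "\<And>m. m \<in> rng T \<Longrightarrow> F' m = F m"
  shows "repr s' F' T"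
  by (rule repr_cong[OF assms(2,3)]) (use assms in \<open>auto simp: keeps_def\<close>)

definition frame :: "arrays \<Rightarrow> nat \<Rightarrow> itree \<Rightarrow> itree \<Rightarrow> real \<Rightarrow> bool" where
  "frame s t X Y c \<longleftrightarrow> fst s FX t = idn X \<and> fst s FY t = idn Y \<and> fst s FK t = 0 \<and> snd s FC t = c"

lemma keeps_frame: "keeps I t s s' \<Longrightarrow> j < t \<Longrightarrow> frame s j X Y c \<Longrightarrow> frame s' j X Y c"
  by (simp add: keeps_def frame_def)

text \<open>The trivial relation reduces \<open>dp_invariant\<close> to its locality part.\<close>

lemma dp_outside:
  assumes "wf_tree X" "wf_tree Y" "rng X \<inter> rng Y = {}" "m \<notin> rng X" "m \<notin> rng Y"
  shows "dp X Y c F m = F m"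
  using dp_invariant[OF assms(1-3), of "\<lambda>_ _ _. True" c F] assms(4,5) by (auto simp: pre_def leaf_ok_def)

lemma dp_nonneg:
  assumes "wf_tree X" "wf_tree Y" "rng X \<inter> rng Y = {}" "0 \<le> c" "\<And>m. 0 \<le> F m"
  shows "0 \<le> dp X Y c F (hi Y)"
proof -
  have "leaf_ok (\<lambda>x _ _. 0 \<le> x) X Y" by (auto simp: leaf_ok_def leafval_def le_max_iff_disj)
  then have "post (\<lambda>x _ _. 0 \<le> x) X Y (dp X Y c F)"
    using dp_invariant[OF assms(1-3), of "\<lambda>x _ _. 0 \<le> x" c F] assms(4,5) by (auto simp: pre_def)
  then show ?thesis using assms(2) by (simp add: post_def)
qed

text \<open>Calls compose because of \<open>keeps\<close>: while the left child runs, the entries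
  and the frame of the right child and the frame of the parent survive, so the next iteration finds
  what it expects.\<close>

lemma iter_dp:
  assumes "inseq X" "inseq Y" "rng X \<inter> rng Y = {}" "tr s X" "tr s Y" "repr s F X" "repr s F Y"
    and "fst s Sp 0 = Suc t" "frame s t X Y c"
  shows "\<exists>s'. iter dp_cond dp_body (cnt X Y) s s' \<and> fst s' Sp 0 = t \<and> repr s' (dp X Y c F) X \<and>
    repr s' (dp X Y c F) Y \<and> keeps (ids X \<union> ids Y) t s s'"
  using assms
proof (induction X Y arbitrary: s t c F rule: pair_induct)
  case (sep X Y)
  define N R where "N = fst s" and "R = snd s"
  have s: "s = (N, R)" by (simp add: N_def R_def)
  have wf: "wf_tree X" "wf_tree Y" and lt: "lo X < k + l" "lo Y < k + l"
    using sep.prems(1,2) lo_le_hi[of X] lo_le_hi[of Y] by (auto simp: inseq_def)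
  have root: "N Fs (idn X) = lo X" "R Len (idn X) = len X" "N Fs (idn Y) = lo Y" "R Len (idn Y) = len Y"
    using tr_root[OF sep.prems(4)] tr_root[OF sep.prems(5)] by (auto simp: N_def R_def)
  have disj: "ids X \<inter> ids Y = {}" by (rule ids_disjoint[OF wf sep.prems(3)])
  then have ne: "idn X \<noteq> idn Y" using idn_ids[OF wf(1)] idn_ids[OF wf(2)] by auto
  have fr: "N FX t = idn X" "N FY t = idn Y" "N FK t = 0" "R FC t = c" and sp: "N Sp 0 = Suc t"
    using sep.prems(8,9) by (auto simp: frame_def N_def R_def)
  let ?w = "dist (pt (lo X)) (pt (lo Y))"
  have "leafval X Y c F = max (min (min (R Mn (idn X)) (R Mn (idn Y))) (R FC t)) ?w"
    using repr_root[OF wf(1) sep.prems(6)] repr_root[OF wf(2) sep.prems(7)] fr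
    by (simp add: leafval_def R_def min.commute max.commute)
  note eq = ceval_leaf[where R = R, OF sp fr(3,1,2) ne, unfolded root, OF lt refl sep.hyps[unfolded sep_def] this, folded s]
  define s' where "s' = ceval dp_body s"
  have dp: "dp X Y c F = (\<lambda>m. if m \<in> rng X \<union> rng Y then leafval X Y c F else F m)"
    using sep.hyps by (simp add: dp.simps[of X])
  have "repr s' (dp X Y c F) X"
    by (rule repr_const[OF wf(1)]) (auto simp: s'_def eq dp ne)
  moreover have "repr s' (dp X Y c F) Y"
    by (rule repr_const[OF wf(2)]) (auto simp: s'_def eq dp ne)
  moreover have "keeps (ids X \<union> ids Y) t s s'"
    using idn_ids[OF wf(1)] idn_ids[OF wf(2)] by (auto simp: keeps_def s'_def eq N_def R_def)
  moreover have "iter dp_cond dp_body (cnt X Y) s s'"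
    using sep.hyps sep.prems(8) by (simp add: cnt.simps[of X] dp_cond_def s'_def)
  moreover have "fst s' Sp 0 = t" by (simp add: s'_def eq)
  ultimately show ?case by blast
next
  case (swap X Y)
  define N R where "N = fst s" and "R = snd s"
  have s: "s = (N, R)" by (simp add: N_def R_def)
  have wf: "wf_tree X" "wf_tree Y" and lt: "lo X < k + l" "lo Y < k + l"
    using swap.prems(1,2) lo_le_hi[of X] lo_le_hi[of Y] by (auto simp: inseq_def)
  have root: "N Fs (idn X) = lo X" "R Len (idn X) = len X" "N Fs (idn Y) = lo Y" "R Len (idn Y) = len Y"
    using tr_root[OF swap.prems(4)] tr_root[OF swap.prems(5)] by (auto simp: N_def R_def)
  have fr: "N FX t = idn X" "N FY t = idn Y" "N FK t = 0" "R FC t = c" and sp: "N Sp 0 = Suc t"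
    using swap.prems(8,9) by (auto simp: frame_def N_def R_def)
  note eq = ceval_swap[where R = R, OF sp fr(3,1,2), unfolded root, OF lt refl swap.hyps(1)[unfolded sep_def] swap.hyps(2), folded s]
  define s' where "s' = ceval dp_body s"
  have kp: "keeps {} t s s'" by (auto simp: keeps_def s'_def eq N_def R_def)
  have "\<exists>s''. iter dp_cond dp_body (cnt Y X) s' s'' \<and> fst s'' Sp 0 = t \<and> repr s'' (dp Y X c F) Y \<and>
    repr s'' (dp Y X c F) X \<and> keeps (ids Y \<union> ids X) t s' s''"
  proof (rule swap.IH[OF swap.prems(2,1)])
    show "rng Y \<inter> rng X = {}" using swap.prems(3) by blast
    show "tr s' Y" "tr s' X" using keeps_tr[OF kp] wf swap.prems by auto
    show "repr s' F Y" "repr s' F X"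
      using keeps_repr[OF kp wf(2) swap.prems(7)] keeps_repr[OF kp wf(1) swap.prems(6)] by auto
    show "fst s' Sp 0 = Suc t" "frame s' t Y X c" using sp fr by (auto simp: s'_def eq frame_def)
  qed
  then obtain s'' where s'': "iter dp_cond dp_body (cnt Y X) s' s''" "fst s'' Sp 0 = t" "repr s'' (dp Y X c F) Y"
    "repr s'' (dp Y X c F) X" "keeps (ids Y \<union> ids X) t s' s''" by blast
  have "iter dp_cond dp_body (cnt X Y) s s''"
    using swap.hyps swap.prems(8) s''(1) by (simp add: cnt.simps[of X] dp_cond_def s'_def)
  moreover have "dp X Y c F = dp Y X c F" using swap.hyps by (simp add: dp.simps[of X])
  moreover have "keeps (ids X \<union> ids Y) t s s''" by (rule keeps_trans[OF kp s''(5)]) auto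
  ultimately show ?case using s''(2-4) by (intro exI[of _ s'']) simp
next
  case (split a b Y)
  let ?X = "Nd a b"
  define N R where "N = fst s" and "R = snd s"
  have s: "s = (N, R)" by (simp add: N_def R_def)
  have wf: "wf_tree ?X" "wf_tree Y" and lt: "lo ?X < k + l" "lo Y < k + l"
    using split.prems(1,2) lo_le_hi[of ?X] lo_le_hi[of Y] by (auto simp: inseq_def)
  have wf': "wf_tree a" "wf_tree b" using wf by auto
  note ab = inseq_Nd[OF split.prems(1)]
  note R_X = rng_Nd[OF wf(1)] rng_Nd_disj[OF wf(1)]
  have root: "N Fs (idn ?X) = lo ?X" "R Len (idn ?X) = len ?X" "N Fs (idn Y) = lo Y" "R Len (idn Y) = len Y"
    using tr_root[OF split.prems(4)] tr_root[OF split.prems(5)] by (auto simp: N_def R_def)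
  have disj: "ids ?X \<inter> ids Y = {}" by (rule ids_disjoint[OF wf split.prems(3)])
  note I = ids_Nd[OF wf(1)]
  have ida: "idn a \<in> ids a" "idn b \<in> ids b" "idn ?X \<in> ids ?X" using wf wf' by (auto simp del: idn.simps)
  have ne: "idn ?X \<noteq> idn a" "idn ?X \<noteq> idn b" "idn a \<noteq> idn b" using I ida by (auto simp del: idn.simps)
  have fr: "N FX t = idn ?X" "N FY t = idn Y" "N FK t = 0" "R FC t = c" and sp: "N Sp 0 = Suc t"
    using split.prems(8,9) by (auto simp: frame_def N_def R_def simp del: idn.simps)
  have ch: "N Lc (idn ?X) = idn a" "N Rc (idn ?X) = idn b" using split.prems(4) by (auto simp: N_def simp del: idn.simps)
  have tr: "tr s a" "tr s b" using split.prems(4) by (auto simp del: idn.simps)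
  let ?w = "dist (pt (lo ?X)) (pt (lo Y))"
  define R1 where "R1 = R(Dw := (R Dw)(0 := ?w))"
  define s1 where "s1 = ceval push_down (N, R1)"
  define N' R' where "N' = fst s1" and "R' = snd s1"
  have pd: "ceval push_down (N, R1) = (N', R')" by (simp add: N'_def R'_def s1_def)
  note eq1 = ceval_push_down[of N t, OF sp fr(1) ch ne, of R1, folded s1_def]
  have same: "N' Sp = N Sp" "N' FX = N FX" "N' FY = N FY" "N' FK = N FK" "N' Lc = N Lc" "N' Rc = N Rc" "R' FC = R FC"
      "N' Fs = N Fs" "N' Stk = N Stk" "R' Len = R Len"
    by (simp_all add: N'_def R'_def eq1 R1_def del: idn.simps)
  note eq = ceval_split[where R = R, OF sp fr(3,1,2), unfolded root, OF lt refl split.hyps(1)[unfolded sep_def] _ pd[unfolded R1_def] same(1-7) ch,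
      folded s]
  define s2 where "s2 = ceval dp_body s"
  have "\<not> len ?X < len Y" using split.hyps(2) by simp
  note eq = eq[OF this, folded s2_def]
  have repr1: "repr s1 F a \<and> repr s1 F b"
  proof (cases "N Lz (idn ?X) = 0")
    case True
    then have "repr s F a" "repr s F b" using split.prems(6) by (simp_all add: N_def del: idn.simps)
    then show ?thesis using wf' True
      by (auto intro!: repr_cong[of _ s F] simp: eq1 R1_def N_def R_def simp del: idn.simps)
  next
    case False
    then have "\<forall>m\<in>rng ?X. F m = R Mn (idn ?X)" using split.prems(6) by (simp add: N_def R_def del: idn.simps)
    then have "\<forall>m\<in>rng a. F m = R Mn (idn ?X)" "\<forall>m\<in>rng b. F m = R Mn (idn ?X)" using R_X by auto
    then show ?thesis using False wf' ne
      by (auto intro!: repr_const[of _ _ "R Mn (idn ?X)"] simp: eq1 R1_def simp del: idn.simps)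
  qed
  have repr2: "repr s2 F a" "repr s2 F b"
    by (rule repr_cong[of _ s1 F]; use repr1 wf' in \<open>simp add: eq N'_def R'_def del: idn.simps\<close>)+
  have Ls_a: "R' Ls (idn a) = F (hi a)" using repr_root[OF wf'(1)] repr1 by (simp add: R'_def)
  have kp2: "keeps (ids ?X) t s s2"
  proof -
    have "N' Lz i = N Lz i \<and> R' Mn i = R Mn i \<and> R' Ls i = R Ls i" if "i \<notin> ids ?X" for i
    proof -
      have "i \<noteq> idn a" "i \<noteq> idn b" using that I ida by auto
      then show ?thesis by (simp add: N'_def R'_def eq1 R1_def del: idn.simps)
    qed
    then show ?thesis using same by (auto simp: keeps_def eq N_def[symmetric] R_def[symmetric] simp del: idn.simps)
  qed
  have tr2: "tr s2 a" "tr s2 b" "tr s2 Y" "tr s2 ?X"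
    using keeps_tr[OF kp2] wf wf' tr split.prems(4,5) by blast+
  have reprY: "repr s2 F Y" by (rule keeps_repr[OF kp2 wf(2) split.prems(7)]) (use disj in auto)
  have fr2: "frame s2 (Suc (Suc t)) a Y c" "frame s2 (Suc t) b Y (F (hi a))" "fst s2 FK t = 1" "fst s2 FX t = idn ?X"
    "fst s2 Sp 0 = Suc (Suc (Suc t))"
    using fr Ls_a by (auto simp: frame_def eq simp del: idn.simps)
  have disjs: "rng a \<inter> rng Y = {}" "rng b \<inter> rng Y = {}" using split.prems(3) R_X by auto
  let ?Fa = "dp a Y c F"
  obtain s3 where s3: "iter dp_cond dp_body (cnt a Y) s2 s3" "fst s3 Sp 0 = Suc (Suc t)" "repr s3 ?Fa a"
    "repr s3 ?Fa Y" "keeps (ids a \<union> ids Y) (Suc (Suc t)) s2 s3"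
    using split.IH(1)[OF ab(1) split.prems(2) disjs(1) tr2(1,3) repr2(1) reprY fr2(5,1)] by blast
  have Fa_b: "?Fa m = F m" if "m \<in> rng b" for m
    by (rule dp_outside[OF wf'(1) wf(2) disjs(1)]) (use that R_X disjs in auto)
  have repr_b: "repr s3 ?Fa b"
    by (rule keeps_repr[OF s3(5) wf'(2) repr2(2)]) (use I disj Fa_b in auto)
  have tr3: "tr s3 b" "tr s3 Y" "tr s3 ?X" using keeps_tr[OF s3(5)] wf wf' tr2 by blast+
  have fr3: "frame s3 (Suc t) b Y (F (hi a))" using keeps_frame[OF s3(5) _ fr2(2)] by simp
  let ?Fb = "dp b Y (F (hi a)) ?Fa"
  obtain s4 where s4: "iter dp_cond dp_body (cnt b Y) s3 s4" "fst s4 Sp 0 = Suc t" "repr s4 ?Fb b"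
    "repr s4 ?Fb Y" "keeps (ids b \<union> ids Y) (Suc t) s3 s4"
    using split.IH(2)[OF ab(2) split.prems(2) disjs(2) tr3(1,2) repr_b s3(4,2) fr3] by blast
  have Fb_a: "?Fb m = ?Fa m" if "m \<in> rng a" for m
    by (rule dp_outside[OF wf'(2) wf(2) disjs(2)]) (use that R_X disjs in auto)
  have repr_a: "repr s4 ?Fb a"
    by (rule keeps_repr[OF s4(5) wf'(1) s3(3)]) (use I disj Fb_a in auto)
  have tr4: "tr s4 ?X" using keeps_tr[OF s4(5) wf(1) tr3(3)] .
  have fr4: "fst s4 FK t = 1" "fst s4 FX t = idn ?X" using s3(5) s4(5) fr2(3,4) by (auto simp: keeps_def simp del: idn.simps)
  define s5 where "s5 = ceval dp_body s4"
  have ch4: "fst s4 Lc (idn ?X) = idn a" "fst s4 Rc (idn ?X) = idn b" using tr4 by (simp_all del: idn.simps)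
  note eq5 = ceval_pull[of "fst s4", OF s4(2) fr4 ch4 ne(1,2), of "snd s4", unfolded prod.collapse, folded s5_def]
  have nY: "idn ?X \<notin> ids Y" using disj ida(3) by blast
  have repr5: "repr s5 ?Fb a" "repr s5 ?Fb b" "repr s5 ?Fb Y"
    by (rule repr_cong[of _ s4 ?Fb]; use repr_a s4(3,4) wf wf' I nY in \<open>auto simp: eq5 simp del: idn.simps\<close>)+
  \<comment> \<open>The pull has cleared the flag of the node, so the representation passes through
    its children again.\<close>
  have "repr s5 ?Fb ?X" using repr5 ne by (simp add: eq5 del: idn.simps)
  moreover have "dp ?X Y c F = ?Fb" using split.hyps by (simp add: dp.simps[of ?X])
  moreover have "keeps (ids ?X \<union> ids Y) t s s5"
  proof -
    have kp5: "keeps (ids ?X) t s4 s5" using ida(3) by (auto simp: keeps_def eq5 simp del: idn.simps)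
    have "keeps (ids ?X \<union> ids Y) t s s3" by (rule keeps_trans[OF kp2 s3(5)]) (use I in auto)
    then have "keeps (ids ?X \<union> ids Y) t s s4" by (rule keeps_trans[OF _ s4(5)]) (use I in auto)
    then show ?thesis by (rule keeps_trans[OF _ kp5]) auto
  qed
  moreover have "iter dp_cond dp_body (cnt ?X Y) s s5"
  proof -
    have "iter dp_cond dp_body 1 s4 s5" using s4(2) by (simp add: dp_cond_def s5_def)
    then have "iter dp_cond dp_body (cnt a Y + (cnt b Y + 1)) s2 s5"
      by (intro iter_add[OF s3(1)] iter_add[OF s4(1)])
    then show ?thesis using split.hyps split.prems(8) by (simp add: cnt.simps[of ?X] dp_cond_def s2_def)
  qed
  moreover have "fst s5 Sp 0 = t" by (simp add: eq5)
  ultimately show ?case using repr5(3) by (intro exI[of _ s5]) simp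
qed

end

section \<open>The whole program\<close>

abbreviation rootP :: nx where
  "rootP \<equiv> var RtP"

abbreviation rootQ :: nx where
  "rootQ \<equiv> NV Stk (NC 0)"

definition setup1 :: cx where
  "setup1 = SQ (SN Sp (NC 0) (NC 0)) (SQ (SN Mv (NC 0) (NC 0)) (SN Ev (NC 0) NK))"

text \<open>The second construction reuses the stack from entry 0, hence the root is saved;
  \<open>Mv\<close> already equals \<open>k\<close> after the first one.\<close>

definition setup2 :: cx where
  "setup2 = SQ (SN RtP (NC 0) rootQ) (SQ (SN Sp (NC 0) (NC 0)) (SN Ev (NC 0) (NP NK NQ)))"

text \<open>The corner before the start gets 0, everything else a finite substitute for infinity,
  which the lazy flags write to both whole curves in constant time.\<close>

definition setup3 :: cx where
  "setup3 =
     SQ (SD Dw (NC 0) (NC 0) NK)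
    (SQ (SR Mn rootP (RP (RT (RC 2) (RP (RP (RV Len rootP) (RV Len rootQ)) (RV Dw (NC 0)))) (RC 1)))
    (SQ (SR Ls rootP (RV Mn rootP))
    (SQ (SN Lz rootP (NC 1))
    (SQ (SR Mn rootQ (RV Mn rootP))
    (SQ (SR Ls rootQ (RV Mn rootP))
    (SQ (SN Lz rootQ (NC 1))
    (SQ (SN FX (NC 0) rootP)
    (SQ (SN FY (NC 0) rootQ)
    (SQ (SR FC (NC 0) (RC 0))
    (SQ (SN FK (NC 0) (NC 0))
        (SN Sp (NC 0) (NC 1))))))))))))"

definition init_prog :: "nat \<Rightarrow> com" where
  "init_prog d = NStore (NConst 2) (NAdd (NConst 1) (ntimes d (NAdd (NLoad (NConst 0)) (NLoad (NConst 1)))))"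

text \<open>The recursion may underestimate; the factor \<open>1 + eps / 2\<close> of
  \<open>dp_sound\<close> makes up for it. Cell 0 still holds the accuracy parameter when it is read
  here.\<close>

definition output_prog :: com where
  "output_prog = RStore (NConst 0)
     (RMul (RAdd (RConst 1) (RDiv (RLoad (NConst 0)) (RConst 2))) (rcomp (RV Ls rootQ)))"

definition while_prog :: "nat \<Rightarrow> bx \<Rightarrow> cx \<Rightarrow> com" where
  "while_prog d b p = While (bcomp b) (ccomp d p)"

definition frechet_prog :: "nat \<Rightarrow> com" where
  "frechet_prog d =
     Seq (init_prog d)
    (Seq (ccomp d setup1)
    (Seq (while_prog d build_cond build_body)
    (Seq (ccomp d setup2)
    (Seq (while_prog d build_cond build_body)
    (Seq (ccomp d setup3)
    (Seq (while_prog d dp_cond dp_body)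
         output_prog))))))"

definition time_const :: "nat \<Rightarrow> nat" where
  "time_const d = maxcost (init_prog d) + maxcost (ccomp d setup1) + maxcost (ccomp d setup2) +
     maxcost (ccomp d setup3) + maxcost output_prog"

context two_curves
begin

lemma segments: "segment 0 k" "segment k (k + l)"
  using k_pos l_pos by (auto simp: segment_def lst_def)

lemma iter_unchanged:
  "iter b p n s s' \<Longrightarrow> (\<And>s. fst (ceval p s) f = fst s f) \<Longrightarrow> fst s' f = fst s f"
proof (induction n arbitrary: s)
  case (Suc n)
  then show ?case using Suc.IH[of "ceval p s"] by simp
qed simp

lemma build_body_RtP: "fst (ceval build_body s) RtP = fst s RtP"
  by (simp add: build_body_def merge_prog_def push_prog_def)

lemma ceval_setup3:
  assumes "N RtP 0 = ip" "N Stk 0 = iq" "ip \<noteq> iq" "w = dist (pt 0) (pt k)" "M = 2 * (R Len ip + R Len iq + w) + 1"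
  shows "ceval setup3 (N, R) =
    (N(Lz := (N Lz)(ip := 1, iq := 1), FX := (N FX)(0 := ip), FY := (N FY)(0 := iq), FK := (N FK)(0 := 0),
       Sp := (N Sp)(0 := 1)),
     R(Dw := (R Dw)(0 := w), Mn := (R Mn)(ip := M, iq := M), Ls := (R Ls)(ip := M, iq := M), FC := (R FC)(0 := 0)))"
proof -
  have "0 < k + l" "k < k + l" using k_pos l_pos by auto
  then show ?thesis using assms(1-4) by (simp add: setup3_def assms(5) fun_eq_iff)
qed

lemma abstract_run:
  obtains S T n1 n2 s1 s2 s3 where
    "full S T" "balanced S" "balanced T" "n1 \<le> 2 * k" "n2 \<le> 2 * l"
    "iter build_cond build_body n1 (ceval setup1 s0) s1" "\<not> beval build_cond s1"
    "iter build_cond build_body n2 (ceval setup2 s1) s2" "\<not> beval build_cond s2"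
    "iter dp_cond dp_body (cnt S T) (ceval setup3 s2) s3" "\<not> beval dp_cond s3"
    "snd s3 Ls (fst s3 Stk 0) = dp S T 0 (\<lambda>_. 2 * (len S + len T + dist (pt 0) (pt k)) + 1) (hi T)"
proof -
  obtain n1 s1 S where 1: "n1 \<le> 2 * (k - 0)" "iter build_cond build_body n1 (ceval setup1 s0) s1"
      "\<not> beval build_cond s1"
    and S: "wf_tree S" "balanced S" "lo S = 0" "Suc (hi S) = k" "tr s1 S" "fst s1 Stk 0 = idn S" "fst s1 Mv 0 = k"
    using build_correct[OF segments(1), of "ceval setup1 s0" "{}"] by (auto simp: setup1_def)
  have "tr (ceval setup2 s1) S" by (rule tr_cong[OF S(1,5)]) (simp add: setup2_def)
  then obtain n2 s2 T where 2: "n2 \<le> 2 * (k + l - k)" "iter build_cond build_body n2 (ceval setup2 s1) s2"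
      "\<not> beval build_cond s2"
    and T: "wf_tree T" "balanced T" "lo T = k" "Suc (hi T) = k + l" "tr s2 T" "fst s2 Stk 0 = idn T" "tr s2 S"
    using build_correct[OF segments(2), of "ceval setup2 s1" "{S}"] S by (auto simp: setup2_def)
  have RtP: "fst s2 RtP 0 = idn S"
    using iter_unchanged[OF 2(2) build_body_RtP] S(6) by (simp add: setup2_def)
  have ST: "full S T" using S T by (simp add: full_def)
  have disj: "rng S \<inter> rng T = {}" using rng_full[OF ST] by auto
  have ne: "idn S \<noteq> idn T" using ids_disjoint[OF S(1) T(1) disj] idn_ids[OF S(1)] idn_ids[OF T(1)] by auto
  let ?w = "dist (pt 0) (pt k)"
  let ?M = "2 * (len S + len T + ?w) + 1"
  have "?M = 2 * (snd s2 Len (idn S) + snd s2 Len (idn T) + ?w) + 1" using tr_root[OF T(5)] tr_root[OF T(7)] by simp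
  note eq = ceval_setup3[where N = "fst s2" and R = "snd s2", OF RtP T(6) ne refl this, unfolded prod.collapse]
  define s where "s = ceval setup3 s2"
  have "tr s S" by (rule tr_cong[OF S(1) T(7)]) (simp add: s_def eq)
  moreover have "tr s T" by (rule tr_cong[OF T(1,5)]) (simp add: s_def eq)
  moreover have "repr s (\<lambda>_. ?M) S" by (rule repr_const[OF S(1)]) (auto simp: s_def eq)
  moreover have "repr s (\<lambda>_. ?M) T" by (rule repr_const[OF T(1)]) (auto simp: s_def eq)
  moreover have "fst s Sp 0 = Suc 0" "frame s 0 S T 0" using RtP T(6) by (simp_all add: s_def eq frame_def)
  moreover have "inseq S" "inseq T" using full_inseq[OF ST] by auto
  ultimately obtain s3 where s3: "iter dp_cond dp_body (cnt S T) s s3" "fst s3 Sp 0 = 0"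
    "repr s3 (dp S T 0 (\<lambda>_. ?M)) T" "keeps (ids S \<union> ids T) 0 s s3"
    using iter_dp[of S T s "\<lambda>_. ?M" 0 0] disj by blast
  have "fst s3 Stk 0 = idn T" using s3(4) T(6) by (simp add: keeps_def s_def eq)
  then have "snd s3 Ls (fst s3 Stk 0) = dp S T 0 (\<lambda>_. ?M) (hi T)" using repr_root[OF T(1) s3(3)] by simp
  moreover have "\<not> beval dp_cond s3" using s3(2) by (simp add: dp_cond_def)
  ultimately show ?thesis
    using that[OF ST S(2) T(2) _ _ 1(2,3) 2(2,3)] 1(1) 2(1) s3(1) unfolding s_def by simp
qed

text \<open>The trees have \<open>k + l - 2\<close> inner nodes together. Each has a share of at
  most \<open>3 * 10 * c / eps\<close>, from the two constants of \<open>share\<close> and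
  packedness, plus 1 for the last vertex of the other curve.\<close>

lemma cnt_bound:
  assumes ST: "full S T" and bal: "balanced S" "balanced T" and c: "0 < c"
    and packed: "\<And>z r. 0 < r \<Longrightarrow> (\<Sum>m<k. inball z r m) \<le> c * r"
      "\<And>z r. 0 < r \<Longrightarrow> (\<Sum>m\<in>{k..<k + l}. inball z r m) \<le> c * r"
  shows "real (cnt S T) \<le> 5 * real (k + l - 2) * (30 * c / eps + 1) + 2"
proof -
  have in_seq: "inseq S" "inseq T" using full_inseq[OF ST] by auto
  have wf: "wf_tree S" "wf_tree T" and eqs: "lo S = 0" "Suc (hi S) = k" "lo T = k" "Suc (hi T) = k + l"
    using ST by (auto simp: full_def)
  have *: "share I Y \<le> 30 * c / eps + 1"
    if "0 < len I" "\<And>z r. 0 < r \<Longrightarrow> (\<Sum>m\<in>rng Y. inball z r m) \<le> c * r" for I Y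
  proof -
    let ?r = "10 / eps * len I"
    have "0 < ?r" using that(1) eps_pos by simp
    then have "3 / len I * (\<Sum>m\<in>rng Y. inball (pt (lo I)) ?r m) \<le> 3 / len I * (c * ?r)"
      by (intro mult_left_mono that(2) \<open>0 < ?r\<close>) (use that(1) in simp)
    also have "\<dots> = 30 * c / eps" using that(1) eps_pos by (simp add: field_simps)
    finally show ?thesis by (simp add: share_def)
  qed
  have len: "0 < len (Nd a b)" if "Nd a b \<in> subs S \<or> Nd a b \<in> subs T" for a b
    using that inseq_subs in_seq len_pos by blast
  have "isum (\<lambda>I. share I T) S \<le> real (hi S - lo S) * (30 * c / eps + 1)"
    by (rule isum_le[OF wf(1)]) (use * len packed(2) rng_full[OF ST] in simp)
  moreover have "isum (\<lambda>I. share I S) T \<le> real (hi T - lo T) * (30 * c / eps + 1)"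
    by (rule isum_le[OF wf(2)]) (use * len packed(1) rng_full[OF ST] in simp)
  moreover have "real (k + l - 2) = real (hi S - lo S) + real (hi T - lo T)"
  proof -
    have "k + l - 2 = (hi S - lo S) + (hi T - lo T)" using eqs k_pos l_pos by linarith
    then show ?thesis by (simp only: of_nat_add)
  qed
  ultimately have "potential S T \<le> real (k + l - 2) * (30 * c / eps + 1)"
    unfolding potential_def by (simp only: distrib_right)
  moreover have "real (cnt S T) \<le> 5 * potential S T + 1 + (if len S < len T then 1 else 0)"
    by (rule cnt_le_potential[OF in_seq bal]) (simp_all add: lst_def eqs)
  moreover have "(if len S < len T then 1 else (0::real)) \<le> 1" by simp
  ultimately have "real (cnt S T) \<le> 5 * (real (k + l - 2) * (30 * c / eps + 1)) + 2" by linarith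
  then show ?thesis by simp
qed

end

lemma (in ram_input) exec_frechet_prog:
  assumes inp: "fst s 0 = k" "fst s 1 = l" "snd s 0 = eps"
    "\<And>m t. m < k + l \<Longrightarrow> t < d \<Longrightarrow> snd s (Suc t + d * m) = co m t"
  obtains S T t s' where "full S T" "balanced S" "balanced T" "exec (frechet_prog d) s t s'"
    "ram_output s' = (1 + eps / 2) * dp S T 0 (\<lambda>_. 2 * (len S + len T + dist (pt 0) (pt k)) + 1) (hi T)"
    "t \<le> time_const d + (2 * (k + l) + 2) * loopcost d build_cond build_body + Suc (cnt S T) * loopcost d dp_cond dp_body"
proof -
  obtain u1 where u1: "exec (init_prog d) s (maxcost (init_prog d)) u1" "ok u1"
  proof
    show "exec (init_prog d) s (maxcost (init_prog d)) ((fst s)(2 := base), snd s)"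
      using exec.NStore[of "NConst 2" "NAdd (NConst 1) (ntimes d (NAdd (NLoad (NConst 0)) (NLoad (NConst 1))))" s] inp
      by (simp add: init_prog_def base_def)
    show "ok ((fst s)(2 := base), snd s)" using inp by (simp add: ok_def)
  qed
  obtain t2 u2 where u2: "exec (ccomp d setup1) u1 t2 u2" "t2 \<le> maxcost (ccomp d setup1)" "ok u2"
    "view u2 = ceval setup1 (view u1)" using exec_ccomp[OF u1(2)] by blast
  obtain S T n1 n2 s1 s2 s3 where ST: "full S T" "balanced S" "balanced T" and n: "n1 \<le> 2 * k" "n2 \<le> 2 * l"
    and 1: "iter build_cond build_body n1 (ceval setup1 (view u1)) s1" "\<not> beval build_cond s1"
    and 2: "iter build_cond build_body n2 (ceval setup2 s1) s2" "\<not> beval build_cond s2"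
    and 3: "iter dp_cond dp_body (cnt S T) (ceval setup3 s2) s3" "\<not> beval dp_cond s3"
    and out: "snd s3 Ls (fst s3 Stk 0) = dp S T 0 (\<lambda>_. 2 * (len S + len T + dist (pt 0) (pt k)) + 1) (hi T)"
    by (rule abstract_run)
  obtain t3 u3 where u3: "exec (while_prog d build_cond build_body) u2 t3 u3"
    "t3 \<le> Suc n1 * loopcost d build_cond build_body" "ok u3" "view u3 = s1"
    using exec_while[OF u2(3) _ 1(2), of build_body n1] 1(1) u2(4) unfolding while_prog_def by auto
  obtain t4 u4 where u4: "exec (ccomp d setup2) u3 t4 u4" "t4 \<le> maxcost (ccomp d setup2)" "ok u4"
    "view u4 = ceval setup2 (view u3)" using exec_ccomp[OF u3(3)] by blast
  obtain t5 u5 where u5: "exec (while_prog d build_cond build_body) u4 t5 u5"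
    "t5 \<le> Suc n2 * loopcost d build_cond build_body" "ok u5" "view u5 = s2"
    using exec_while[OF u4(3) _ 2(2), of build_body n2] 2(1) u4(4) u3(4) unfolding while_prog_def by auto
  obtain t6 u6 where u6: "exec (ccomp d setup3) u5 t6 u6" "t6 \<le> maxcost (ccomp d setup3)" "ok u6"
    "view u6 = ceval setup3 (view u5)" using exec_ccomp[OF u5(3)] by blast
  obtain t7 u7 where u7: "exec (while_prog d dp_cond dp_body) u6 t7 u7"
    "t7 \<le> Suc (cnt S T) * loopcost d dp_cond dp_body" "ok u7" "view u7 = s3"
    using exec_while[OF u6(3) _ 3(2), of dp_body "cnt S T"] 3(1) u6(4) u5(4) unfolding while_prog_def by auto
  define r where "r = RMul (RAdd (RConst 1) (RDiv (RLoad (NConst 0)) (RConst 2))) (rcomp (RV Ls rootQ))"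
  have "rval (rcomp (RV Ls rootQ)) u7 = snd s3 Ls (fst s3 Stk 0)"
    unfolding rval_rcomp[OF u7(3)] u7(4) by simp
  then have r: "rval r u7 = (1 + eps / 2) * snd s3 Ls (fst s3 Stk 0)"
    using u7(3) by (simp add: r_def ok_def del: rcomp.simps)
  define u8 where "u8 = (fst u7, (snd u7)(0 := rval r u7))"
  have u8: "exec output_prog u7 (maxcost output_prog) u8"
    using exec.RStore[of "NConst 0" r u7] by (simp add: output_prog_def u8_def r_def[symmetric] del: rcomp.simps)
  have "exec (frechet_prog d) s (maxcost (init_prog d) + (t2 + (t3 + (t4 + (t5 + (t6 + (t7 + maxcost output_prog))))))) u8"
    unfolding frechet_prog_def
    by (intro exec.Seq[OF u1(1)] exec.Seq[OF u2(1)] exec.Seq[OF u3(1)] exec.Seq[OF u4(1)] exec.Seq[OF u5(1)]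
        exec.Seq[OF u6(1)] exec.Seq[OF u7(1)] u8)
  moreover have "ram_output u8 = (1 + eps / 2) * dp S T 0 (\<lambda>_. 2 * (len S + len T + dist (pt 0) (pt k)) + 1) (hi T)"
    by (simp add: ram_output_def u8_def r out)
  moreover have "maxcost (init_prog d) + (t2 + (t3 + (t4 + (t5 + (t6 + (t7 + maxcost output_prog))))))
    \<le> time_const d + (2 * (k + l) + 2) * loopcost d build_cond build_body + Suc (cnt S T) * loopcost d dp_cond dp_body"
  proof -
    have "t3 + t5 \<le> (Suc n1 + Suc n2) * loopcost d build_cond build_body" using u3(2) u5(2) by (simp add: add_mult_distrib)
    also have "\<dots> \<le> (2 * (k + l) + 2) * loopcost d build_cond build_body" using n by (intro mult_le_mono1) simp
    finally show ?thesis using u2(2) u4(2) u6(2) u7(2) unfolding time_const_def by linarith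
  qed
  ultimately show ?thesis using that ST by blast
qed

section \<open>Input format\<close>

lemma coords_eq:
  "\<exists>js :: 'n::finite list. distinct js \<and> set js = UNIV \<and> length js = CARD('n) \<and>
    (\<forall>x :: real ^ 'n. coords x = map (\<lambda>i. x $ i) js)"
proof -
  define js where "js = (SOME js :: 'n list. distinct js \<and> set js = UNIV)"
  have "\<exists>js :: 'n list. distinct js \<and> set js = UNIV"
    using finite_distinct_list[OF finite_class.finite_UNIV] by blast
  then have "distinct js \<and> set js = UNIV" unfolding js_def by (rule someI_ex)
  moreover from this have "length js = CARD('n)" using distinct_card[of js] by simp
  ultimately show ?thesis by (intro exI[of _ js]) (simp add: coords_def js_def)
qed

lemma length_coords: "length (coords (x :: real ^ 'n::finite)) = CARD('n)"
  using coords_eq[where 'n = 'n] by (metis length_map)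

lemma dist_coords:
  fixes x y :: "real ^ 'n::finite"
  shows "dist x y = sqrt (\<Sum>t<CARD('n). (coords x ! t - coords y ! t)\<^sup>2)"
proof -
  obtain js :: "'n list" where js: "distinct js" "set js = UNIV" "length js = CARD('n)"
    "\<And>x :: real ^ 'n. coords x = map (\<lambda>i. x $ i) js" using coords_eq by metis
  have "(\<Sum>i\<in>UNIV. (x $ i - y $ i)\<^sup>2) = sum_list (map (\<lambda>i. (x $ i - y $ i)\<^sup>2) js)"
    using js by (simp add: sum_list_distinct_conv_sum_set)
  also have "\<dots> = (\<Sum>t<CARD('n). (coords x ! t - coords y ! t)\<^sup>2)"
    using js by (simp add: sum_list_sum_nth atLeast0LessThan)
  finally show ?thesis by (simp add: dist_vec_def L2_set_def dist_real_def)
qed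

lemma concat_nth_same_length:
  assumes "\<And>x. length (f x) = d" "m < length xs" "t < d"
  shows "concat (map f xs) ! (t + d * m) = f (xs ! m) ! t" "t + d * m < length (concat (map f xs))"
proof -
  have "concat (map f xs) ! (t + d * m) = f (xs ! m) ! t \<and> t + d * m < length (concat (map f xs))"
    using assms(2)
  proof (induction xs arbitrary: m)
    case (Cons x xs)
    show ?case
    proof (cases m)
      case 0
      then show ?thesis using assms by (simp add: nth_append)
    next
      case (Suc m')
      then show ?thesis using Cons.IH[of m'] Cons.prems assms(1) by (simp add: nth_append)
    qed
  qed simp
  then show "concat (map f xs) ! (t + d * m) = f (xs ! m) ! t" "t + d * m < length (concat (map f xs))" by auto
qed

lemma input_state_coords:
  fixes P Q :: "(real ^ 'n::finite) list"
  assumes "m < length P + length Q" "t < CARD('n)"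
  shows "snd (input_state \<epsilon> P Q) (Suc t + CARD('n) * m) = coords ((P @ Q) ! m) ! t"
  using concat_nth_same_length[of coords "CARD('n)" m "P @ Q" t, OF length_coords] assms
  by (simp add: input_state_def load_list_def)

section \<open>The running time\<close>

text \<open>The ball around the first vertex that just reaches the second one contains the whole
  first edge.\<close>

lemma packed_ge_1:
  assumes "packed c P" "point_sequence P" "2 \<le> length P"
  shows "1 \<le> c"
proof -
  let ?r = "dist (P ! 0) (P ! 1)"
  let ?g = "\<lambda>i. measure lborel {t \<in> {0..1}. linepath (P ! i) (P ! Suc i) t \<in> cball (P ! 0) ?r} * dist (P ! i) (P ! Suc i)"
  have r: "0 < ?r" using assms by (simp add: point_sequence_def)
  have "?r \<le> ?g 0" using length_in_cball_ge[of "P ! 0" "P ! 0" ?r ?r "P ! 1"] by simp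
  also have "\<dots> \<le> (\<Sum>i<length P - 1. ?g i)" using assms(3) by (intro member_le_sum) auto
  also have "\<dots> \<le> c * ?r" using assms(1) r by (simp add: packed_def length_in_ball_def)
  finally show ?thesis using r by simp
qed

context two_sequences
begin

lemma sum_inball_P: "(\<Sum>m<length P. inball z r m) = length_in_ball P z r"
proof -
  obtain k where k: "length P = Suc k" using k_pos by (cases "length P") auto
  have "inball z r m = measure lborel {t \<in> {0..1}. linepath (P ! m) (P ! Suc m) t \<in> cball z r} * dist (P ! m) (P ! Suc m)"
    if "m < k" for m
    unfolding inball_def lst_def using that k by (simp add: nth_append)
  moreover have "inball z r k = 0" unfolding inball_def lst_def using k by simp
  ultimately show ?thesis by (simp add: k length_in_ball_def)
qed

lemma sum_inball_Q: "(\<Sum>m\<in>{length P..<length P + length Q}. inball z r m) = length_in_ball Q z r"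
proof -
  obtain l where l: "length Q = Suc l" using l_pos by (cases "length Q") auto
  have "(\<Sum>m\<in>{length P..<length P + length Q}. inball z r m) = (\<Sum>m<length Q. inball z r (length P + m))"
    by (rule sum.reindex_bij_witness[of _ "\<lambda>m. length P + m" "\<lambda>m. m - length P"]) auto
  moreover have "inball z r (length P + m) =
      measure lborel {t \<in> {0..1}. linepath (Q ! m) (Q ! Suc m) t \<in> cball z r} * dist (Q ! m) (Q ! Suc m)"
    if "m < l" for m
    unfolding inball_def lst_def using that l k_pos by (simp add: nth_append)
  moreover have "inball z r (length P + l) = 0" unfolding inball_def lst_def using l by simp
  ultimately show ?thesis by (simp add: l length_in_ball_def)
qed

end

text \<open>For \<open>n = 2\<close> the term with \<open>n - 2\<close> vanishes and the maximum
  with 1 covers the rest, however small \<open>c\<close> is. Otherwise \<open>1 \<le> c\<close> lets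
  \<open>n\<close> be absorbed into \<open>c * n / eps\<close>. The constants are
  \<open>6 = 2 * 2 + 2\<close> and \<open>158 = 5 * 31 + 2 + 1\<close>.\<close>

lemma time_bound:
  fixes n :: nat and c eps :: real
  assumes "2 \<le> n" "0 < c" "0 < eps" "eps < 1" "3 \<le> n \<Longrightarrow> 1 \<le> c"
    and "t \<le> K + (2 * n + 2) * LB + Suc m * LD" and m: "real m \<le> 5 * real (n - 2) * (30 * c / eps + 1) + 2"
  shows "real t \<le> (real K + 6 * real LB + 158 * real LD) * max 1 (c * real n / eps)"
proof -
  let ?x = "max 1 (c * real n / eps)"
  have "real n \<le> 2 * ?x \<and> real (n - 2) * (30 * c / eps + 1) \<le> 31 * ?x"
  proof (cases "n = 2")
    case False
    then have "1 \<le> c" using assms(1,5) by simp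
    then have "1 \<le> c / eps" using assms(3,4) by simp
    then have n: "real n * 1 \<le> real n * (c / eps)" by (intro mult_left_mono) auto
    have "0 \<le> 30 * c / eps + 1" using assms(2,3) by simp
    then have "real (n - 2) * (30 * c / eps + 1) \<le> real n * (30 * c / eps + 1)" by (intro mult_right_mono) auto
    also have "\<dots> = 30 * (real n * (c / eps)) + real n" by (simp add: algebra_simps)
    finally have "real (n - 2) * (30 * c / eps + 1) \<le> 30 * (real n * (c / eps)) + real n" .
    moreover have "a \<le> 2 * z \<and> b \<le> 31 * z" if "a * 1 \<le> y" "b \<le> 30 * y + a" "y \<le> z" "1 \<le> z" for a b y z :: real
      using that by simp
    moreover have "1 \<le> ?x" by simp
    moreover have "real n * (c / eps) \<le> ?x" by (simp add: mult.commute)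
    ultimately show ?thesis using n by blast
  qed simp
  then have x: "1 \<le> ?x" "real n \<le> 2 * ?x" "real (n - 2) * (30 * c / eps + 1) \<le> 31 * ?x" by auto
  have "real (2 * n + 2) \<le> 6 * ?x" using x by simp
  moreover have "real (Suc m) \<le> 158 * ?x"
  proof -
    have "real m \<le> 5 * (real (n - 2) * (30 * c / eps + 1)) + 2" using m by (simp add: mult.assoc)
    then show ?thesis using x by simp
  qed
  ultimately have "real K + real (2 * n + 2) * real LB + real (Suc m) * real LD
      \<le> real K * ?x + 6 * ?x * real LB + 158 * ?x * real LD"
    using x(1) by (intro add_mono mult_right_mono) (auto simp: mult_le_cancel_left1)
  moreover have "real t \<le> real (K + (2 * n + 2) * LB + Suc m * LD)" using assms(6) by (simp only: of_nat_le_iff)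
  ultimately show ?thesis by (simp add: algebra_simps)
qed

theorem theorem5p4:
  shows "\<exists>(p :: com) (C :: real). \<forall>(\<epsilon> :: real) (c :: real) (P :: (real ^ 'n) list) (Q :: (real ^ 'n) list).
    0 < \<epsilon> \<longrightarrow> \<epsilon> < 1 \<longrightarrow> 0 < c \<longrightarrow>
    point_sequence P \<longrightarrow> point_sequence Q \<longrightarrow> packed c P \<longrightarrow> packed c Q \<longrightarrow>
    (\<exists>t s. exec p (input_state \<epsilon> P Q) t s \<and>
       strong_frechet P Q \<le> ram_output s \<and> ram_output s \<le> (1 + \<epsilon>) * strong_frechet P Q \<and>
       real t \<le> C * max 1 (c * real (length P + length Q) / \<epsilon>))"
proof (rule exI[of _ "frechet_prog CARD('n)"], rule exI[of _ "real (time_const CARD('n)) +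
    6 * real (loopcost CARD('n) build_cond build_body) + 158 * real (loopcost CARD('n) dp_cond dp_body)"],
    intro allI impI)
  fix \<epsilon> c :: real and P Q :: "(real ^ 'n) list"
  assume eps: "0 < \<epsilon>" "\<epsilon> < 1" and c: "0 < c" and PQ: "point_sequence P" "point_sequence Q"
    and packed: "packed c P" "packed c Q"
  let ?d = "CARD('n)"
  interpret two_sequences P Q \<epsilon> using eps PQ by unfold_locales
  interpret ram_input "length P" "length Q" \<epsilon> "\<lambda>m. (P @ Q) ! m" ?d "\<lambda>m t. coords ((P @ Q) ! m) ! t"
    by unfold_locales (rule dist_coords)
  have inp: "fst (input_state \<epsilon> P Q) 0 = length P" "fst (input_state \<epsilon> P Q) 1 = length Q" "snd (input_state \<epsilon> P Q) 0 = \<epsilon>"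
    by (simp_all add: input_state_def load_list_def)
  obtain S T t s where ST: "full S T" "balanced S" "balanced T"
    and run: "exec (frechet_prog ?d) (input_state \<epsilon> P Q) t s"
    and out: "ram_output s = (1 + \<epsilon> / 2) *
      dp S T 0 (\<lambda>_. 2 * (len S + len T + dist ((P @ Q) ! 0) ((P @ Q) ! length P)) + 1) (hi T)"
    and t: "t \<le> time_const ?d + (2 * (length P + length Q) + 2) * loopcost ?d build_cond build_body +
      Suc (cnt S T) * loopcost ?d dp_cond dp_body"
    by (rule exec_frechet_prog[OF inp input_state_coords])
  let ?M = "2 * (len S + len T + dist ((P @ Q) ! 0) ((P @ Q) ! length P)) + 1"
  define v where "v = dp S T 0 (\<lambda>_. ?M) (hi T)"
  have M: "2 * (len S + len T + dist (P ! 0) (Q ! 0)) + 1 \<le> ?M" using k_pos by (simp add: nth_append)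
  have "0 \<le> v"
    unfolding v_def
  proof (rule dp_nonneg)
    show "wf_tree S" "wf_tree T" using ST(1) by (auto simp: full_def)
    show "rng S \<inter> rng T = {}" using rng_full[OF ST(1)] by auto
  qed (simp_all add: len_nonneg)
  note approx = dp_approx[OF ST(1) M v_def this]
  have "real (cnt S T) \<le> 5 * real (length P + length Q - 2) * (30 * c / \<epsilon> + 1) + 2"
    using packed by (intro cnt_bound[OF ST c]) (simp_all add: sum_inball_P sum_inball_Q packed_def)
  \<comment> \<open>With three vertices in all, one of the curves has an edge.\<close>
  moreover have "1 \<le> c" if "3 \<le> length P + length Q"
  proof (cases "2 \<le> length P")
    case True
    then show ?thesis using packed_ge_1 packed PQ by blast
  next
    case False
    then have "2 \<le> length Q" using that by simp
    then show ?thesis using packed_ge_1 packed PQ by blast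
  qed
  moreover have "2 \<le> length P + length Q" using k_pos l_pos by linarith
  ultimately have "real t \<le> (real (time_const ?d) + 6 * real (loopcost ?d build_cond build_body) +
      158 * real (loopcost ?d dp_cond dp_body)) * max 1 (c * real (length P + length Q) / \<epsilon>)"
    using time_bound[of "length P + length Q" c \<epsilon> t, OF _ c eps _ t] by blast
  then show "\<exists>t s. exec (frechet_prog ?d) (input_state \<epsilon> P Q) t s \<and>
       strong_frechet P Q \<le> ram_output s \<and> ram_output s \<le> (1 + \<epsilon>) * strong_frechet P Q \<and>
       real t \<le> (real (time_const ?d) + 6 * real (loopcost ?d build_cond build_body) +
      158 * real (loopcost ?d dp_cond dp_body)) * max 1 (c * real (length P + length Q) / \<epsilon>)"
    using run approx unfolding v_def out[symmetric] by blast
qed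

end
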